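(* Let $k\in\frac{2\pi}{2N}\Lambda$ and $l\in\frac{2\pi}{\beta}\mathbb{Z}$. Then $$\hat c^\beta_\Lambda(k,l)\le \frac{48}{2\lambda\hat L(k)+l^2/(2\delta)},$$ where $\hat L(k)=\sum_{j=1}^d(1-\cos k_j)$.
   Context: Let $d,N\ge 1$ be integers and $\Lambda=(\mathbb{Z}/2N)^d$ the $d$-dimensional torus of side $2N$, with vertex set identified with $\{0,1,\dots,2N-1\}^d$ and nearest-neighbour adjacency $x\sim y$ ($x$ and $y$ differ by $\pm1$ modulo $2N$ in exactly one coordinate). Sums over $x\sim y$ are over unordered adjacent pairs; when $N=1$ each adjacent pair is counted twice, so that $\Lambda$ is $2d$-regular. $\frac{2\pi}{2N}\Lambda$ is the set of $k=(k_1,\dots,k_d)$ with $k_j\in\frac{2\pi}{2N}\mathbb{Z}$ modulo $2\pi$. Fix $\lambda>0$, $\delta>0$ and $0<\beta<\infty$. Let $E$ be a probability measure governing two independent collections: (i) $D=(D_x:x\in\Lambda)$, independent Poisson processes of intensity $\delta$ on $[0,\beta)$, each conditioned on the number of points $|D_x|$ being even; (ii) $\xi=(\xi_x:x\in\Lambda)$, independent random variables equal to $0$ or $1$ with probability $1/2$ each. Put $\sigma(x,t)=(-1)^{\xi_x+|D_x\cap[0,t]|}$ for $x\in\Lambda$, $t\in[0,\beta)$ (this is well defined on the circle of length $\beta$). The space--time Ising measure $\mu^\beta_\Lambda$ is the law on configurations $\sigma$ whose expectation is $$\mu^\beta_\Lambda(f)=\frac{1}{Z^\beta_\Lambda}E\Big[f(\sigma)\exp\Big(\lambda\sum_{x\sim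 y}\int_0^\beta\sigma(x,t)\sigma(y,t)\,dt\Big)\Big],\quad Z^\beta_\Lambda=E\Big[\exp\Big(\lambda\sum_{x\sim y}\int_0^\beta\sigma(x,t)\sigma(y,t)\,dt\Big)\Big].$$ The Schwinger function is $c^\beta_\Lambda((x,s),(y,t))=\mu^\beta_\Lambda(\sigma(x,s)\sigma(y,t))$, $0\le s,t<\beta$, and its Fourier transform is $$\hat c^\beta_\Lambda(k,l)=\sum_{x\in\Lambda}\int_0^\beta c^\beta_\Lambda((0,0),(x,t))\,e^{ik\cdot x}e^{ilt}\,dt .$$ When $(k,l)=(0,0)$ the right-hand side of the bound is read as $+\infty$. *)

theory Defs
  imports "HOL-Probability.Probability" "HOL-Number_Theory.Cong"
begin

section \<open>The torus\<close>

type_synonym vertex = "nat \<Rightarrow> nat"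

definition torus :: "nat \<Rightarrow> nat \<Rightarrow> vertex set" where
  "torus d N = {1..d} \<rightarrow>\<^sub>E {0..<2 * N}"

definition origin :: "nat \<Rightarrow> vertex" where
  "origin d = (\<lambda>j\<in>{1..d}. 0)"

definition adjacent :: "nat \<Rightarrow> nat \<Rightarrow> vertex \<Rightarrow> vertex \<Rightarrow> bool" where
  "adjacent d N x y \<longleftrightarrow>
     (\<exists>j\<in>{1..d}. ([y j = x j + 1] (mod 2 * N) \<or> [x j = y j + 1] (mod 2 * N)) \<and>
                 (\<forall>i\<in>{1..d}. i \<noteq> j \<longrightarrow> x i = y i))"

definition edges :: "nat \<Rightarrow> nat \<Rightarrow> vertex set set" where
  "edges d N = {{x, y} |x y. x \<in> torus d N \<and> y \<in> torus d N \<and> adjacent d N x y}"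

text \<open>On the torus of side 2 the steps \<open>+1\<close> and \<open>-1\<close> lead to the same vertex; every edge is
  then doubled, so that the torus is \<open>2 * d\<close>-regular for every \<open>N\<close>.\<close>

definition edge_mult :: "nat \<Rightarrow> nat" where
  "edge_mult N = (if N = 1 then 2 else 1)"


section \<open>Poisson processes conditioned to have an even number of points\<close>

text \<open>Finite subsets of \<open>[0, \<beta>)\<close>, with the sigma-algebra generated by the counts of points in
  Borel sets.\<close>

definition configs :: "real \<Rightarrow> real set measure" where
  "configs \<beta> = sigma {S. finite S \<and> S \<subseteq> {0..<\<beta>}}
     {{S. finite S \<and> S \<subseteq> {0..<\<beta>} \<and> card (S \<inter> B) = n} |B n. B \<in> sets borel \<and> B \<subseteq> {0..<\<beta>}}"

definition poisson_law :: "real \<Rightarrow> real \<Rightarrow> real set measure \<Rightarrow> bool" where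
  "poisson_law \<delta> \<beta> P \<longleftrightarrow>
     prob_space P \<and> sets P = sets (configs \<beta>) \<and>
     (\<forall>B n. B \<in> sets borel \<and> B \<subseteq> {0..<\<beta>} \<longrightarrow>
        measure P {S \<in> space P. card (S \<inter> B) = n} =
          (\<delta> * measure lborel B) ^ n / fact n * exp (- (\<delta> * measure lborel B))) \<and>
     (\<forall>(B :: nat \<Rightarrow> real set) m.
        (\<forall>i<m. B i \<in> sets borel \<and> B i \<subseteq> {0..<\<beta>}) \<and> disjoint_family_on B {..<m} \<longrightarrow>
        prob_space.indep_vars P (\<lambda>_. count_space UNIV) (\<lambda>i S. card (S \<inter> B i)) {..<m})"

text \<open>\<^term>\<open>uniform_measure P A\<close> is the conditional probability measure of \<open>P\<close> given \<open>A\<close>.\<close>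

definition even_poisson_law :: "real \<Rightarrow> real \<Rightarrow> real set measure \<Rightarrow> bool" where
  "even_poisson_law \<delta> \<beta> \<nu> \<longleftrightarrow>
     (\<exists>P. poisson_law \<delta> \<beta> P \<and> \<nu> = uniform_measure P {S \<in> space P. even (card S)})"


section \<open>The space--time Ising measure\<close>

type_synonym spin_config = "vertex \<Rightarrow> real \<Rightarrow> real"

definition spin :: "(vertex \<Rightarrow> real set) \<Rightarrow> (vertex \<Rightarrow> nat) \<Rightarrow> spin_config" where
  "spin D \<xi> x t = (-1) ^ (\<xi> x + card (D x \<inter> {0..t}))"

definition interaction :: "nat \<Rightarrow> nat \<Rightarrow> real \<Rightarrow> spin_config \<Rightarrow> real" where
  "interaction d N \<beta> \<sigma> =
     (\<Sum>e\<in>edges d N. real (edge_mult N) * (LINT t:{0..<\<beta>}|lborel. (\<Prod>z\<in>e. \<sigma> z t)))"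

text \<open>Below, \<open>M\<close> is the underlying probability space and \<open>\<sigma>\<close> the random spin configuration
  on it.\<close>

definition partition_function ::
  "nat \<Rightarrow> nat \<Rightarrow> real \<Rightarrow> real \<Rightarrow> 'w measure \<Rightarrow> ('w \<Rightarrow> spin_config) \<Rightarrow> real" where
  "partition_function d N lam \<beta> M \<sigma> = (LINT \<omega>|M. exp (lam * interaction d N \<beta> (\<sigma> \<omega>)))"

definition ising_mean ::
  "nat \<Rightarrow> nat \<Rightarrow> real \<Rightarrow> real \<Rightarrow> 'w measure \<Rightarrow> ('w \<Rightarrow> spin_config) \<Rightarrow> (spin_config \<Rightarrow> real) \<Rightarrow> real" where
  "ising_mean d N lam \<beta> M \<sigma> f =
     (LINT \<omega>|M. f (\<sigma> \<omega>) * exp (lam * interaction d N \<beta> (\<sigma> \<omega>))) / partition_function d N lam \<beta> M \<sigma>"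

definition schwinger ::
  "nat \<Rightarrow> nat \<Rightarrow> real \<Rightarrow> real \<Rightarrow> 'w measure \<Rightarrow> ('w \<Rightarrow> spin_config) \<Rightarrow>
     vertex \<times> real \<Rightarrow> vertex \<times> real \<Rightarrow> real" where
  "schwinger d N lam \<beta> M \<sigma> p q =
     ising_mean d N lam \<beta> M \<sigma> (\<lambda>s. s (fst p) (snd p) * s (fst q) (snd q))"

definition schwinger_fourier ::
  "nat \<Rightarrow> nat \<Rightarrow> real \<Rightarrow> real \<Rightarrow> 'w measure \<Rightarrow> ('w \<Rightarrow> spin_config) \<Rightarrow> (nat \<Rightarrow> real) \<Rightarrow> real \<Rightarrow> complex" where
  "schwinger_fourier d N lam \<beta> M \<sigma> k l =
     (\<Sum>x\<in>torus d N. LINT t:{0..<\<beta>}|lborel.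
        complex_of_real (schwinger d N lam \<beta> M \<sigma> (origin d, 0) (x, t)) *
        exp (\<i> * complex_of_real (\<Sum>j=1..d. k j * real (x j))) *
        exp (\<i> * complex_of_real (l * t)))"

definition L_hat :: "nat \<Rightarrow> (nat \<Rightarrow> real) \<Rightarrow> real" where
  "L_hat d k = (\<Sum>j=1..d. 1 - cos (k j))"

end

theory Submission
  imports Defs "HOL-Real_Asymp.Real_Asymp"
begin

text \<open>The two terms of the denominator are treated separately. Writing \<open>c\<close> for the Fourier transform
of the Schwinger function, it is shown that \<open>2 * lam * L_hat d k * c \<le> 1\<close> and
\<open>l\<^sup>2 / (2 * \<delta>) * c \<le> 16\<close>; adding the two gives the claim, even with 17 in place of 48.

Both bounds come from an exact finite model. Observe the spins only at the times \<open>\<beta> * j / n\<close> with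
\<open>j < n\<close>. The numbers of points in the \<open>n\<close> intervals between these times are independent Poisson
variables, and only their parities matter; the condition that the total is even closes the sequence of
parities into a ring. So the sampled spins of one site have the law of a periodic two-state chain whose
kernel is \<open>(1 + a * b * q) / 2\<close> with \<open>q = exp (- 2 * \<delta> * \<beta> / n)\<close>. Replacing the time
integrals in the Gibbs factor by averages over the sampling times gives a Gibbs measure on finitely many
configurations. It is invariant under translations in space and time, hence its Fourier transform is, up
to normalisation, the mean square of the amplitude of a space-time plane wave, in particular real and
nonnegative.

The spatial bound is the classical infrared bound. Regard the ring of spins over a site as one vector;
under the a priori law these vectors are independent and identically distributed. Let \<open>Z(h)\<close> be the
partition sum in which the vectors are displaced by a field \<open>h\<close>. A reflection that bisects bonds
splits \<open>Z(h)\<close> into two halves coupled by a Gaussian kernel, which is positive definite, so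
\<open>Z(h)\<^sup>2\<close> is at most the product of the values of \<open>Z\<close> at the two symmetrised fields.
Among the finitely many fields that take only values of \<open>h\<close>, a maximiser of \<open>Z\<close> that
is constant along as many bonds as possible must be constant along all of them, since otherwise a
reflection would improve it. Therefore \<open>Z(h) \<le> Z(0)\<close> (\<open>Gaussian_domination\<close>), and the second
order term of this inequality at \<open>h = 0\<close> in the direction of a plane wave is the bound
(\<open>infrared_bound\<close>, \<open>spatial_bound\<close>).

The temporal bound uses the transfer matrix \<open>T\<close> from one time slice to the next. It is symmetric and of
the form \<open>Y\<^sup>T Y\<close>, hence so are its powers, and the correlation \<open>g(t)\<close> of a slice observable at
distance \<open>t\<close> is a convex function (\<open>corr_convex\<close>): its second difference is a trace
\<open>Tr (T\<^sup>p X T\<^sup>q X\<^sup>T)\<close>, where \<open>X\<close> is the commutator of \<open>T\<close> with the observable. Two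
summations by parts bound the Fourier coefficient of a convex function by its first decrement
\<open>g(0) - g(1)\<close> (\<open>convex_Fourier_bound\<close>). That decrement is half of the mean square change of the
observable in one time step, and it is controlled by the free kernel because an entry of a positive
semidefinite matrix is at most the mean of the two diagonal entries in its row and column
(\<open>temporal_bound\<close>). As \<open>n\<close> grows, it becomes of order \<open>\<delta> * \<beta> / n\<close>.

Finally \<open>n\<close> tends to infinity. Sampling times are taken to approach a given time from the right, where
the spins are continuous; then bounded convergence suffices throughout, first over the probability space
and then over time (\<open>schwinger_limit\<close>, \<open>Fourier_limit\<close>).\<close>

section \<open>Cauchy--Schwarz for Gaussian kernels\<close>

text \<open>Expanding one factor of the power over \<open>i\<close> turns the coefficient \<open>c p\<close> into
\<open>c p * a p i\<close> and lowers the power; the induction therefore has to allow all coefficients.\<close>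

lemma power_kernel_nonneg:
  fixes c :: "'a \<Rightarrow> real" and a :: "'a \<Rightarrow> 'i \<Rightarrow> real"
  shows "0 \<le> (\<Sum>p\<in>A. \<Sum>q\<in>A. c p * c q * (\<Sum>i\<in>I. a p i * a q i) ^ m)"
proof (induction m arbitrary: c)
  case 0
  have "(\<Sum>p\<in>A. \<Sum>q\<in>A. c p * c q) = (\<Sum>p\<in>A. c p)\<^sup>2"
    by (simp add: power2_eq_square sum_product)
  then show ?case by simp
next
  case (Suc m)
  let ?k = "\<lambda>p q. (\<Sum>i\<in>I. a p i * a q i)"
  have "(\<Sum>p\<in>A. \<Sum>q\<in>A. c p * c q * ?k p q ^ Suc m)
      = (\<Sum>p\<in>A. \<Sum>q\<in>A. \<Sum>i\<in>I. (c p * a p i) * (c q * a q i) * ?k p q ^ m)"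
    by (simp add: sum_distrib_left sum_distrib_right mult_ac)
  also have "\<dots> = (\<Sum>p\<in>A. \<Sum>i\<in>I. \<Sum>q\<in>A. (c p * a p i) * (c q * a q i) * ?k p q ^ m)"
    by (intro sum.cong refl sum.swap)
  also have "\<dots> = (\<Sum>i\<in>I. \<Sum>p\<in>A. \<Sum>q\<in>A. (c p * a p i) * (c q * a q i) * ?k p q ^ m)"
    by (rule sum.swap)
  also have "\<dots> \<ge> 0" by (rule sum_nonneg) (rule Suc)
  finally show ?case .
qed

text \<open>The exponential series has nonnegative coefficients, so positivity passes from the powers
to the exponential.\<close>

lemma exp_kernel_nonneg:
  fixes c :: "'a \<Rightarrow> real" and a :: "'a \<Rightarrow> 'i \<Rightarrow> real"
  shows "0 \<le> (\<Sum>p\<in>A. \<Sum>q\<in>A. c p * c q * exp (\<Sum>i\<in>I. a p i * a q i))"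
proof -
  let ?k = "\<lambda>p q. (\<Sum>i\<in>I. a p i * a q i)"
  have "(\<lambda>n. \<Sum>p\<in>A. \<Sum>q\<in>A. c p * c q * (\<Sum>m<n. ?k p q ^ m /\<^sub>R fact m))
     \<longlonglongrightarrow> (\<Sum>p\<in>A. \<Sum>q\<in>A. c p * c q * exp (?k p q))"
    by (intro tendsto_sum tendsto_mult tendsto_const exp_converges[unfolded sums_def])
  moreover have "0 \<le> (\<Sum>p\<in>A. \<Sum>q\<in>A. c p * c q * (\<Sum>m<n. ?k p q ^ m /\<^sub>R fact m))" for n
  proof -
    have "(\<Sum>p\<in>A. \<Sum>q\<in>A. c p * c q * (\<Sum>m<n. ?k p q ^ m /\<^sub>R fact m))
      = (\<Sum>p\<in>A. \<Sum>q\<in>A. \<Sum>m<n. (c p * c q * ?k p q ^ m) /\<^sub>R fact m)"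
      by (simp add: sum_distrib_left mult_ac)
    also have "\<dots> = (\<Sum>p\<in>A. \<Sum>m<n. \<Sum>q\<in>A. (c p * c q * ?k p q ^ m) /\<^sub>R fact m)"
      by (intro sum.cong refl sum.swap)
    also have "\<dots> = (\<Sum>m<n. \<Sum>p\<in>A. \<Sum>q\<in>A. (c p * c q * ?k p q ^ m) /\<^sub>R fact m)"
      by (rule sum.swap)
    also have "\<dots> = (\<Sum>m<n. (\<Sum>p\<in>A. \<Sum>q\<in>A. c p * c q * ?k p q ^ m) /\<^sub>R fact m)"
      by (simp add: sum_distrib_left)
    also have "\<dots> \<ge> 0"
      by (intro sum_nonneg scaleR_nonneg_nonneg power_kernel_nonneg) simp
    finally show ?thesis .
  qed
  ultimately show ?thesis by (intro LIMSEQ_le_const) auto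
qed

lemma discriminant_nonpos:
  fixes A B C :: real
  assumes "\<And>s. 0 \<le> A + 2 * s * B + s\<^sup>2 * C"
  shows "B\<^sup>2 \<le> A * C"
proof -
  have A: "0 \<le> A" using assms[of 0] by simp
  have "C \<ge> 0"
  proof (rule ccontr)
    assume "\<not> C \<ge> 0"
    then have C: "C < 0" by simp
    \<comment> \<open>chosen so large that the quadratic term beats the other two\<close>
    define s where "s = (A + 1 + 2 * \<bar>B\<bar> - C) / (- C)"
    have s1: "s \<ge> 1" using C A by (simp add: s_def field_simps)
    have sC: "s * C = - (A + 1 + 2 * \<bar>B\<bar> - C)" using C by (simp add: s_def field_simps)
    have "A + 2 * s * B + s\<^sup>2 * C = A + s * (2 * B + s * C)"
      by (simp add: power2_eq_square algebra_simps)
    also have "\<dots> = A + s * (2 * B - (A + 1 + 2 * \<bar>B\<bar> - C))" by (simp only: sC diff_conv_add_uminus)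
    also have "\<dots> \<le> A + s * (- (A + 1))" using C s1 by (intro add_left_mono mult_left_mono) auto
    also have "\<dots> \<le> A + 1 * (- (A + 1))" using s1 A by (intro add_left_mono mult_right_mono_neg) auto
    finally have "A + 2 * s * B + s\<^sup>2 * C < 0" by simp
    then show False using assms[of s] by simp
  qed
  show ?thesis
  proof (cases "C = 0")
    case True
    have "B = 0"
    proof (rule ccontr)
      assume "B \<noteq> 0"
      then show False using assms[of "- (A + 1) / (2 * B)"] True by (simp add: field_simps)
    qed
    then show ?thesis using True by simp
  next
    case False
    with \<open>C \<ge> 0\<close> have "C > 0" by simp
    then show ?thesis using assms[of "- B / C"]
      by (simp add: field_simps power2_eq_square)
  qed
qed

text \<open>Apply positivity to the disjoint union of \<open>U\<close> and \<open>V\<close> with the coefficients \<open>f\<close> on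
\<open>U\<close> and \<open>s * g\<close> on \<open>V\<close>: this is a nonnegative quadratic polynomial in \<open>s\<close>.\<close>

lemma exp_kernel_Cauchy_Schwarz:
  fixes f :: "'a \<Rightarrow> real" and a :: "'a \<Rightarrow> 'i \<Rightarrow> real"
    and g :: "'b \<Rightarrow> real" and b :: "'b \<Rightarrow> 'i \<Rightarrow> real"
  assumes fin: "finite U" "finite V"
  shows "(\<Sum>u\<in>U. \<Sum>v\<in>V. f u * g v * exp (\<Sum>i\<in>I. a u i * b v i))\<^sup>2
    \<le> (\<Sum>u\<in>U. \<Sum>v\<in>U. f u * f v * exp (\<Sum>i\<in>I. a u i * a v i))
      * (\<Sum>u\<in>V. \<Sum>v\<in>V. g u * g v * exp (\<Sum>i\<in>I. b u i * b v i))"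
proof (rule discriminant_nonpos)
  fix s :: real
  let ?UV = "\<Sum>u\<in>U. \<Sum>v\<in>V. f u * g v * exp (\<Sum>i\<in>I. a u i * b v i)"
  define c where "c = case_sum f (\<lambda>v. s * g v)"
  define e where "e = case_sum a b"
  have "0 \<le> (\<Sum>p\<in>U <+> V. \<Sum>q\<in>U <+> V. c p * c q * exp (\<Sum>i\<in>I. e p i * e q i))"
    by (rule exp_kernel_nonneg)
  also have "\<dots> = (\<Sum>u\<in>U. \<Sum>v\<in>U. f u * f v * exp (\<Sum>i\<in>I. a u i * a v i))
      + (\<Sum>u\<in>U. \<Sum>v\<in>V. s * (f u * g v * exp (\<Sum>i\<in>I. a u i * b v i)))
      + ((\<Sum>v\<in>V. \<Sum>u\<in>U. s * (f u * g v * exp (\<Sum>i\<in>I. a u i * b v i)))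
      + (\<Sum>u\<in>V. \<Sum>v\<in>V. s\<^sup>2 * (g u * g v * exp (\<Sum>i\<in>I. b u i * b v i))))"
    using fin by (simp add: sum.Plus c_def e_def sum.distrib mult_ac power2_eq_square)
  also have "(\<Sum>v\<in>V. \<Sum>u\<in>U. s * (f u * g v * exp (\<Sum>i\<in>I. a u i * b v i))) = s * ?UV"
    by (subst sum.swap) (simp add: sum_distrib_left)
  finally show "0 \<le> (\<Sum>u\<in>U. \<Sum>v\<in>U. f u * f v * exp (\<Sum>i\<in>I. a u i * a v i)) + 2 * s * ?UV
      + s\<^sup>2 * (\<Sum>u\<in>V. \<Sum>v\<in>V. g u * g v * exp (\<Sum>i\<in>I. b u i * b v i))"
    by (simp only: sum_distrib_left[symmetric] mult.assoc)
qed

text \<open>Expanding the squares, the Gaussian kernel is the exponential of an inner product times a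
factor of \<open>a u\<close> and a factor of \<open>b v\<close>, which are absorbed into \<open>f\<close> and \<open>g\<close>.\<close>

lemma Gaussian_kernel_Cauchy_Schwarz:
  fixes f g :: "'a \<Rightarrow> real" and a b :: "'a \<Rightarrow> 'i \<Rightarrow> real" and \<gamma> :: "'i \<Rightarrow> real"
  assumes fin: "finite U" and \<gamma>: "\<And>i. i \<in> I \<Longrightarrow> 0 \<le> \<gamma> i"
  shows "(\<Sum>u\<in>U. \<Sum>v\<in>U. f u * g v * exp (- (\<Sum>i\<in>I. \<gamma> i * (a u i - b v i)\<^sup>2)))\<^sup>2
    \<le> (\<Sum>u\<in>U. \<Sum>v\<in>U. f u * f v * exp (- (\<Sum>i\<in>I. \<gamma> i * (a u i - a v i)\<^sup>2)))
      * (\<Sum>u\<in>U. \<Sum>v\<in>U. g u * g v * exp (- (\<Sum>i\<in>I. \<gamma> i * (b u i - b v i)\<^sup>2)))"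
proof -
  define w where "w p = exp (- (\<Sum>i\<in>I. \<gamma> i * (p i)\<^sup>2))" for p :: "'i \<Rightarrow> real"
  define r where "r p = (\<lambda>i. sqrt (2 * \<gamma> i) * p i)" for p :: "'i \<Rightarrow> real"
  have *: "exp (- (\<Sum>i\<in>I. \<gamma> i * (p i - q i)\<^sup>2)) = w p * w q * exp (\<Sum>i\<in>I. r p i * r q i)" for p q
  proof -
    have "(\<Sum>i\<in>I. r p i * r q i) = (\<Sum>i\<in>I. \<gamma> i * (2 * p i * q i))"
    proof (intro sum.cong refl)
      fix i assume "i \<in> I"
      have "r p i * r q i = (sqrt (2 * \<gamma> i) * sqrt (2 * \<gamma> i)) * (p i * q i)"
        by (simp only: r_def mult_ac)
      then show "r p i * r q i = \<gamma> i * (2 * p i * q i)" using \<gamma>[OF \<open>i \<in> I\<close>] by simp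
    qed
    then show ?thesis
      unfolding w_def exp_add[symmetric]
      by (simp add: power2_diff algebra_simps sum.distrib sum_subtractf sum_negf)
  qed
  show ?thesis
    using exp_kernel_Cauchy_Schwarz[OF fin fin, where f = "\<lambda>u. f u * w (a u)" and g = "\<lambda>u. g u * w (b u)"
        and a = "\<lambda>u. r (a u)" and b = "\<lambda>u. r (b u)" and I = I]
    by (simp only: * mult_ac)
qed

section \<open>Reflection positivity and Gaussian domination\<close>

text \<open>The number \<open>J x y\<close> counts parallel bonds. Every vertex carries a vector from the finite
set \<open>S\<close>, with a priori weight \<open>\<rho>\<close>; the set \<open>I\<close> indexes the coordinates of the vectors.\<close>

locale spin_graph =
  fixes V :: "'v set" and J :: "'v \<Rightarrow> 'v \<Rightarrow> nat"
    and I :: "'i set" and S :: "('i \<Rightarrow> real) set" and \<rho> :: "('i \<Rightarrow> real) \<Rightarrow> real" and \<kappa> :: real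
  assumes finite_V: "finite V" and finite_I: "finite I" and finite_S: "finite S"
    and \<rho>_nonneg: "\<And>u. u \<in> S \<Longrightarrow> 0 \<le> \<rho> u" and \<kappa>_pos: "0 < \<kappa>"
    and J_sym: "\<And>x y. J x y = J y x"
begin

text \<open>The sum over ordered pairs meets every bond twice, so that the energy of a bond is
\<open>\<kappa> / 2\<close> times the squared distance.\<close>

definition energy :: "('v \<Rightarrow> 'i \<Rightarrow> real) \<Rightarrow> real" where
  "energy g = (\<kappa> / 4) * (\<Sum>x\<in>V. \<Sum>y\<in>V. real (J x y) * (\<Sum>i\<in>I. (g x i - g y i)\<^sup>2))"

definition shifted_sum :: "('v \<Rightarrow> 'i \<Rightarrow> real) \<Rightarrow> real" where
  "shifted_sum h = (\<Sum>s\<in>V \<rightarrow>\<^sub>E S. (\<Prod>x\<in>V. \<rho> (s x)) * exp (- energy (\<lambda>x i. s x i - h x i)))"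

text \<open>The last condition says that the plane of reflection bisects every bond that it meets.\<close>

definition reflection :: "('v \<Rightarrow> 'v) \<Rightarrow> 'v set \<Rightarrow> bool" where
  "reflection \<theta> H \<longleftrightarrow> H \<subseteq> V \<and> \<theta> ` H = V - H \<and> (\<forall>x\<in>V. \<theta> (\<theta> x) = x)
     \<and> (\<forall>x\<in>V. \<forall>y\<in>V. J (\<theta> x) (\<theta> y) = J x y)
     \<and> (\<forall>x\<in>H. \<forall>y\<in>V - H. 0 < J x y \<longrightarrow> y = \<theta> x)"

text \<open>The field that agrees with \<open>h\<close> on \<open>H\<close> and is symmetric under \<open>\<theta>\<close>.\<close>

definition fold_across :: "('v \<Rightarrow> 'v) \<Rightarrow> 'v set \<Rightarrow> ('v \<Rightarrow> 'b) \<Rightarrow> 'v \<Rightarrow> 'b" where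
  "fold_across \<theta> H h = (\<lambda>x. if x \<in> H then h x else h (\<theta> x))"

lemma finite_spins: "finite (W \<rightarrow>\<^sub>E S)" if "finite W"
  using that finite_S by (simp add: finite_PiE)

lemma shifted_sum_nonneg: "0 \<le> shifted_sum h"
  unfolding shifted_sum_def by (intro sum_nonneg mult_nonneg_nonneg prod_nonneg \<rho>_nonneg ballI) (auto dest: PiE_mem)

lemma shifted_sum_cong: "shifted_sum g = shifted_sum h" if "\<And>x. x \<in> V \<Longrightarrow> g x = h x"
  unfolding shifted_sum_def energy_def using that by simp

lemma reflectionD:
  assumes "reflection \<theta> H"
  shows "H \<subseteq> V" "\<theta> ` H = V - H" "\<And>x. x \<in> V \<Longrightarrow> \<theta> (\<theta> x) = x"
    "\<And>x y. x \<in> V \<Longrightarrow> y \<in> V \<Longrightarrow> J (\<theta> x) (\<theta> y) = J x y"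
    "\<And>x y. x \<in> H \<Longrightarrow> y \<in> V \<Longrightarrow> y \<notin> H \<Longrightarrow> 0 < J x y \<Longrightarrow> y = \<theta> x"
  using assms unfolding reflection_def by simp_all

lemma reflection_bij: assumes "reflection \<theta> H" shows "bij_betw \<theta> H (V - H)"
proof -
  have "inj_on \<theta> H"
    by (rule inj_on_inverseI[of _ \<theta>]) (use assms in \<open>auto simp: reflection_def\<close>)
  then show ?thesis using assms by (simp add: reflection_def bij_betw_def)
qed

text \<open>Both halves are parametrised by \<open>H\<close>, the second one through \<open>\<theta>\<close>. A bond from \<open>H\<close> to its
complement joins some \<open>x\<close> to \<open>\<theta> x\<close>, and it is met from either end.\<close>

lemma split_edge_sum:
  fixes \<phi> :: "'v \<Rightarrow> 'v \<Rightarrow> real"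
  assumes R: "reflection \<theta> H" and sym: "\<And>x y. \<phi> x y = \<phi> y x"
  shows "(\<Sum>x\<in>V. \<Sum>y\<in>V. real (J x y) * \<phi> x y)
    = (\<Sum>x\<in>H. \<Sum>y\<in>H. real (J x y) * \<phi> x y)
      + (\<Sum>x\<in>H. \<Sum>y\<in>H. real (J x y) * \<phi> (\<theta> x) (\<theta> y))
      + 2 * (\<Sum>x\<in>H. real (J x (\<theta> x)) * \<phi> x (\<theta> x))"
proof -
  let ?f = "\<lambda>x y. real (J x y) * \<phi> x y"
  have H: "H \<subseteq> V" and finH: "finite H" "finite (V - H)"
    using reflectionD(1)[OF R] finite_V by (auto intro: finite_subset)
  have bij: "bij_betw \<theta> H (V - H)" by (rule reflection_bij[OF R])
  have \<theta>mem: "\<theta> x \<in> V - H" if "x \<in> H" for x using bij_betwE[OF bij] that by blast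
  have split: "sum f V = sum f H + sum f (V - H)" for f :: "'v \<Rightarrow> real"
    using sum.subset_diff[OF H finite_V, of f] by simp
  have re: "sum f (V - H) = (\<Sum>x\<in>H. f (\<theta> x))" for f :: "'v \<Rightarrow> real"
    using sum.reindex_bij_betw[OF bij, of f] by simp
  have cross: "(\<Sum>y\<in>H. ?f x (\<theta> y)) = ?f x (\<theta> x)" if x: "x \<in> H" for x
  proof -
    have "?f x (\<theta> y) = (if y = x then ?f x (\<theta> x) else 0)" if "y \<in> H" for y
    proof (cases "y = x")
      case False
      then have "\<theta> y \<noteq> \<theta> x"
        using bij x that unfolding bij_betw_def inj_on_def by blast
      then have "J x (\<theta> y) = 0"
        using reflectionD(5)[OF R x] \<theta>mem[OF that] by (metis DiffD1 DiffD2 neq0_conv)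
      then show ?thesis using False by simp
    qed simp
    then have "(\<Sum>y\<in>H. ?f x (\<theta> y)) = (\<Sum>y\<in>H. if y = x then ?f x (\<theta> x) else 0)"
      by (rule sum.cong[OF refl])
    then show ?thesis using x finH by simp
  qed
  have J\<theta>: "J (\<theta> x) (\<theta> y) = J x y" if "x \<in> H" "y \<in> H" for x y
    using reflectionD(4)[OF R] H that by blast
  have "(\<Sum>x\<in>V. \<Sum>y\<in>V. ?f x y)
    = (\<Sum>x\<in>H. \<Sum>y\<in>H. ?f x y) + (\<Sum>x\<in>H. \<Sum>y\<in>H. ?f x (\<theta> y))
      + ((\<Sum>x\<in>H. \<Sum>y\<in>H. ?f (\<theta> x) y) + (\<Sum>x\<in>H. \<Sum>y\<in>H. ?f (\<theta> x) (\<theta> y)))"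
    by (simp only: split re sum.distrib)
  also have "(\<Sum>x\<in>H. \<Sum>y\<in>H. ?f (\<theta> x) y) = (\<Sum>x\<in>H. \<Sum>y\<in>H. ?f x (\<theta> y))"
    by (subst sum.swap) (simp add: J_sym sym[of _ "\<theta> _"])
  also have "(\<Sum>x\<in>H. \<Sum>y\<in>H. ?f x (\<theta> y)) = (\<Sum>x\<in>H. ?f x (\<theta> x))"
    using cross by simp
  finally show ?thesis using J\<theta> by simp
qed

definition half_weight :: "'v set \<Rightarrow> ('v \<Rightarrow> 'i \<Rightarrow> real) \<Rightarrow> ('v \<Rightarrow> 'i \<Rightarrow> real) \<Rightarrow> real" where
  "half_weight H p u = (\<Prod>x\<in>H. \<rho> (u x)) *
     exp (- (\<kappa> / 4 * (\<Sum>x\<in>H. \<Sum>y\<in>H. real (J x y) * (\<Sum>i\<in>I. ((u x i - p x i) - (u y i - p y i))\<^sup>2))))"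

text \<open>The partition sum as seen from the plane of reflection: two configurations on \<open>H\<close>,
displaced by \<open>p\<close> and \<open>q\<close>, of which the second stands for the mirror half. The bonds across the plane
give the Gaussian kernel in the difference of the two displaced configurations.\<close>

definition glue :: "('v \<Rightarrow> 'v) \<Rightarrow> 'v set \<Rightarrow> ('v \<Rightarrow> 'i \<Rightarrow> real) \<Rightarrow> ('v \<Rightarrow> 'i \<Rightarrow> real) \<Rightarrow> real" where
  "glue \<theta> H p q = (\<Sum>u\<in>H \<rightarrow>\<^sub>E S. \<Sum>v\<in>H \<rightarrow>\<^sub>E S. half_weight H p u * half_weight H q v *
     exp (- (\<Sum>j\<in>H \<times> I. \<kappa> / 2 * real (J (fst j) (\<theta> (fst j))) *
        ((u (fst j) (snd j) - p (fst j) (snd j)) - (v (fst j) (snd j) - q (fst j) (snd j)))\<^sup>2)))"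

text \<open>A configuration on \<open>V\<close> is the same as a pair of configurations on \<open>H\<close>, the second one
transported by \<open>\<theta>\<close>; \<open>split_edge_sum\<close> separates the energy accordingly.\<close>

lemma shifted_sum_eq_glue:
  assumes R: "reflection \<theta> H" and p: "\<And>x. x \<in> H \<Longrightarrow> p x = h x" and q: "\<And>x. x \<in> H \<Longrightarrow> q x = h (\<theta> x)"
  shows "shifted_sum h = glue \<theta> H p q"
proof -
  have H: "H \<subseteq> V" and finH: "finite H" "finite (V - H)"
    using reflectionD(1)[OF R] finite_V by (auto intro: finite_subset)
  have bij: "bij_betw \<theta> H (V - H)" by (rule reflection_bij[OF R])
  have \<theta>H: "\<theta> x \<in> V - H" if "x \<in> H" for x using bij_betwE[OF bij] that by blast
  have \<theta>\<theta>: "\<theta> (\<theta> x) = x" if "x \<in> V" for x using reflectionD(3)[OF R] that .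
  have HV: "x \<in> V" if "x \<in> H" for x using H that by blast
  have \<theta>\<theta>H: "\<theta> (\<theta> x) = x" if "x \<in> H" for x using \<theta>\<theta>[OF HV[OF that]] .
  have \<theta>H': "\<theta> x \<in> H" if "x \<in> V" "x \<notin> H" for x
  proof -
    have "x \<in> \<theta> ` H" using reflectionD(2)[OF R] that by simp
    then obtain y where y: "y \<in> H" "x = \<theta> y" by blast
    then show ?thesis using \<theta>\<theta> H by auto
  qed
  define w where "w s = (\<Prod>x\<in>V. \<rho> (s x)) * exp (- energy (\<lambda>x i. s x i - h x i))" for s
  define J' where "J' = (\<lambda>u v x. if x \<in> V then if x \<in> H then u x else v (\<theta> x) else undefined :: 'i \<Rightarrow> real)"
  have w: "w (J' u v) = half_weight H p u * half_weight H q v *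
     exp (- (\<Sum>j\<in>H \<times> I. \<kappa> / 2 * real (J (fst j) (\<theta> (fst j))) *
        ((u (fst j) (snd j) - p (fst j) (snd j)) - (v (fst j) (snd j) - q (fst j) (snd j)))\<^sup>2))"
    (is "_ = ?A * ?B * exp (- ?C)")
    for u v
  proof -
    let ?g = "\<lambda>x i. J' u v x i - h x i"
    let ?\<phi> = "\<lambda>x y. \<Sum>i\<in>I. (?g x i - ?g y i)\<^sup>2"
    have g1: "?g x i = u x i - p x i" if "x \<in> H" for x i using that H p by (auto simp: J'_def)
    have g2: "?g (\<theta> x) i = v x i - q x i" if "x \<in> H" for x i
      using that H q \<theta>H[OF that] \<theta>\<theta> by (auto simp: J'_def)
    have "(\<Prod>x\<in>V. \<rho> (J' u v x)) = (\<Prod>x\<in>H. \<rho> (J' u v x)) * (\<Prod>x\<in>V-H. \<rho> (J' u v x))"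
      using prod.subset_diff[OF H finite_V] by (simp add: mult.commute)
    also have "(\<Prod>x\<in>V-H. \<rho> (J' u v x)) = (\<Prod>x\<in>H. \<rho> (J' u v (\<theta> x)))"
      by (rule prod.reindex_bij_betw[OF bij, symmetric])
    finally have P: "(\<Prod>x\<in>V. \<rho> (J' u v x)) = (\<Prod>x\<in>H. \<rho> (u x)) * (\<Prod>x\<in>H. \<rho> (v x))"
      using H \<theta>H \<theta>\<theta> by (simp add: J'_def subset_iff cong: prod.cong)
    have "energy ?g = \<kappa> / 4 * ((\<Sum>x\<in>H. \<Sum>y\<in>H. real (J x y) * ?\<phi> x y)
      + (\<Sum>x\<in>H. \<Sum>y\<in>H. real (J x y) * ?\<phi> (\<theta> x) (\<theta> y))
      + 2 * (\<Sum>x\<in>H. real (J x (\<theta> x)) * ?\<phi> x (\<theta> x)))"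
      unfolding energy_def
      by (subst split_edge_sum[OF R]) (simp_all add: power2_commute)
    also have "\<dots> = \<kappa> / 4 * (\<Sum>x\<in>H. \<Sum>y\<in>H. real (J x y) * (\<Sum>i\<in>I. ((u x i - p x i) - (u y i - p y i))\<^sup>2))
      + \<kappa> / 4 * (\<Sum>x\<in>H. \<Sum>y\<in>H. real (J x y) * (\<Sum>i\<in>I. ((v x i - q x i) - (v y i - q y i))\<^sup>2))
      + \<kappa> / 2 * (\<Sum>x\<in>H. real (J x (\<theta> x)) * (\<Sum>i\<in>I. ((u x i - p x i) - (v x i - q x i))\<^sup>2))"
      unfolding distrib_left by (simp add: g1 g2 cong: sum.cong)
    also have "\<kappa> / 2 * (\<Sum>x\<in>H. real (J x (\<theta> x)) * (\<Sum>i\<in>I. ((u x i - p x i) - (v x i - q x i))\<^sup>2))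
       = ?C"
      by (simp add: sum.cartesian_product' sum_distrib_left mult_ac)
    finally have E: "energy ?g
      = \<kappa> / 4 * (\<Sum>x\<in>H. \<Sum>y\<in>H. real (J x y) * (\<Sum>i\<in>I. ((u x i - p x i) - (u y i - p y i))\<^sup>2))
      + \<kappa> / 4 * (\<Sum>x\<in>H. \<Sum>y\<in>H. real (J x y) * (\<Sum>i\<in>I. ((v x i - q x i) - (v y i - q y i))\<^sup>2))
      + ?C" .
    show ?thesis unfolding w_def P E half_weight_def
      by (simp only: minus_add_distrib exp_add mult_ac)
  qed
  have "shifted_sum h = (\<Sum>s\<in>V \<rightarrow>\<^sub>E S. w s)" by (simp add: shifted_sum_def w_def)
  also have "\<dots> = (\<Sum>(u, v)\<in>(H \<rightarrow>\<^sub>E S) \<times> (H \<rightarrow>\<^sub>E S). w (J' u v))"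
  proof (rule sum.reindex_bij_witness[symmetric,
        where i = "\<lambda>s. (restrict s H, \<lambda>x\<in>H. s (\<theta> x))" and j = "\<lambda>(u, v). J' u v"], goal_cases)
    case (1 a)
    obtain u v where a: "a = (u, v)" "u \<in> H \<rightarrow>\<^sub>E S" "v \<in> H \<rightarrow>\<^sub>E S" using 1 by auto
    have "restrict (J' u v) H = u" "(\<lambda>x\<in>H. J' u v (\<theta> x)) = v"
      by (rule extensionalityI[of _ H]; use a(2,3) HV \<theta>H \<theta>\<theta>H in \<open>force simp: J'_def PiE_def\<close>)+
    then show ?case using a by simp
  next
    case (2 a)
    obtain u v where a: "a = (u, v)" "u \<in> H \<rightarrow>\<^sub>E S" "v \<in> H \<rightarrow>\<^sub>E S" using 2 by auto
    have "J' u v \<in> V \<rightarrow>\<^sub>E S"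
      by (rule PiE_I) (use a(2,3) \<theta>H' in \<open>auto simp: J'_def PiE_def Pi_def\<close>)
    then show ?case using a by simp
  next
    case (3 b)
    have "J' (restrict b H) (\<lambda>x\<in>H. b (\<theta> x)) = b"
      by (rule extensionalityI[of _ V]) (use 3 \<theta>\<theta> \<theta>H' in \<open>auto simp: J'_def PiE_def extensional_def\<close>)
    then show ?case by simp
  next
    case (4 b)
    then show ?case using HV \<theta>H by (auto simp: PiE_def Pi_def)
  next
    case (5 b)
    then show ?case by (simp add: split_beta)
  qed
  also have "\<dots> = glue \<theta> H p q"
    unfolding glue_def w by (simp add: sum.cartesian_product)
  finally show ?thesis .
qed

text \<open>Reflection positivity: \<open>glue\<close> is a positive semidefinite form, and its diagonal values at
the two halves of \<open>h\<close> are the partition sums of the two symmetrised fields.\<close>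

lemma reflection_Cauchy_Schwarz:
  assumes R: "reflection \<theta> H"
  shows "(shifted_sum h)\<^sup>2 \<le> shifted_sum (fold_across \<theta> H h) * shifted_sum (fold_across \<theta> H (h \<circ> \<theta>))"
proof -
  have H: "H \<subseteq> V" and finH: "finite H"
    using reflectionD(1)[OF R] finite_V by (auto intro: finite_subset)
  have \<theta>H: "\<theta> x \<notin> H" if "x \<in> H" for x using bij_betwE[OF reflection_bij[OF R]] that by blast
  have \<theta>\<theta>: "\<theta> (\<theta> x) = x" if "x \<in> H" for x
    using reflectionD(3)[OF R] H that by (simp add: subset_iff)
  have 1: "shifted_sum h = glue \<theta> H h (h \<circ> \<theta>)" by (rule shifted_sum_eq_glue[OF R]) simp_all
  have 2: "shifted_sum (fold_across \<theta> H h) = glue \<theta> H h h"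
    by (rule shifted_sum_eq_glue[OF R]) (simp_all add: fold_across_def \<theta>H \<theta>\<theta>)
  have 3: "shifted_sum (fold_across \<theta> H (h \<circ> \<theta>)) = glue \<theta> H (h \<circ> \<theta>) (h \<circ> \<theta>)"
    by (rule shifted_sum_eq_glue[OF R]) (simp_all add: fold_across_def \<theta>H \<theta>\<theta>)
  have \<gamma>: "0 \<le> \<kappa> / 2 * real (J (fst j) (\<theta> (fst j)))" for j :: "'v \<times> 'i" using \<kappa>_pos by simp
  show ?thesis unfolding 1 2 3 glue_def
    by (rule Gaussian_kernel_Cauchy_Schwarz[where U = "H \<rightarrow>\<^sub>E S" and I = "H \<times> I"
         and \<gamma> = "\<lambda>j. \<kappa> / 2 * real (J (fst j) (\<theta> (fst j)))"
         and f = "half_weight H h" and g = "half_weight H (h \<circ> \<theta>)"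
         and a = "\<lambda>u j. u (fst j) (snd j) - h (fst j) (snd j)"
         and b = "\<lambda>u j. u (fst j) (snd j) - (h \<circ> \<theta>) (fst j) (snd j)",
         OF finite_spins[OF finH] \<gamma>])
qed

text \<open>Twice the number of bonds along which \<open>h\<close> is not constant.\<close>

definition disagreement :: "('v \<Rightarrow> 'i \<Rightarrow> real) \<Rightarrow> nat" where
  "disagreement h = (\<Sum>x\<in>V. \<Sum>y\<in>V. J x y * of_bool (h x \<noteq> h y))"

text \<open>The two folded fields together contain each half of \<open>h\<close> twice, but they agree along all
bonds across the plane.\<close>

lemma disagreement_fold_across:
  assumes R: "reflection \<theta> H" and x: "x \<in> H" and y: "y \<in> V - H" and J: "0 < J x y" and ne: "h x \<noteq> h y"
  shows "disagreement (fold_across \<theta> H h) + disagreement (fold_across \<theta> H (h \<circ> \<theta>)) < 2 * disagreement h"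
proof -
  have H: "H \<subseteq> V" and finH: "finite H"
    using reflectionD(1)[OF R] finite_V by (auto intro: finite_subset)
  have \<theta>H: "\<theta> x \<notin> H" if "x \<in> H" for x using bij_betwE[OF reflection_bij[OF R]] that by blast
  have \<theta>\<theta>: "\<theta> (\<theta> x) = x" if "x \<in> H" for x
    using reflectionD(3)[OF R] H that by (simp add: subset_iff)
  have y': "y = \<theta> x" using reflectionD(5)[OF R x] y J by simp
  have dis: "real (disagreement g) = (\<Sum>x\<in>H. \<Sum>y\<in>H. real (J x y) * of_bool (g x \<noteq> g y))
      + (\<Sum>x\<in>H. \<Sum>y\<in>H. real (J x y) * of_bool (g (\<theta> x) \<noteq> g (\<theta> y)))
      + 2 * (\<Sum>x\<in>H. real (J x (\<theta> x)) * of_bool (g x \<noteq> g (\<theta> x)))" for g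
  proof -
    have "(of_bool (g x \<noteq> g y) :: real) = of_bool (g y \<noteq> g x)" for x y by (cases "g x = g y") auto
    from split_edge_sum[OF R, of "\<lambda>x y. of_bool (g x \<noteq> g y)", OF this]
    show ?thesis by (simp add: disagreement_def)
  qed
  have f1: "fold_across \<theta> H g x = g x" "fold_across \<theta> H g (\<theta> x) = g x" if "x \<in> H" for g :: "'v \<Rightarrow> 'i \<Rightarrow> real" and x
    using that by (simp_all add: fold_across_def \<theta>H \<theta>\<theta>)
  have "0 < real (J x (\<theta> x)) * of_bool (h x \<noteq> h (\<theta> x))" using J ne y' by simp
  also have "\<dots> \<le> (\<Sum>x\<in>H. real (J x (\<theta> x)) * of_bool (h x \<noteq> h (\<theta> x)))"
    by (rule member_le_sum) (use x finH in auto)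
  finally have "real (disagreement (fold_across \<theta> H h)) + real (disagreement (fold_across \<theta> H (h \<circ> \<theta>))) < 2 * real (disagreement h)"
    unfolding dis by (simp add: f1 cong: sum.cong)
  then show ?thesis by linarith
qed

text \<open>Only finitely many fields take all their values in \<open>h ` V\<close>, and folding does not leave this
set. A maximiser with the least disagreement has no disagreement at all: by
\<open>reflection_Cauchy_Schwarz\<close> both folded fields would again be maximisers, and by
\<open>disagreement_fold_across\<close> one of them would have less disagreement. A field that is constant along all
bonds does not change the energy.\<close>

theorem Gaussian_domination:
  assumes reflectable: "\<And>x y. x \<in> V \<Longrightarrow> y \<in> V \<Longrightarrow> 0 < J x y \<Longrightarrow>
     \<exists>\<theta> H. reflection \<theta> H \<and> (x \<in> H \<longleftrightarrow> y \<notin> H)"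
  shows "shifted_sum h \<le> shifted_sum (\<lambda>_ _. 0)"
proof -
  define \<G> where "\<G> = V \<rightarrow>\<^sub>E h ` V"
  have fin: "finite \<G>" using finite_V by (simp add: \<G>_def finite_PiE)
  have h: "restrict h V \<in> \<G>" by (auto simp: \<G>_def)
  define m where "m = Max (shifted_sum ` \<G>)"
  have m: "shifted_sum g \<le> m" if "g \<in> \<G>" for g using fin that by (simp add: m_def)
  have "m \<in> shifted_sum ` \<G>" unfolding m_def using fin h by (intro Max_in) auto
  then obtain g0 where "g0 \<in> \<G> \<and> shifted_sum g0 = m" by blast
  from ex_has_least_nat[of "\<lambda>g. g \<in> \<G> \<and> shifted_sum g = m", OF this, of disagreement]
  obtain g where g: "g \<in> \<G>" "shifted_sum g = m"
    and least: "\<And>g'. g' \<in> \<G> \<Longrightarrow> shifted_sum g' = m \<Longrightarrow> disagreement g \<le> disagreement g'"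
    by (elim exE conjE) simp
  have Zh: "shifted_sum h \<le> m" using m[OF h] shifted_sum_cong[of "restrict h V" h] by simp
  show ?thesis
  proof (cases "m = 0")
    case True
    then show ?thesis using Zh shifted_sum_nonneg[of "\<lambda>_ _. 0"] by simp
  next
    case False
    then have m0: "m > 0" using shifted_sum_nonneg[of g] g by simp
    have agree: "g x = g y" if xy: "x \<in> V" "y \<in> V" "0 < J x y" for x y
    proof (rule ccontr)
      assume ne: "g x \<noteq> g y"
      obtain \<theta> H where R: "reflection \<theta> H" and "x \<in> H \<longleftrightarrow> y \<notin> H" using reflectable[OF xy] by blast
      then obtain x' y' where xy': "x' \<in> H" "y' \<in> V - H" "0 < J x' y'" "g x' \<noteq> g y'"
      proof (cases "x \<in> H")
        case True
        then show ?thesis using that[of x y] xy ne \<open>x \<in> H \<longleftrightarrow> y \<notin> H\<close> by simp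
      next
        case False
        then show ?thesis using that[of y x] xy ne[symmetric] J_sym[of x y] \<open>x \<in> H \<longleftrightarrow> y \<notin> H\<close> by simp
      qed
      have H: "H \<subseteq> V" using R unfolding reflection_def by blast
      have \<theta>V: "\<theta> x \<in> V" if "x \<in> V" for x
      proof (cases "x \<in> H")
        case True
        then have "\<theta> x \<in> V - H" unfolding reflectionD(2)[OF R, symmetric] by (rule imageI)
        then show ?thesis by simp
      next
        case False
        then have "x \<in> \<theta> ` H" using that reflectionD(2)[OF R] by simp
        then obtain y where "y \<in> H" "x = \<theta> y" by blast
        then show ?thesis using reflectionD(3)[OF R, of y] H by auto
      qed
      define gL where "gL = restrict (fold_across \<theta> H g) V"
      define gR where "gR = restrict (fold_across \<theta> H (g \<circ> \<theta>)) V"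
      note \<theta>\<theta> = reflectionD(3)[OF R]
      have gV: "g x \<in> h ` V" if "x \<in> V" for x using g(1) that unfolding \<G>_def by (rule PiE_mem)
      have mem: "gL \<in> \<G>" "gR \<in> \<G>" unfolding gL_def gR_def \<G>_def fold_across_def
        by (simp_all add: restrict_PiE_iff gV \<theta>V \<theta>\<theta>)
      have Z: "shifted_sum gL = shifted_sum (fold_across \<theta> H g)" "shifted_sum gR = shifted_sum (fold_across \<theta> H (g \<circ> \<theta>))"
        unfolding gL_def gR_def by (rule shifted_sum_cong, simp)+
      have D: "disagreement gL = disagreement (fold_across \<theta> H g)" "disagreement gR = disagreement (fold_across \<theta> H (g \<circ> \<theta>))"
        by (simp_all add: gL_def gR_def disagreement_def)
      have CS: "m * m \<le> shifted_sum gL * shifted_sum gR"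
        using reflection_Cauchy_Schwarz[OF R, of g] g(2) by (simp add: Z power2_eq_square)
      have "shifted_sum gL * shifted_sum gR \<le> m * shifted_sum gR" "shifted_sum gL * shifted_sum gR \<le> shifted_sum gL * m"
        by (rule mult_right_mono[OF m[OF mem(1)] shifted_sum_nonneg], rule mult_left_mono[OF m[OF mem(2)] shifted_sum_nonneg])
      then have "m * m \<le> m * shifted_sum gR" "m * m \<le> m * shifted_sum gL" using CS by (simp_all add: mult.commute)
      then have "m \<le> shifted_sum gR" "m \<le> shifted_sum gL" using m0 by simp_all
      then have "shifted_sum gL = m" "shifted_sum gR = m" using m[OF mem(1)] m[OF mem(2)] by linarith+
      then have "2 * disagreement g \<le> disagreement gL + disagreement gR"
        using least[OF mem(1)] least[OF mem(2)] by simp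
      then show False using disagreement_fold_across[OF R xy'] D by simp
    qed
    have E: "real (J x y) * (\<Sum>i\<in>I. (s x i - g x i - (s y i - g y i))\<^sup>2)
        = real (J x y) * (\<Sum>i\<in>I. (s x i - s y i)\<^sup>2)" if "x \<in> V" "y \<in> V" for s x y
      using agree[OF that] by (cases "J x y = 0") simp_all
    have "energy (\<lambda>x i. s x i - g x i) = energy (\<lambda>x i. s x i - 0)" for s
      by (simp add: energy_def E)
    then have "shifted_sum g = shifted_sum (\<lambda>_ _. 0)" by (simp only: shifted_sum_def)
    then show ?thesis using Zh g by simp
  qed
qed

end

context spin_graph
begin

definition pairing :: "('v \<Rightarrow> 'i \<Rightarrow> real) \<Rightarrow> ('v \<Rightarrow> 'i \<Rightarrow> real) \<Rightarrow> real" where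
  "pairing f g = (\<Sum>x\<in>V. \<Sum>i\<in>I. f x i * g x i)"

definition weight :: "('v \<Rightarrow> 'i \<Rightarrow> real) \<Rightarrow> real" where
  "weight s = (\<Prod>x\<in>V. \<rho> (s x)) * exp (- energy s)"

text \<open>The hypothesis says that \<open>h\<close> is an eigenvector of the graph Laplacian with eigenvalue \<open>l\<close>.\<close>

lemma summation_by_parts:
  assumes eig: "\<And>x i. x \<in> V \<Longrightarrow> i \<in> I \<Longrightarrow> (\<Sum>y\<in>V. real (J x y) * (h x i - h y i)) = l * h x i"
  shows "(\<Sum>x\<in>V. \<Sum>y\<in>V. real (J x y) * (\<Sum>i\<in>I. (f x i - f y i) * (h x i - h y i))) = 2 * l * pairing f h"
proof -
  define A where "A = (\<Sum>x\<in>V. \<Sum>y\<in>V. \<Sum>i\<in>I. real (J x y) * (f x i * (h x i - h y i)))"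
  have B: "(\<Sum>x\<in>V. \<Sum>y\<in>V. \<Sum>i\<in>I. real (J x y) * (f y i * (h y i - h x i))) = A"
    unfolding A_def by (subst sum.swap) (simp add: J_sym)
  have "A = (\<Sum>x\<in>V. \<Sum>i\<in>I. \<Sum>y\<in>V. real (J x y) * (f x i * (h x i - h y i)))"
    unfolding A_def by (intro sum.cong refl sum.swap)
  also have "\<dots> = (\<Sum>x\<in>V. \<Sum>i\<in>I. f x i * (\<Sum>y\<in>V. real (J x y) * (h x i - h y i)))"
    by (simp add: sum_distrib_left mult_ac)
  also have "\<dots> = l * pairing f h"
    by (simp add: eig pairing_def sum_distrib_left mult_ac)
  finally have A: "A = l * pairing f h" .
  have "(\<Sum>x\<in>V. \<Sum>y\<in>V. real (J x y) * (\<Sum>i\<in>I. (f x i - f y i) * (h x i - h y i)))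
    = (\<Sum>x\<in>V. \<Sum>y\<in>V. (\<Sum>i\<in>I. real (J x y) * (f x i * (h x i - h y i)))
        + (\<Sum>i\<in>I. real (J x y) * (f y i * (h y i - h x i))))"
    by (simp add: sum_distrib_left sum.distrib[symmetric] algebra_simps)
  also have "\<dots> = 2 * A" by (simp only: sum.distrib A_def[symmetric] B)
  finally show ?thesis using A by simp
qed

lemma energy_shift:
  assumes eig: "\<And>x i. x \<in> V \<Longrightarrow> i \<in> I \<Longrightarrow> (\<Sum>y\<in>V. real (J x y) * (h x i - h y i)) = l * h x i"
  shows "energy (\<lambda>x i. s x i - e * h x i)
    = energy s - e * (\<kappa> * l * pairing s h) + e\<^sup>2 * (\<kappa> / 2 * l * pairing h h)"
proof -
  have "(\<Sum>x\<in>V. \<Sum>y\<in>V. real (J x y) * (\<Sum>i\<in>I. (s x i - e * h x i - (s y i - e * h y i))\<^sup>2))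
    = (\<Sum>x\<in>V. \<Sum>y\<in>V. real (J x y) * (\<Sum>i\<in>I. (s x i - s y i)\<^sup>2)
        - 2 * e * (real (J x y) * (\<Sum>i\<in>I. (s x i - s y i) * (h x i - h y i)))
        + e\<^sup>2 * (real (J x y) * (\<Sum>i\<in>I. (h x i - h y i) * (h x i - h y i))))"
    by (intro sum.cong refl)
      (simp add: sum_distrib_left sum.distrib[symmetric] sum_subtractf[symmetric] power2_eq_square algebra_simps)
  also have "\<dots> = (\<Sum>x\<in>V. \<Sum>y\<in>V. real (J x y) * (\<Sum>i\<in>I. (s x i - s y i)\<^sup>2))
      - 2 * e * (2 * l * pairing s h) + e\<^sup>2 * (2 * l * pairing h h)"
    by (simp only: sum.distrib sum_subtractf sum_distrib_left[symmetric] summation_by_parts[OF eig])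
  finally show ?thesis unfolding energy_def by (simp only:) (simp add: algebra_simps)
qed

text \<open>Compare the terms of second order in \<open>e\<close> on both sides of \<open>Gaussian_domination\<close> for the field
\<open>e * h\<close>. Adding the inequalities for \<open>e\<close> and \<open>- e\<close> cancels the first order.\<close>

lemma infrared_bound:
  assumes reflectable: "\<And>x y. x \<in> V \<Longrightarrow> y \<in> V \<Longrightarrow> 0 < J x y \<Longrightarrow>
     \<exists>\<theta> H. reflection \<theta> H \<and> (x \<in> H \<longleftrightarrow> y \<notin> H)"
    and eig: "\<And>x i. x \<in> V \<Longrightarrow> i \<in> I \<Longrightarrow> (\<Sum>y\<in>V. real (J x y) * (h x i - h y i)) = l * h x i"
    and l: "0 \<le> l"
  shows "\<kappa> * l * (\<Sum>s\<in>V \<rightarrow>\<^sub>E S. weight s * (pairing s h)\<^sup>2) \<le> pairing h h * (\<Sum>s\<in>V \<rightarrow>\<^sub>E S. weight s)"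
proof (cases "l = 0")
  case True
  have "0 \<le> pairing h h" by (simp add: pairing_def sum_nonneg)
  moreover have "0 \<le> (\<Sum>s\<in>V \<rightarrow>\<^sub>E S. weight s)"
    unfolding weight_def by (intro sum_nonneg mult_nonneg_nonneg prod_nonneg \<rho>_nonneg ballI) (auto dest: PiE_mem)
  ultimately show ?thesis using True by simp
next
  case False
  then have \<kappa>l: "0 < \<kappa> * l" using l \<kappa>_pos by simp
  define X where "X s = \<kappa> * l * pairing s h" for s
  define c where "c = \<kappa> / 2 * l * pairing h h"
  define Z where "Z = (\<Sum>s\<in>V \<rightarrow>\<^sub>E S. weight s)"
  have Zf0: "shifted_sum (\<lambda>_ _. 0) = Z" by (simp add: shifted_sum_def Z_def weight_def)
  have Zfe: "shifted_sum (\<lambda>x i. e * h x i) = exp (- (e\<^sup>2 * c)) * (\<Sum>s\<in>V \<rightarrow>\<^sub>E S. weight s * exp (e * X s))" for e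
    unfolding shifted_sum_def sum_distrib_left
  proof (rule sum.cong[OF refl])
    fix s
    have "energy (\<lambda>x i. s x i - e * h x i) = energy s - e * X s + e\<^sup>2 * c"
      unfolding X_def c_def by (rule energy_shift) (rule eig)
    then have "exp (- energy (\<lambda>x i. s x i - e * h x i)) = exp (- (e\<^sup>2 * c)) * exp (- energy s) * exp (e * X s)"
      by (simp add: exp_add[symmetric])
    then show "(\<Prod>x\<in>V. \<rho> (s x)) * exp (- energy (\<lambda>x i. s x i - e * h x i))
      = exp (- (e\<^sup>2 * c)) * (weight s * exp (e * X s))"
      by (simp add: weight_def)
  qed
  have dom: "(\<Sum>s\<in>V \<rightarrow>\<^sub>E S. weight s * exp (e * X s)) \<le> exp (e\<^sup>2 * c) * Z" for e
    using Gaussian_domination[OF reflectable, of "\<lambda>x i. e * h x i"] unfolding Zf0 Zfe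
    by (simp add: exp_minus field_simps)
  have ineq: "(\<Sum>s\<in>V \<rightarrow>\<^sub>E S. weight s * ((exp (e * X s) + exp (- (e * X s)) - 2) / e\<^sup>2))
      \<le> 2 * Z * ((exp (e\<^sup>2 * c) - 1) / e\<^sup>2)" for e :: real
  proof -
    have "(\<Sum>s\<in>V \<rightarrow>\<^sub>E S. weight s * ((exp (e * X s) + exp (- (e * X s)) - 2) / e\<^sup>2))
      = ((\<Sum>s\<in>V \<rightarrow>\<^sub>E S. weight s * exp (e * X s)) + (\<Sum>s\<in>V \<rightarrow>\<^sub>E S. weight s * exp ((-e) * X s)) - 2 * Z) / e\<^sup>2"
      unfolding Z_def sum_distrib_left sum.distrib[symmetric] sum_subtractf[symmetric] sum_divide_distrib
      by (intro sum.cong refl) (simp add: algebra_simps add_divide_distrib diff_divide_distrib)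
    also have "\<dots> \<le> (exp (e\<^sup>2 * c) * Z + exp (e\<^sup>2 * c) * Z - 2 * Z) / e\<^sup>2"
    proof (rule divide_right_mono)
      show "(\<Sum>s\<in>V \<rightarrow>\<^sub>E S. weight s * exp (e * X s)) + (\<Sum>s\<in>V \<rightarrow>\<^sub>E S. weight s * exp (- e * X s)) - 2 * Z
        \<le> exp (e\<^sup>2 * c) * Z + exp (e\<^sup>2 * c) * Z - 2 * Z"
        using add_mono[OF dom[of e] dom[of "- e"]] by (simp only: power2_minus diff_right_mono)
    qed simp
    also have "\<dots> = 2 * Z * ((exp (e\<^sup>2 * c) - 1) / e\<^sup>2)" by (simp add: algebra_simps)
    finally show ?thesis .
  qed
  have lim1: "((\<lambda>e::real. (exp (e * x) + exp (- (e * x)) - 2) / e\<^sup>2) \<longlongrightarrow> x\<^sup>2) (at_right 0)" for x :: real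
  proof -
    consider "x > 0" | "x = 0" | "x < 0" by linarith
    then have "((\<lambda>e::real. (exp (e * x) + exp (- (e * x)) - 2) / e\<^sup>2) \<longlongrightarrow> x * x) (at_right 0)"
      by cases (real_asymp, simp, real_asymp)
    then show ?thesis by (simp add: power2_eq_square)
  qed
  have lim2: "((\<lambda>e::real. (exp (e\<^sup>2 * c) - 1) / e\<^sup>2) \<longlongrightarrow> c) (at_right 0)"
  proof -
    consider "c > 0" | "c = 0" | "c < 0" by linarith
    then show ?thesis by cases (real_asymp, simp, real_asymp)
  qed
  have "(\<Sum>s\<in>V \<rightarrow>\<^sub>E S. weight s * (X s)\<^sup>2) \<le> 2 * Z * c"
  proof (rule tendsto_le)
    show "((\<lambda>e. \<Sum>s\<in>V \<rightarrow>\<^sub>E S. weight s * ((exp (e * X s) + exp (- (e * X s)) - 2) / e\<^sup>2))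
       \<longlongrightarrow> (\<Sum>s\<in>V \<rightarrow>\<^sub>E S. weight s * (X s)\<^sup>2)) (at_right 0)"
      by (intro tendsto_sum tendsto_mult tendsto_const lim1)
    show "((\<lambda>e. 2 * Z * ((exp (e\<^sup>2 * c) - 1) / e\<^sup>2)) \<longlongrightarrow> 2 * Z * c) (at_right 0)"
      by (intro tendsto_mult tendsto_const lim2)
  qed (use ineq in auto)
  then have "(\<kappa> * l) * (\<kappa> * l * (\<Sum>s\<in>V \<rightarrow>\<^sub>E S. weight s * (pairing s h)\<^sup>2)) \<le> (\<kappa> * l) * (pairing h h * Z)"
    by (simp add: X_def c_def sum_distrib_left power2_eq_square mult_ac)
  then show ?thesis using \<kappa>l unfolding Z_def by (rule mult_left_le_imp_le)
qed

end

section \<open>Powers of symmetric kernels on a finite set\<close>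

fun kpow :: "'a set \<Rightarrow> ('a \<Rightarrow> 'a \<Rightarrow> real) \<Rightarrow> nat \<Rightarrow> 'a \<Rightarrow> 'a \<Rightarrow> real" where
  "kpow \<Omega> T 0 x y = of_bool (x = y)"
| "kpow \<Omega> T (Suc m) x y = (\<Sum>z\<in>\<Omega>. kpow \<Omega> T m x z * T z y)"

text \<open>Positive semidefiniteness in the form \<open>K = Y\<^sup>T Y\<close>. The explicit factor \<open>Y\<close> makes the traces below
visibly sums of squares, and no diagonalisation is needed.\<close>

definition gram :: "'a set \<Rightarrow> ('a \<Rightarrow> 'a \<Rightarrow> real) \<Rightarrow> bool" where
  "gram \<Omega> K \<longleftrightarrow> (\<exists>Y. \<forall>x\<in>\<Omega>. \<forall>y\<in>\<Omega>. K x y = (\<Sum>v\<in>\<Omega>. Y v x * Y v y))"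

locale sym_kernel =
  fixes \<Omega> :: "'a set" and T :: "'a \<Rightarrow> 'a \<Rightarrow> real"
  assumes fin: "finite \<Omega>" and T_sym: "\<And>x y. T x y = T y x" and T_gram: "gram \<Omega> T"
begin

abbreviation "K \<equiv> kpow \<Omega> T"

lemma kpow_1: "x \<in> \<Omega> \<Longrightarrow> K (Suc 0) x y = T x y"
  using fin by (simp add: if_distrib sum.delta' cong: if_cong) 

lemma kpow_Suc_left: "x \<in> \<Omega> \<Longrightarrow> y \<in> \<Omega> \<Longrightarrow> K (Suc m) x y = (\<Sum>z\<in>\<Omega>. T x z * K m z y)"
proof (induction m arbitrary: y)
  case 0
  then show ?case using fin by simp
next
  case (Suc m)
  have "K (Suc (Suc m)) x y = (\<Sum>z\<in>\<Omega>. \<Sum>w\<in>\<Omega>. T x w * K m w z * T z y)"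
    using Suc by (simp add: sum_distrib_right del: kpow.simps(2) add: kpow.simps(2)[of _ _ "Suc m"])
  also have "\<dots> = (\<Sum>w\<in>\<Omega>. \<Sum>z\<in>\<Omega>. T x w * K m w z * T z y)" by (rule sum.swap)
  finally show ?case by (simp add: sum_distrib_left mult_ac)
qed

lemma kpow_sym: "x \<in> \<Omega> \<Longrightarrow> y \<in> \<Omega> \<Longrightarrow> K m x y = K m y x"
proof (induction m arbitrary: x y)
  case 0
  then show ?case by (simp add: eq_commute)
next
  case (Suc m)
  have "K (Suc m) x y = (\<Sum>z\<in>\<Omega>. T y z * K m z x)"
    using Suc T_sym by (simp add: mult.commute)
  then show ?case using kpow_Suc_left[OF Suc.prems(2,1)] by simp
qed

lemma kpow_Suc_Suc: "x \<in> \<Omega> \<Longrightarrow> y \<in> \<Omega> \<Longrightarrow>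
   K (Suc (Suc m)) x y = (\<Sum>z\<in>\<Omega>. \<Sum>w\<in>\<Omega>. T z x * K m z w * T w y)"
  by (subst kpow_Suc_left) (auto simp: sum_distrib_left mult_ac T_sym[of x] intro!: sum.cong)

text \<open>If \<open>T\<^sup>m = Y\<^sup>T Y\<close>, then \<open>T T\<^sup>m T = (Y T)\<^sup>T (Y T)\<close> by the symmetry of \<open>T\<close>; the powers 0 and 1 start
the induction.\<close>

lemma gram_kpow: "gram \<Omega> (K m)"
proof (induction m rule: induct_nat_012)
  case 0
  show ?case unfolding gram_def
  proof (intro exI ballI)
    fix x y assume "x \<in> \<Omega>" "y \<in> \<Omega>"
    have "of_bool (v = x) * of_bool (v = y) = (if v = x then of_bool (x = y) else 0 :: real)" for v
      by simp
    then show "K 0 x y = (\<Sum>v\<in>\<Omega>. of_bool (v = x) * of_bool (v = y))"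
      using \<open>x \<in> \<Omega>\<close> fin by (simp only: sum.delta) simp
  qed
next
  case 1
  show ?case using T_gram unfolding gram_def by (simp only: kpow_1 One_nat_def cong: ball_cong)
next
  case (ge2 m)
  then obtain Y where Y: "\<And>x y. x \<in> \<Omega> \<Longrightarrow> y \<in> \<Omega> \<Longrightarrow> K m x y = (\<Sum>v\<in>\<Omega>. Y v x * Y v y)"
    unfolding gram_def by blast
  have "K (Suc (Suc m)) x y = (\<Sum>v\<in>\<Omega>. (\<Sum>z\<in>\<Omega>. Y v z * T z x) * (\<Sum>w\<in>\<Omega>. Y v w * T w y))"
    if "x \<in> \<Omega>" "y \<in> \<Omega>" for x y
  proof -
    have "K (Suc (Suc m)) x y = (\<Sum>z\<in>\<Omega>. \<Sum>w\<in>\<Omega>. \<Sum>v\<in>\<Omega>. (Y v z * T z x) * (Y v w * T w y))"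
      using that by (simp add: kpow_Suc_Suc Y sum_distrib_left sum_distrib_right mult_ac del: kpow.simps)
    also have "\<dots> = (\<Sum>z\<in>\<Omega>. \<Sum>v\<in>\<Omega>. \<Sum>w\<in>\<Omega>. (Y v z * T z x) * (Y v w * T w y))"
      by (intro sum.cong refl sum.swap)
    also have "\<dots> = (\<Sum>v\<in>\<Omega>. \<Sum>z\<in>\<Omega>. \<Sum>w\<in>\<Omega>. (Y v z * T z x) * (Y v w * T w y))"
      by (rule sum.swap)
    finally show ?thesis by (simp only: sum_product)
  qed
  then show ?case unfolding gram_def
    by (intro exI[of _ "\<lambda>v x. \<Sum>z\<in>\<Omega>. Y v z * T z x"] ballI)
qed

text \<open>With \<open>A = Y\<^sup>T Y\<close> and \<open>B = Y'\<^sup>T Y'\<close>, the trace of \<open>A X B X\<^sup>T\<close> is the sum of the squares of the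
entries of \<open>Y X Y'\<^sup>T\<close>.\<close>

lemma trace_gram_nonneg:
  assumes "gram \<Omega> A" "gram \<Omega> B"
  shows "0 \<le> (\<Sum>w\<in>\<Omega>. \<Sum>x\<in>\<Omega>. \<Sum>y\<in>\<Omega>. \<Sum>z\<in>\<Omega>. A w x * X x y * B y z * X w z)"
proof -
  obtain Y where Y: "\<And>x y. x \<in> \<Omega> \<Longrightarrow> y \<in> \<Omega> \<Longrightarrow> A x y = (\<Sum>v\<in>\<Omega>. Y v x * Y v y)"
    using assms(1) unfolding gram_def by blast
  obtain Y' where Y': "\<And>x y. x \<in> \<Omega> \<Longrightarrow> y \<in> \<Omega> \<Longrightarrow> B x y = (\<Sum>v\<in>\<Omega>. Y' v x * Y' v y)"
    using assms(2) unfolding gram_def by blast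
  define C where "C u v = (\<Sum>x\<in>\<Omega>. \<Sum>y\<in>\<Omega>. Y u x * X x y * Y' v y)" for u v
  define G where "G u v w x y z = (Y u x * X x y * Y' v y) * (Y u w * X w z * Y' v z)" for u v w x y z
  have "(\<Sum>w\<in>\<Omega>. \<Sum>x\<in>\<Omega>. \<Sum>y\<in>\<Omega>. \<Sum>z\<in>\<Omega>. A w x * X x y * B y z * X w z)
    = (\<Sum>w\<in>\<Omega>. \<Sum>x\<in>\<Omega>. \<Sum>y\<in>\<Omega>. \<Sum>z\<in>\<Omega>. \<Sum>u\<in>\<Omega>. \<Sum>v\<in>\<Omega>. G u v w x y z)"
    by (intro sum.cong refl) (simp add: G_def Y Y' sum_distrib_left sum_distrib_right mult_ac)
  also have "\<dots> = (\<Sum>w\<in>\<Omega>. \<Sum>x\<in>\<Omega>. \<Sum>y\<in>\<Omega>. \<Sum>u\<in>\<Omega>. \<Sum>z\<in>\<Omega>. \<Sum>v\<in>\<Omega>. G u v w x y z)"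
    by (intro sum.cong refl sum.swap)
  also have "\<dots> = (\<Sum>w\<in>\<Omega>. \<Sum>x\<in>\<Omega>. \<Sum>u\<in>\<Omega>. \<Sum>y\<in>\<Omega>. \<Sum>z\<in>\<Omega>. \<Sum>v\<in>\<Omega>. G u v w x y z)"
    by (intro sum.cong refl sum.swap)
  also have "\<dots> = (\<Sum>w\<in>\<Omega>. \<Sum>u\<in>\<Omega>. \<Sum>x\<in>\<Omega>. \<Sum>y\<in>\<Omega>. \<Sum>z\<in>\<Omega>. \<Sum>v\<in>\<Omega>. G u v w x y z)"
    by (intro sum.cong refl sum.swap)
  also have "\<dots> = (\<Sum>u\<in>\<Omega>. \<Sum>w\<in>\<Omega>. \<Sum>x\<in>\<Omega>. \<Sum>y\<in>\<Omega>. \<Sum>z\<in>\<Omega>. \<Sum>v\<in>\<Omega>. G u v w x y z)"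
    by (rule sum.swap)
  also have "\<dots> = (\<Sum>u\<in>\<Omega>. \<Sum>w\<in>\<Omega>. \<Sum>x\<in>\<Omega>. \<Sum>y\<in>\<Omega>. \<Sum>v\<in>\<Omega>. \<Sum>z\<in>\<Omega>. G u v w x y z)"
    by (intro sum.cong refl sum.swap)
  also have "\<dots> = (\<Sum>u\<in>\<Omega>. \<Sum>w\<in>\<Omega>. \<Sum>x\<in>\<Omega>. \<Sum>v\<in>\<Omega>. \<Sum>y\<in>\<Omega>. \<Sum>z\<in>\<Omega>. G u v w x y z)"
    by (intro sum.cong refl sum.swap)
  also have "\<dots> = (\<Sum>u\<in>\<Omega>. \<Sum>w\<in>\<Omega>. \<Sum>v\<in>\<Omega>. \<Sum>x\<in>\<Omega>. \<Sum>y\<in>\<Omega>. \<Sum>z\<in>\<Omega>. G u v w x y z)"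
    by (intro sum.cong refl sum.swap)
  also have "\<dots> = (\<Sum>u\<in>\<Omega>. \<Sum>v\<in>\<Omega>. \<Sum>w\<in>\<Omega>. \<Sum>x\<in>\<Omega>. \<Sum>y\<in>\<Omega>. \<Sum>z\<in>\<Omega>. G u v w x y z)"
    by (intro sum.cong refl sum.swap)
  also have "\<dots> = (\<Sum>u\<in>\<Omega>. \<Sum>v\<in>\<Omega>. C u v * C u v)"
    unfolding C_def G_def by (intro sum.cong refl) (simp only: sum_distrib_left[symmetric] sum_distrib_right[symmetric])
  also have "\<dots> \<ge> 0" by (intro sum_nonneg) simp
  finally show ?thesis .
qed

lemma gram_diag_bound:
  assumes "gram \<Omega> A" "x \<in> \<Omega>" "y \<in> \<Omega>"
  shows "2 * (r * A x y * s) \<le> r * A x x * r + s * A y y * s"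
proof -
  obtain Y where Y: "\<And>x y. x \<in> \<Omega> \<Longrightarrow> y \<in> \<Omega> \<Longrightarrow> A x y = (\<Sum>v\<in>\<Omega>. Y v x * Y v y)"
    using assms(1) unfolding gram_def by blast
  have "0 \<le> (\<Sum>v\<in>\<Omega>. (r * Y v x - s * Y v y)\<^sup>2)" by (intro sum_nonneg) simp
  also have "\<dots> = r * A x x * r + s * A y y * s - 2 * (r * A x y * s)"
    using assms(2,3) by (simp add: Y power2_diff sum.distrib sum_subtractf sum_distrib_left sum_distrib_right power2_eq_square algebra_simps)
  finally show ?thesis by simp
qed

text \<open>The trace of \<open>a K a K'\<close>, where \<open>K\<close> and \<open>K'\<close> are the powers \<open>t\<close> and \<open>n - t\<close> of \<open>T\<close>, and
\<open>a\<close> acts as a diagonal matrix: the correlation of \<open>a\<close> at two places at distance \<open>t\<close> on a closed path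
of length \<open>n\<close>. By symmetry both powers may be evaluated at \<open>x\<close> and \<open>y\<close> in this order.\<close>

definition corr :: "nat \<Rightarrow> ('a \<Rightarrow> real) \<Rightarrow> nat \<Rightarrow> real" where
  "corr n a t = (\<Sum>x\<in>\<Omega>. \<Sum>y\<in>\<Omega>. a x * a y * (K t x y * K (n - t) x y))"

lemma corr_reflect: "t \<le> n \<Longrightarrow> corr n a (n - t) = corr n a t"
  by (simp add: corr_def mult_ac)

text \<open>With the commutator \<open>X x y = T x y * (a y - a x)\<close>, the second difference of \<open>corr n a\<close> at \<open>t\<close> is
the trace of \<open>T\<^sup>p X T\<^sup>q X\<^sup>T\<close> for \<open>p = t - 1\<close> and \<open>q = n - t - 1\<close>: of the four products in
\<open>(a y - a x) * (a z - a w)\<close>, one has its two places at distance \<open>t + 1\<close>, one at distance \<open>t - 1\<close>, and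
two at distance \<open>t\<close>.\<close>

lemma corr_convex:
  assumes "0 < t" "t < n"
  shows "2 * corr n a t \<le> corr n a (t + 1) + corr n a (t - 1)"
proof -
  obtain p where p: "t = Suc p" using assms(1) gr0_implies_Suc by blast
  define q where "q = n - t - 1"
  have n: "n = Suc p + Suc q" using assms p by (simp add: q_def)
  define F where "F w x y z = K p w x * T x y * K q y z * T w z" for w x y z
  have "0 \<le> (\<Sum>w\<in>\<Omega>. \<Sum>x\<in>\<Omega>. \<Sum>y\<in>\<Omega>. \<Sum>z\<in>\<Omega>. K p w x * (T x y * (a y - a x)) * K q y z * (T w z * (a z - a w)))"
    by (rule trace_gram_nonneg[OF gram_kpow gram_kpow, where X = "\<lambda>x y. T x y * (a y - a x)"])
  also have "\<dots> = (\<Sum>w\<in>\<Omega>. \<Sum>x\<in>\<Omega>. \<Sum>y\<in>\<Omega>. \<Sum>z\<in>\<Omega>. a y * a z * F w x y z)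
      + (\<Sum>w\<in>\<Omega>. \<Sum>x\<in>\<Omega>. \<Sum>y\<in>\<Omega>. \<Sum>z\<in>\<Omega>. a w * a x * F w x y z)
      - (\<Sum>w\<in>\<Omega>. \<Sum>x\<in>\<Omega>. \<Sum>y\<in>\<Omega>. \<Sum>z\<in>\<Omega>. a w * a y * F w x y z)
      - (\<Sum>w\<in>\<Omega>. \<Sum>x\<in>\<Omega>. \<Sum>y\<in>\<Omega>. \<Sum>z\<in>\<Omega>. a x * a z * F w x y z)"
    unfolding F_def sum.distrib[symmetric] sum_subtractf[symmetric]
    by (intro sum.cong refl) (simp add: algebra_simps)
  also have "(\<Sum>w\<in>\<Omega>. \<Sum>x\<in>\<Omega>. \<Sum>y\<in>\<Omega>. \<Sum>z\<in>\<Omega>. a y * a z * F w x y z) = corr n a (t + 1)"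
  proof -
    have "corr n a (t + 1) = (\<Sum>y\<in>\<Omega>. \<Sum>z\<in>\<Omega>. a y * a z * (K (Suc (Suc p)) z y * K q y z))"
      unfolding corr_def using n p by (intro sum.cong refl) (simp add: kpow_sym[of _ _ "Suc (Suc p)"] del: kpow.simps)
    also have "\<dots> = (\<Sum>y\<in>\<Omega>. \<Sum>z\<in>\<Omega>. \<Sum>w\<in>\<Omega>. \<Sum>x\<in>\<Omega>. a y * a z * F w x y z)"
      by (intro sum.cong refl) (simp add: kpow_Suc_Suc F_def sum_distrib_left sum_distrib_right mult_ac del: kpow.simps)
    also have "\<dots> = (\<Sum>y\<in>\<Omega>. \<Sum>w\<in>\<Omega>. \<Sum>z\<in>\<Omega>. \<Sum>x\<in>\<Omega>. a y * a z * F w x y z)"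
      by (intro sum.cong refl sum.swap)
    also have "\<dots> = (\<Sum>w\<in>\<Omega>. \<Sum>y\<in>\<Omega>. \<Sum>x\<in>\<Omega>. \<Sum>z\<in>\<Omega>. a y * a z * F w x y z)"
      by (subst sum.swap, intro sum.cong refl sum.swap)
    also have "\<dots> = (\<Sum>w\<in>\<Omega>. \<Sum>x\<in>\<Omega>. \<Sum>y\<in>\<Omega>. \<Sum>z\<in>\<Omega>. a y * a z * F w x y z)"
      by (intro sum.cong refl sum.swap)
    finally show ?thesis ..
  qed
  also have "(\<Sum>w\<in>\<Omega>. \<Sum>x\<in>\<Omega>. \<Sum>y\<in>\<Omega>. \<Sum>z\<in>\<Omega>. a w * a x * F w x y z) = corr n a (t - 1)"
  proof -
    have "corr n a (t - 1) = (\<Sum>w\<in>\<Omega>. \<Sum>x\<in>\<Omega>. a w * a x * (K p w x * K (Suc (Suc q)) x w))"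
      unfolding corr_def using n p by (intro sum.cong refl) (simp add: kpow_sym[of _ _ "Suc (Suc q)"] del: kpow.simps)
    also have "\<dots> = (\<Sum>w\<in>\<Omega>. \<Sum>x\<in>\<Omega>. \<Sum>y\<in>\<Omega>. \<Sum>z\<in>\<Omega>. a w * a x * F w x y z)"
      by (intro sum.cong refl)
        (simp add: kpow_Suc_Suc F_def sum_distrib_left sum_distrib_right mult_ac T_sym del: kpow.simps)
    finally show ?thesis ..
  qed
  also have "(\<Sum>w\<in>\<Omega>. \<Sum>x\<in>\<Omega>. \<Sum>y\<in>\<Omega>. \<Sum>z\<in>\<Omega>. a w * a y * F w x y z) = corr n a t"
  proof -
    have "corr n a t = (\<Sum>w\<in>\<Omega>. \<Sum>y\<in>\<Omega>. a w * a y * (K (Suc p) w y * K (Suc q) y w))"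
      unfolding corr_def using n p by (intro sum.cong refl) (simp add: kpow_sym[of _ _ "Suc q"] del: kpow.simps)
    also have "\<dots> = (\<Sum>w\<in>\<Omega>. \<Sum>y\<in>\<Omega>. \<Sum>x\<in>\<Omega>. \<Sum>z\<in>\<Omega>. a w * a y * F w x y z)"
    proof (intro sum.cong refl)
      fix w y
      have 1: "K (Suc q) y w = (\<Sum>z\<in>\<Omega>. K q y z * T w z)" by (simp add: T_sym[of w])
      have 2: "K (Suc p) w y = (\<Sum>x\<in>\<Omega>. K p w x * T x y)" by simp
      show "a w * a y * (K (Suc p) w y * K (Suc q) y w) = (\<Sum>x\<in>\<Omega>. \<Sum>z\<in>\<Omega>. a w * a y * F w x y z)"
        by (simp only: 1 2 sum_product) (simp only: F_def sum_distrib_left mult_ac)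
    qed
    also have "\<dots> = (\<Sum>w\<in>\<Omega>. \<Sum>x\<in>\<Omega>. \<Sum>y\<in>\<Omega>. \<Sum>z\<in>\<Omega>. a w * a y * F w x y z)"
      by (intro sum.cong refl sum.swap)
    finally show ?thesis ..
  qed
  also have "(\<Sum>w\<in>\<Omega>. \<Sum>x\<in>\<Omega>. \<Sum>y\<in>\<Omega>. \<Sum>z\<in>\<Omega>. a x * a z * F w x y z) = corr n a t"
  proof -
    have "corr n a t = (\<Sum>x\<in>\<Omega>. \<Sum>z\<in>\<Omega>. a x * a z * (K (Suc q) x z * K (Suc p) x z))"
      unfolding corr_def using n p by (intro sum.cong refl) (simp del: kpow.simps)
    also have "\<dots> = (\<Sum>x\<in>\<Omega>. \<Sum>z\<in>\<Omega>. \<Sum>y\<in>\<Omega>. \<Sum>w\<in>\<Omega>. a x * a z * F w x y z)"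
    proof (intro sum.cong refl)
      fix x z assume xz: "x \<in> \<Omega>" "z \<in> \<Omega>"
      have "K (Suc p) x z = (\<Sum>w\<in>\<Omega>. K p w x * T w z)"
        using xz by (auto intro!: sum.cong simp: kpow_sym[of x])
      then show "a x * a z * (K (Suc q) x z * K (Suc p) x z) = (\<Sum>y\<in>\<Omega>. \<Sum>w\<in>\<Omega>. a x * a z * F w x y z)"
        using kpow_Suc_left[OF xz, of q]
        by (simp only: sum_product) (simp only: F_def sum_distrib_left mult_ac)
    qed
    also have "\<dots> = (\<Sum>x\<in>\<Omega>. \<Sum>y\<in>\<Omega>. \<Sum>z\<in>\<Omega>. \<Sum>w\<in>\<Omega>. a x * a z * F w x y z)"
      by (intro sum.cong refl sum.swap)
    also have "\<dots> = (\<Sum>x\<in>\<Omega>. \<Sum>y\<in>\<Omega>. \<Sum>w\<in>\<Omega>. \<Sum>z\<in>\<Omega>. a x * a z * F w x y z)"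
      by (intro sum.cong refl sum.swap)
    also have "\<dots> = (\<Sum>x\<in>\<Omega>. \<Sum>w\<in>\<Omega>. \<Sum>y\<in>\<Omega>. \<Sum>z\<in>\<Omega>. a x * a z * F w x y z)"
      by (intro sum.cong refl sum.swap)
    also have "\<dots> = (\<Sum>w\<in>\<Omega>. \<Sum>x\<in>\<Omega>. \<Sum>y\<in>\<Omega>. \<Sum>z\<in>\<Omega>. a x * a z * F w x y z)"
      by (rule sum.swap)
    finally show ?thesis ..
  qed
  finally show ?thesis by simp
qed

end

text \<open>Summing by parts twice around the cycle moves the factor \<open>2 - 2 * cos \<theta>\<close> to the negative second
difference of \<open>f\<close>. At \<open>t = 0\<close> this equals \<open>2 * (f 0 - f 1)\<close>. Elsewhere the second differences are
nonnegative, and they add up to \<open>2 * (f 0 - f 1)\<close> because the total over the cycle vanishes; so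
\<open>- cos \<le> 1\<close> costs the same amount once more.\<close>

lemma convex_Fourier_bound:
  fixes f :: "nat \<Rightarrow> real" and m :: int
  assumes n: "2 \<le> n"
    and convex: "\<And>t. 0 < t \<Longrightarrow> t < n \<Longrightarrow> 2 * f t \<le> f (t + 1) + f (t - 1)"
    and refl: "\<And>t. t \<le> n \<Longrightarrow> f (n - t) = f t"
    and \<theta>: "\<theta> * real n = 2 * pi * of_int m"
  shows "(2 - 2 * cos \<theta>) * (\<Sum>t<n. cos (\<theta> * real t) * f t) \<le> 4 * (f 0 - f 1)"
proof -
  define c where "c t = cos (\<theta> * real t)" for t
  define \<Delta> where "\<Delta> t = f (t + 1) + f (t - 1) - 2 * f t" for t
  obtain k where k: "n = Suc k" using n by (metis Suc_le_D numeral_2_eq_2)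
  have fn: "f n = f 0" "f k = f 1" using refl[of 0] refl[of 1] k n by simp_all
  have cn: "c n = 1" by (simp only: c_def \<theta> cos_int_2pin)
  have cn1: "c k = cos \<theta>"
  proof -
    have "\<theta> * real k = 2 * pi * of_int m - \<theta>" using \<theta> k by (simp add: algebra_simps)
    then show ?thesis unfolding c_def by (simp add: cos_diff cos_int_2pin sin_int_2pin del: of_int_mult)
  qed
  have step: "(2 - 2 * cos \<theta>) * c (Suc t) = 2 * c (Suc t) - c (Suc (Suc t)) - c t" for t
  proof -
    have 1: "\<theta> * real (Suc (Suc t)) = \<theta> * real (Suc t) + \<theta>" "\<theta> * real t = \<theta> * real (Suc t) - \<theta>"
      by (simp_all add: algebra_simps)
    show ?thesis unfolding c_def 1 cos_add cos_diff by (simp add: algebra_simps)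
  qed
  have shift: "(\<Sum>t<k. g (Suc t)) = (\<Sum>t<k. g t) + g k - g 0" for g :: "nat \<Rightarrow> real"
    using sum.lessThan_Suc_shift[of g k] by simp
  have "(2 - 2 * cos \<theta>) * (\<Sum>t<n. c t * f t)
      = (2 - 2 * cos \<theta>) * f 0 + (\<Sum>t<k. (2 * c (Suc t) - c (Suc (Suc t)) - c t) * f (Suc t))"
    unfolding k sum.lessThan_Suc_shift distrib_left sum_distrib_left mult.assoc[symmetric] step
    by (simp add: c_def)
  also have "(\<Sum>t<k. (2 * c (Suc t) - c (Suc (Suc t)) - c t) * f (Suc t))
      = (\<Sum>t<k. 2 * c (Suc t) * f (Suc t)) - (\<Sum>t<k. c (Suc (Suc t)) * f (Suc t)) - (\<Sum>t<k. c t * f (Suc t))"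
    by (simp add: sum_subtractf left_diff_distrib)
  also have "(\<Sum>t<k. c (Suc (Suc t)) * f (Suc t)) = (\<Sum>t<k. c (Suc t) * f t) + f 1 - c 1 * f 0"
    using shift[of "\<lambda>t. c (Suc t) * f t"] cn fn k by simp
  also have "(\<Sum>t<k. c t * f (Suc t)) = (\<Sum>t<k. c (Suc t) * f (Suc (Suc t))) - cos \<theta> * f 0 + f 1"
    using shift[of "\<lambda>t. c t * f (Suc t)"] cn1 fn k by (simp add: c_def)
  finally have "(2 - 2 * cos \<theta>) * (\<Sum>t<n. c t * f t)
      = 2 * (f 0 - f 1) - (\<Sum>t<k. c (Suc t) * \<Delta> (Suc t))"
    by (simp add: \<Delta>_def sum.distrib sum_subtractf algebra_simps c_def sum_distrib_left)
  also have "\<dots> \<le> 2 * (f 0 - f 1) + (\<Sum>t<k. \<Delta> (Suc t))"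
  proof -
    have "- (c (Suc t) * \<Delta> (Suc t)) \<le> \<Delta> (Suc t)" if "t < k" for t
    proof -
      have "0 \<le> \<Delta> (Suc t)" using convex[of "Suc t"] that k by (simp add: \<Delta>_def)
      moreover have "- c (Suc t) \<le> 1" using cos_ge_minus_one by (simp add: c_def minus_le_iff)
      ultimately have "- c (Suc t) * \<Delta> (Suc t) \<le> 1 * \<Delta> (Suc t)" by (rule mult_right_mono[rotated])
      then show ?thesis by simp
    qed
    then have "(\<Sum>t<k. - (c (Suc t) * \<Delta> (Suc t))) \<le> (\<Sum>t<k. \<Delta> (Suc t))" by (intro sum_mono) auto
    then show ?thesis by (simp add: sum_negf)
  qed
  also have "(\<Sum>t<k. \<Delta> (Suc t)) = 2 * (f 0 - f 1)"
  proof -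
    have "(\<Sum>t<k. \<Delta> (Suc t)) = (\<Sum>t<k. (f (Suc (Suc t)) - f (Suc t)) - (f (Suc t) - f t))"
      by (simp add: \<Delta>_def)
    also have "\<dots> = (f (Suc k) - f k) - (f 1 - f 0)"
      by (subst sum_lessThan_telescope[of "\<lambda>t. f (Suc t) - f t"]) simp
    finally show ?thesis using fn k by simp
  qed
  finally show ?thesis by (simp add: c_def)
qed

section \<open>Closed paths\<close>

lemma mod_rotate:
  fixes i j n :: nat
  assumes "i \<le> n" "j < n"
  shows "((i + j) mod n + (n - i)) mod n = j" "(i + (j + (n - i)) mod n) mod n = j"
proof -
  have "(i + j) + (n - i) = j + n" "i + (j + (n - i)) = j + n" using assms by simp_all
  then show "((i + j) mod n + (n - i)) mod n = j" "(i + (j + (n - i)) mod n) mod n = j"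
    using assms by (simp_all only: mod_add_left_eq mod_add_right_eq) simp_all
qed

lemma prod_rotate_index:
  fixes f :: "nat \<Rightarrow> real"
  assumes "i \<le> n"
  shows "(\<Prod>j<n. f ((i + j) mod n)) = (\<Prod>j<n. f j)"
  by (rule prod.reindex_bij_witness[where i = "\<lambda>j. (j + (n - i)) mod n" and j = "\<lambda>j. (i + j) mod n"])
    (use mod_rotate[OF assms] in \<open>auto simp: mod_simps intro: mod_less_divisor\<close>)

lemma sum_rotate_index:
  fixes f :: "nat \<Rightarrow> real"
  assumes "i \<le> n"
  shows "(\<Sum>j<n. f ((i + j) mod n)) = (\<Sum>j<n. f j)"
  by (rule sum.reindex_bij_witness[where i = "\<lambda>j. (j + (n - i)) mod n" and j = "\<lambda>j. (i + j) mod n"])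
    (use mod_rotate[OF assms] in \<open>auto simp: mod_simps intro: mod_less_divisor\<close>)

context sym_kernel
begin

lemma sum_paths_Suc:
  fixes F :: "(nat \<Rightarrow> 'a) \<Rightarrow> real"
  shows "(\<Sum>s\<in>{..Suc m} \<rightarrow>\<^sub>E \<Omega>. F s) = (\<Sum>s\<in>{..m} \<rightarrow>\<^sub>E \<Omega>. \<Sum>w\<in>\<Omega>. F (s(Suc m := w)))"
proof -
  have "(\<Sum>s\<in>{..Suc m} \<rightarrow>\<^sub>E \<Omega>. F s) = (\<Sum>s\<in>(\<lambda>(w, s). s(Suc m := w)) ` (\<Omega> \<times> ({..m} \<rightarrow>\<^sub>E \<Omega>)). F s)"
    by (simp add: atMost_Suc PiE_insert_eq)
  also have "\<dots> = (\<Sum>(w, s)\<in>\<Omega> \<times> ({..m} \<rightarrow>\<^sub>E \<Omega>). F (s(Suc m := w)))"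
    by (subst sum.reindex) (use inj_combinator[of "Suc m" "{..m}" "\<lambda>_. \<Omega>"] in \<open>auto simp: split_beta\<close>)
  also have "\<dots> = (\<Sum>w\<in>\<Omega>. \<Sum>s\<in>{..m} \<rightarrow>\<^sub>E \<Omega>. F (s(Suc m := w)))"
    by (simp add: sum.cartesian_product)
  finally show ?thesis by (subst sum.swap)
qed

lemma sum_paths_0:
  fixes F :: "(nat \<Rightarrow> 'a) \<Rightarrow> real"
  shows "(\<Sum>s\<in>{..0} \<rightarrow>\<^sub>E \<Omega>. F s) = (\<Sum>x\<in>\<Omega>. F ((\<lambda>_. undefined)(0 := x)))"
proof -
  have "(\<Sum>s\<in>{..0} \<rightarrow>\<^sub>E \<Omega>. F s) = (\<Sum>s\<in>(\<lambda>(w, s). s(0 := w)) ` (\<Omega> \<times> ({} \<rightarrow>\<^sub>E \<Omega>)). F s)"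
    using PiE_insert_eq[of "0::nat" "{}" "\<lambda>_. \<Omega>"] by (simp add: atMost_0)
  also have "\<dots> = (\<Sum>(w, s)\<in>\<Omega> \<times> ({} \<rightarrow>\<^sub>E \<Omega>). F (s(0 := w)))"
    by (subst sum.reindex) (use inj_combinator[of "0::nat" "{}" "\<lambda>_. \<Omega>"] in \<open>auto simp: split_beta\<close>)
  also have "\<dots> = (\<Sum>w\<in>\<Omega>. \<Sum>s\<in>{} \<rightarrow>\<^sub>E \<Omega>. F (s(0 := w)))"
    by (rule sum.cartesian_product[symmetric])
  finally show ?thesis by (simp add: fun_upd_def)
qed

lemma open_path_sum:
  "(\<Sum>s\<in>{..m} \<rightarrow>\<^sub>E \<Omega>. (\<Prod>j<m. T (s j) (s (Suc j))) * G (s 0) (s m))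
    = (\<Sum>x\<in>\<Omega>. \<Sum>y\<in>\<Omega>. K m x y * G x y)"
proof (induction m arbitrary: G)
  case 0
  show ?case using fin by (subst sum_paths_0) (simp add: of_bool_def if_distrib if_distribR cong: if_cong)
next
  case (Suc m)
  have "(\<Sum>s\<in>{..Suc m} \<rightarrow>\<^sub>E \<Omega>. (\<Prod>j<Suc m. T (s j) (s (Suc j))) * G (s 0) (s (Suc m)))
     = (\<Sum>s\<in>{..m} \<rightarrow>\<^sub>E \<Omega>. (\<Prod>j<m. T (s j) (s (Suc j))) * (\<Sum>w\<in>\<Omega>. T (s m) w * G (s 0) w))"
    by (subst sum_paths_Suc) (simp add: sum_distrib_left mult_ac)
  also have "\<dots> = (\<Sum>x\<in>\<Omega>. \<Sum>y\<in>\<Omega>. K m x y * (\<Sum>w\<in>\<Omega>. T y w * G x w))"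
    by (rule Suc.IH)
  also have "\<dots> = (\<Sum>x\<in>\<Omega>. \<Sum>y\<in>\<Omega>. \<Sum>w\<in>\<Omega>. K m x y * T y w * G x w)"
    by (simp add: sum_distrib_left mult_ac)
  also have "\<dots> = (\<Sum>x\<in>\<Omega>. \<Sum>w\<in>\<Omega>. \<Sum>y\<in>\<Omega>. K m x y * T y w * G x w)"
    by (intro sum.cong refl sum.swap)
  finally show ?case by (simp add: sum_distrib_right)
qed

text \<open>Summing a product of kernels along a path over all inner vertices is matrix multiplication; the
marked position \<open>t\<close> splits it into two powers.\<close>

lemma open_path_sum_marked:
  assumes "t \<le> m"
  shows "(\<Sum>s\<in>{..m} \<rightarrow>\<^sub>E \<Omega>. (\<Prod>j<m. T (s j) (s (Suc j))) * G (s 0) (s t) (s m))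
    = (\<Sum>x\<in>\<Omega>. \<Sum>y\<in>\<Omega>. \<Sum>z\<in>\<Omega>. K t x y * K (m - t) y z * G x y z)"
  using assms
proof (induction m arbitrary: G rule: dec_induct)
  case base
  have "(\<Sum>z\<in>\<Omega>. K t x y * K 0 y z * G x y z) = K t x y * G x y y" if "y \<in> \<Omega>" for x y
    using that fin by (simp add: of_bool_def if_distrib if_distribR cong: if_cong)
  then show ?case using open_path_sum[of t "\<lambda>x y. G x y y"] by simp
next
  case (step m)
  have "(\<Sum>s\<in>{..Suc m} \<rightarrow>\<^sub>E \<Omega>. (\<Prod>j<Suc m. T (s j) (s (Suc j))) * G (s 0) (s t) (s (Suc m)))
     = (\<Sum>s\<in>{..m} \<rightarrow>\<^sub>E \<Omega>. (\<Prod>j<m. T (s j) (s (Suc j))) * (\<Sum>w\<in>\<Omega>. T (s m) w * G (s 0) (s t) w))"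
    using step(1) by (subst sum_paths_Suc) (simp add: sum_distrib_left mult_ac)
  also have "\<dots> = (\<Sum>x\<in>\<Omega>. \<Sum>y\<in>\<Omega>. \<Sum>z\<in>\<Omega>. K t x y * K (m - t) y z * (\<Sum>w\<in>\<Omega>. T z w * G x y w))"
    by (rule step.IH)
  also have "\<dots> = (\<Sum>x\<in>\<Omega>. \<Sum>y\<in>\<Omega>. \<Sum>z\<in>\<Omega>. \<Sum>w\<in>\<Omega>. K t x y * (K (m - t) y z * T z w) * G x y w)"
    by (simp add: sum_distrib_left mult_ac)
  also have "\<dots> = (\<Sum>x\<in>\<Omega>. \<Sum>y\<in>\<Omega>. \<Sum>w\<in>\<Omega>. \<Sum>z\<in>\<Omega>. K t x y * (K (m - t) y z * T z w) * G x y w)"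
    by (intro sum.cong refl sum.swap)
  also have "\<dots> = (\<Sum>x\<in>\<Omega>. \<Sum>y\<in>\<Omega>. \<Sum>w\<in>\<Omega>. K t x y * K (Suc m - t) y w * G x y w)"
    using step(1) by (simp add: Suc_diff_le sum_distrib_left sum_distrib_right)
  finally show ?case .
qed

definition loops :: "nat \<Rightarrow> (nat \<Rightarrow> 'a) set" where
  "loops n = {..<n} \<rightarrow>\<^sub>E \<Omega>"

definition loop_weight :: "nat \<Rightarrow> (nat \<Rightarrow> 'a) \<Rightarrow> real" where
  "loop_weight n s = (\<Prod>j<n. T (s j) (s (Suc j mod n)))"

lemma loop_two_point:
  assumes "t < n"
  shows "(\<Sum>s\<in>loops n. loop_weight n s * (a (s 0) * a (s t))) = corr n a t"
proof -
  obtain m where m: "n = Suc m" using assms by (cases n) auto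
  have w: "loop_weight n s = (\<Prod>j<m. T (s j) (s (Suc j))) * T (s m) (s 0)" for s
    by (simp add: loop_weight_def m)
  have "(\<Sum>s\<in>loops n. loop_weight n s * (a (s 0) * a (s t)))
     = (\<Sum>s\<in>{..m} \<rightarrow>\<^sub>E \<Omega>. (\<Prod>j<m. T (s j) (s (Suc j))) * (T (s m) (s 0) * (a (s 0) * a (s t))))"
    unfolding w unfolding loops_def m lessThan_Suc_atMost by (simp only: mult.assoc)
  also have "\<dots> = (\<Sum>x\<in>\<Omega>. \<Sum>y\<in>\<Omega>. \<Sum>z\<in>\<Omega>. K t x y * K (m - t) y z * (T z x * (a x * a y)))"
    by (rule open_path_sum_marked) (use assms m in auto)
  also have "\<dots> = corr n a t"
    unfolding corr_def
  proof (intro sum.cong refl)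
    fix x y assume xy: "x \<in> \<Omega>" "y \<in> \<Omega>"
    have "K (n - t) x y = (\<Sum>z\<in>\<Omega>. K (m - t) y z * T z x)"
      using assms m kpow_sym[OF xy, of "n - t"] by (simp add: Suc_diff_le)
    then show "(\<Sum>z\<in>\<Omega>. K t x y * K (m - t) y z * (T z x * (a x * a y))) = a x * a y * (K t x y * K (n - t) x y)"
      by (simp add: sum_distrib_left mult_ac)
  qed
  finally show ?thesis .
qed

definition rotate_loop :: "nat \<Rightarrow> nat \<Rightarrow> (nat \<Rightarrow> 'a) \<Rightarrow> nat \<Rightarrow> 'a" where
  "rotate_loop n i s = (\<lambda>j\<in>{..<n}. s ((i + j) mod n))"

lemma rotate_mem:
  assumes "s \<in> loops n"
  shows "rotate_loop n i s \<in> loops n"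
proof -
  have "s ((i + j) mod n) \<in> \<Omega>" if "j < n" for j
    using PiE_mem[of s "{..<n}" "\<lambda>_. \<Omega>" "(i + j) mod n"] assms that by (simp add: loops_def)
  then show ?thesis by (simp add: rotate_loop_def loops_def restrict_PiE_iff)
qed

lemma rotate_weight:
  assumes "i \<le> n"
  shows "loop_weight n (rotate_loop n i s) = loop_weight n s"
proof (cases "n = 0")
  case True then show ?thesis by (simp add: loop_weight_def)
next
  case False
  have "loop_weight n (rotate_loop n i s) = (\<Prod>j<n. T (s ((i + j) mod n)) (s (Suc ((i + j) mod n) mod n)))"
    unfolding loop_weight_def rotate_loop_def using False
    by (intro prod.cong refl) (simp add: mod_simps)
  also have "\<dots> = loop_weight n s"
    unfolding loop_weight_def by (rule prod_rotate_index[OF assms])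
  finally show ?thesis .
qed

lemma sum_rotate:
  fixes F :: "(nat \<Rightarrow> 'a) \<Rightarrow> real"
  assumes "i \<le> n"
  shows "(\<Sum>s\<in>loops n. F (rotate_loop n i s)) = (\<Sum>s\<in>loops n. F s)"
proof (rule sum.reindex_bij_witness[where i = "rotate_loop n (n - i)" and j = "rotate_loop n i"], goal_cases)
  case (1 s)
  then show ?case using assms mod_rotate(2)[OF assms]
    by (intro extensionalityI[of _ "{..<n}"]) (auto simp: rotate_loop_def loops_def PiE_def add.commute)
next
  case (3 s)
  then show ?case using assms mod_rotate(1)[OF assms]
    by (intro extensionalityI[of _ "{..<n}"]) (auto simp: rotate_loop_def loops_def PiE_def add.commute)
next
  case (2 s)
  show ?case unfolding loops_def
    by (rule rotate_mem[unfolded loops_def]) (use 2 in \<open>simp add: loops_def\<close>)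
next
  case (4 s)
  show ?case unfolding loops_def
    by (rule rotate_mem[unfolded loops_def]) (use 4 in \<open>simp add: loops_def\<close>)
qed simp

text \<open>Closed paths may be rotated, so the correlation of \<open>a\<close> at two places depends on their distance
only.\<close>

lemma loop_Fourier:
  fixes m :: int
  assumes \<theta>: "\<theta> * real n = 2 * pi * of_int m"
  shows "(\<Sum>s\<in>loops n. loop_weight n s * ((\<Sum>j<n. cos (\<theta> * real j) * a (s j))\<^sup>2 + (\<Sum>j<n. sin (\<theta> * real j) * a (s j))\<^sup>2))
    = real n * (\<Sum>t<n. cos (\<theta> * real t) * corr n a t)"
proof -
  have per: "cos (\<theta> * real i - \<theta> * real ((i + t) mod n)) = cos (\<theta> * real t)" for i t
  proof -
    define q where "q = (i + t) div n"
    have "real (i + t) = real ((i + t) mod n) + real n * real q"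
      unfolding q_def of_nat_mult[symmetric] of_nat_add[symmetric] by simp
    then have "\<theta> * real ((i + t) mod n) = \<theta> * (real i + real t) - \<theta> * real n * real q"
      by (simp add: algebra_simps)
    then have "\<theta> * real i - \<theta> * real ((i + t) mod n) = 2 * pi * of_int (m * int q) - \<theta> * real t"
      by (simp add: \<theta> algebra_simps)
    then show ?thesis by (simp only: cos_diff cos_int_2pin sin_int_2pin mult_1 mult_zero_left add_0_right)
  qed
  have sq: "(\<Sum>j<n. cos (\<theta> * real j) * b j)\<^sup>2 + (\<Sum>j<n. sin (\<theta> * real j) * b j)\<^sup>2
     = (\<Sum>i<n. \<Sum>t<n. cos (\<theta> * real t) * (b i * b ((i + t) mod n)))" for b :: "nat \<Rightarrow> real"
  proof -
    have "(\<Sum>j<n. cos (\<theta> * real j) * b j)\<^sup>2 + (\<Sum>j<n. sin (\<theta> * real j) * b j)\<^sup>2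
      = (\<Sum>i<n. \<Sum>j<n. cos (\<theta> * real i - \<theta> * real j) * (b i * b j))"
      unfolding power2_eq_square sum_product sum.distrib[symmetric] cos_diff
      by (intro sum.cong refl) (simp add: algebra_simps)
    also have "\<dots> = (\<Sum>i<n. \<Sum>t<n. cos (\<theta> * real i - \<theta> * real ((i + t) mod n)) * (b i * b ((i + t) mod n)))"
      by (intro sum.cong refl sum_rotate_index[symmetric, where f = "\<lambda>j. cos (\<theta> * real _ - \<theta> * real j) * (b _ * b j)"]) auto
    finally show ?thesis unfolding per .
  qed
  have st: "(\<Sum>s\<in>loops n. loop_weight n s * (a (s i) * a (s ((i + t) mod n)))) = corr n a t"
    if "i < n" "t < n" for i t
  proof -
    have "(\<Sum>s\<in>loops n. loop_weight n s * (a (s i) * a (s ((i + t) mod n))))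
      = (\<Sum>s\<in>loops n. loop_weight n (rotate_loop n i s) * (a (rotate_loop n i s 0) * a (rotate_loop n i s t)))"
      using that by (simp add: rotate_weight) (simp add: rotate_loop_def)
    also have "\<dots> = corr n a t"
      by (subst sum_rotate) (use that loop_two_point in auto)
    finally show ?thesis .
  qed
  have "(\<Sum>s\<in>loops n. loop_weight n s * ((\<Sum>j<n. cos (\<theta> * real j) * a (s j))\<^sup>2 + (\<Sum>j<n. sin (\<theta> * real j) * a (s j))\<^sup>2))
    = (\<Sum>s\<in>loops n. \<Sum>i<n. \<Sum>t<n. cos (\<theta> * real t) * (loop_weight n s * (a (s i) * a (s ((i + t) mod n)))))"
    unfolding sq by (simp add: sum_distrib_left mult_ac)
  also have "\<dots> = (\<Sum>i<n. \<Sum>s\<in>loops n. \<Sum>t<n. cos (\<theta> * real t) * (loop_weight n s * (a (s i) * a (s ((i + t) mod n)))))"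
    by (rule sum.swap)
  also have "\<dots> = (\<Sum>i<n. \<Sum>t<n. \<Sum>s\<in>loops n. cos (\<theta> * real t) * (loop_weight n s * (a (s i) * a (s ((i + t) mod n)))))"
    by (intro sum.cong refl sum.swap)
  also have "\<dots> = (\<Sum>i<n. \<Sum>t<n. cos (\<theta> * real t) * corr n a t)"
    unfolding sum_distrib_left[symmetric] by (intro sum.cong refl) (simp add: st)
  finally show ?thesis by simp
qed

text \<open>Up to normalisation, the right-hand side is the mean square change of \<open>a\<close> along one step of a closed
path.\<close>

lemma corr_increment:
  assumes "0 < n"
  shows "2 * (corr n a 0 - corr n a 1) = (\<Sum>x\<in>\<Omega>. \<Sum>y\<in>\<Omega>. (a x - a y)\<^sup>2 * (T x y * K (n - 1) x y))"
proof -
  obtain m where m: "n = Suc m" using assms by (cases n) auto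
  define L where "L x y = T x y * K m x y" for x y
  have Ls: "L x y = L y x" if "x \<in> \<Omega>" "y \<in> \<Omega>" for x y using that by (simp add: L_def kpow_sym T_sym)
  have "corr n a 0 = (\<Sum>x\<in>\<Omega>. \<Sum>y\<in>\<Omega>. if y = x then a x * a x * K n x x else 0)"
    unfolding corr_def by (intro sum.cong refl) auto
  also have "\<dots> = (\<Sum>x\<in>\<Omega>. a x * a x * K n x x)" using fin by simp
  also have "\<dots> = (\<Sum>x\<in>\<Omega>. \<Sum>y\<in>\<Omega>. a x * a x * L x y)"
    unfolding m L_def by (intro sum.cong refl) (simp add: kpow_Suc_left kpow_sym sum_distrib_left del: kpow.simps)
  finally have diag: "corr n a 0 = (\<Sum>x\<in>\<Omega>. \<Sum>y\<in>\<Omega>. a x * a x * L x y)" .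
  have diag': "corr n a 0 = (\<Sum>x\<in>\<Omega>. \<Sum>y\<in>\<Omega>. a y * a y * L x y)"
    unfolding diag by (subst sum.swap) (intro sum.cong refl, simp add: Ls)
  have corr1: "corr n a 1 = (\<Sum>x\<in>\<Omega>. \<Sum>y\<in>\<Omega>. a x * a y * L x y)"
    unfolding corr_def m L_def One_nat_def by (intro sum.cong refl) (simp add: kpow_1 del: kpow.simps)
  have "(\<Sum>x\<in>\<Omega>. \<Sum>y\<in>\<Omega>. (a x - a y)\<^sup>2 * L x y)
     = (\<Sum>x\<in>\<Omega>. \<Sum>y\<in>\<Omega>. a x * a x * L x y) + (\<Sum>x\<in>\<Omega>. \<Sum>y\<in>\<Omega>. a y * a y * L x y)
       - 2 * (\<Sum>x\<in>\<Omega>. \<Sum>y\<in>\<Omega>. a x * a y * L x y)"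
    unfolding sum_distrib_left sum.distrib[symmetric] sum_subtractf[symmetric]
    by (intro sum.cong refl) (simp add: power2_eq_square algebra_simps)
  then show ?thesis unfolding diag[symmetric] diag'[symmetric] corr1[symmetric] by (simp add: L_def m)
qed

lemma loop_partition:
  assumes "0 < n"
  shows "(\<Sum>s\<in>loops n. loop_weight n s) = (\<Sum>x\<in>\<Omega>. \<Sum>y\<in>\<Omega>. T x y * K (n - 1) x y)"
proof -
  obtain m where m: "n = Suc m" using assms by (cases n) auto
  have "(\<Sum>s\<in>loops n. loop_weight n s) = corr n (\<lambda>_. 1) 0"
    using loop_two_point[OF assms, of "\<lambda>_. 1"] by simp
  also have "\<dots> = (\<Sum>x\<in>\<Omega>. \<Sum>y\<in>\<Omega>. if y = x then K n x x else 0)"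
    unfolding corr_def by (intro sum.cong refl) auto
  also have "\<dots> = (\<Sum>x\<in>\<Omega>. K n x x)" using fin by simp
  also have "\<dots> = (\<Sum>x\<in>\<Omega>. \<Sum>y\<in>\<Omega>. T x y * K (n - 1) x y)"
    unfolding m by (intro sum.cong refl) (simp add: kpow_Suc_left kpow_sym del: kpow.simps)
  finally show ?thesis .
qed

end

text \<open>By \<open>convex_Fourier_bound\<close> and \<open>corr_increment\<close> it remains to bound the mean square change of the
observables in one step. The rest of the loop enters through the kernel \<open>Q\<close>, which is positive
semidefinite, so that \<open>2 * Q x y \<le> Q x x + Q y y\<close>. This leaves the change under the free kernel \<open>P\<close>,
which is at most \<open>M\<close>, times the trace of \<open>Q\<close>; and the partition sum is at least \<open>p0\<close> times this trace,
already from the loops that stand still during this step.\<close>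

theorem temporal_bound:
  fixes P :: "'a \<Rightarrow> 'a \<Rightarrow> real" and r a b :: "'a \<Rightarrow> real" and m :: int
  defines "T \<equiv> \<lambda>x y. r x * P x y * r y"
  assumes fin: "finite \<Omega>" and P_sym: "\<And>x y. P x y = P y x" and P_gram: "gram \<Omega> P"
    and P_nonneg: "\<And>x y. x \<in> \<Omega> \<Longrightarrow> y \<in> \<Omega> \<Longrightarrow> 0 \<le> P x y" and r_nonneg: "\<And>x. 0 \<le> r x"
    and n: "2 \<le> n" and \<theta>: "\<theta> * real n = 2 * pi * of_int m"
    and p0: "\<And>x. x \<in> \<Omega> \<Longrightarrow> p0 \<le> P x x" "0 < p0"
    and M: "\<And>x. x \<in> \<Omega> \<Longrightarrow> (\<Sum>y\<in>\<Omega>. ((a x - a y)\<^sup>2 + (b x - b y)\<^sup>2) * P x y) \<le> M" "0 \<le> M"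
  shows "p0 * (2 - 2 * cos \<theta>) * (\<Sum>s\<in>{..<n} \<rightarrow>\<^sub>E \<Omega>. (\<Prod>j<n. T (s j) (s (Suc j mod n))) *
       ((\<Sum>j<n. cos (\<theta> * real j) * a (s j))\<^sup>2 + (\<Sum>j<n. sin (\<theta> * real j) * a (s j))\<^sup>2
        + (\<Sum>j<n. cos (\<theta> * real j) * b (s j))\<^sup>2 + (\<Sum>j<n. sin (\<theta> * real j) * b (s j))\<^sup>2))
    \<le> 2 * real n * M * (\<Sum>s\<in>{..<n} \<rightarrow>\<^sub>E \<Omega>. \<Prod>j<n. T (s j) (s (Suc j mod n)))"
proof -
  interpret sym_kernel \<Omega> T
  proof
    show "T x y = T y x" for x y by (simp add: T_def P_sym[of x y])
    obtain Y where "\<forall>x\<in>\<Omega>. \<forall>y\<in>\<Omega>. P x y = (\<Sum>v\<in>\<Omega>. Y v x * Y v y)"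
      using P_gram unfolding gram_def ..
    then show "gram \<Omega> T" unfolding gram_def T_def
      by (intro exI[of _ "\<lambda>v x. Y v x * r x"] ballI) (simp add: sum_distrib_left sum_distrib_right mult_ac)
  qed (rule fin)
  define Q where "Q x y = r x * K (n - 1) x y * r y" for x y
  define B where "B x y = (a x - a y)\<^sup>2 + (b x - b y)\<^sup>2" for x y
  define Z where "Z = (\<Sum>s\<in>loops n. loop_weight n s)"
  define R where "R = (\<Sum>x\<in>\<Omega>. Q x x)"
  have B0: "0 \<le> B x y" and Bs: "B x y = B y x" for x y
    by (simp_all add: B_def power2_commute)
  have K_nonneg: "0 \<le> K k x y" if "x \<in> \<Omega>" "y \<in> \<Omega>" for k x y
    using that(2)
  proof (induction k arbitrary: y)
    case (Suc k)
    then show ?case using that(1) by (auto intro!: sum_nonneg mult_nonneg_nonneg simp: T_def P_nonneg r_nonneg)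
  qed simp
  have Q0: "0 \<le> Q x y" if "x \<in> \<Omega>" "y \<in> \<Omega>" for x y using that by (simp add: Q_def K_nonneg r_nonneg)
  have TK: "T x y * K (n - 1) x y = P x y * Q x y" for x y by (simp add: T_def Q_def)
  have diag: "2 * Q x y \<le> Q x x + Q y y" if "x \<in> \<Omega>" "y \<in> \<Omega>" for x y
    unfolding Q_def by (rule gram_diag_bound[OF gram_kpow that])
  have "2 * (\<Sum>x\<in>\<Omega>. \<Sum>y\<in>\<Omega>. B x y * (T x y * K (n - 1) x y))
      = (\<Sum>x\<in>\<Omega>. \<Sum>y\<in>\<Omega>. B x y * P x y * (2 * Q x y))"
    unfolding TK by (simp add: sum_distrib_left mult_ac)
  also have "\<dots> \<le> (\<Sum>x\<in>\<Omega>. \<Sum>y\<in>\<Omega>. B x y * P x y * (Q x x + Q y y))"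
    by (intro sum_mono mult_left_mono diag mult_nonneg_nonneg B0 P_nonneg)
  also have "\<dots> = (\<Sum>x\<in>\<Omega>. \<Sum>y\<in>\<Omega>. B x y * P x y * Q x x) + (\<Sum>x\<in>\<Omega>. \<Sum>y\<in>\<Omega>. B x y * P x y * Q y y)"
    by (simp add: distrib_left sum.distrib)
  also have "(\<Sum>x\<in>\<Omega>. \<Sum>y\<in>\<Omega>. B x y * P x y * Q y y) = (\<Sum>x\<in>\<Omega>. \<Sum>y\<in>\<Omega>. B x y * P x y * Q x x)"
  proof (subst sum.swap, intro sum.cong refl)
    fix x y show "B y x * P y x * Q x x = B x y * P x y * Q x x" by (simp only: Bs[of y x] P_sym[of y x])
  qed
  also have "(\<Sum>x\<in>\<Omega>. \<Sum>y\<in>\<Omega>. B x y * P x y * Q x x) = (\<Sum>x\<in>\<Omega>. (\<Sum>y\<in>\<Omega>. B x y * P x y) * Q x x)"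
    by (simp add: sum_distrib_right)
  also have "\<dots> \<le> (\<Sum>x\<in>\<Omega>. M * Q x x)"
    using M(1) by (intro sum_mono mult_right_mono) (auto simp: B_def Q0)
  also have "\<dots> = M * R" by (simp add: R_def sum_distrib_left)
  finally have incr: "(\<Sum>x\<in>\<Omega>. \<Sum>y\<in>\<Omega>. B x y * (T x y * K (n - 1) x y)) \<le> M * R"
    by simp
  have "p0 * R = (\<Sum>x\<in>\<Omega>. p0 * Q x x)" by (simp add: R_def sum_distrib_left)
  also have "\<dots> \<le> (\<Sum>x\<in>\<Omega>. P x x * Q x x)" using p0 Q0 by (intro sum_mono mult_right_mono) auto
  also have "\<dots> \<le> (\<Sum>x\<in>\<Omega>. \<Sum>y\<in>\<Omega>. P x y * Q x y)"
    by (rule sum_mono, rule member_le_sum) (use fin P_nonneg Q0 in auto)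
  also have "\<dots> = Z" 
    using loop_partition[of n] n unfolding Z_def TK by simp
  finally have pR: "p0 * R \<le> Z" .
  have one: "(2 - 2 * cos \<theta>) * (\<Sum>s\<in>loops n. loop_weight n s * ((\<Sum>j<n. cos (\<theta> * real j) * f (s j))\<^sup>2 + (\<Sum>j<n. sin (\<theta> * real j) * f (s j))\<^sup>2))
     \<le> 2 * real n * (\<Sum>x\<in>\<Omega>. \<Sum>y\<in>\<Omega>. (f x - f y)\<^sup>2 * (T x y * K (n - 1) x y))" for f
  proof -
    have "(2 - 2 * cos \<theta>) * (\<Sum>t<n. cos (\<theta> * real t) * corr n f t) \<le> 4 * (corr n f 0 - corr n f 1)"
      by (rule convex_Fourier_bound[OF n _ _ \<theta>]) (use corr_convex corr_reflect in auto)
    also have "\<dots> = 2 * (\<Sum>x\<in>\<Omega>. \<Sum>y\<in>\<Omega>. (f x - f y)\<^sup>2 * (T x y * K (n - 1) x y))"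
      using corr_increment[of n f] n by simp
    finally have "real n * ((2 - 2 * cos \<theta>) * (\<Sum>t<n. cos (\<theta> * real t) * corr n f t))
      \<le> real n * (2 * (\<Sum>x\<in>\<Omega>. \<Sum>y\<in>\<Omega>. (f x - f y)\<^sup>2 * (T x y * K (n - 1) x y)))"
      by (rule mult_left_mono) simp
    then show ?thesis unfolding loop_Fourier[OF \<theta>] by (simp only: mult_ac)
  qed
  have "(2 - 2 * cos \<theta>) * (\<Sum>s\<in>loops n. loop_weight n s *
       ((\<Sum>j<n. cos (\<theta> * real j) * a (s j))\<^sup>2 + (\<Sum>j<n. sin (\<theta> * real j) * a (s j))\<^sup>2
        + (\<Sum>j<n. cos (\<theta> * real j) * b (s j))\<^sup>2 + (\<Sum>j<n. sin (\<theta> * real j) * b (s j))\<^sup>2))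
    = (2 - 2 * cos \<theta>) * (\<Sum>s\<in>loops n. loop_weight n s * ((\<Sum>j<n. cos (\<theta> * real j) * a (s j))\<^sup>2 + (\<Sum>j<n. sin (\<theta> * real j) * a (s j))\<^sup>2))
    + (2 - 2 * cos \<theta>) * (\<Sum>s\<in>loops n. loop_weight n s * ((\<Sum>j<n. cos (\<theta> * real j) * b (s j))\<^sup>2 + (\<Sum>j<n. sin (\<theta> * real j) * b (s j))\<^sup>2))"
    (is "?L = _")
    unfolding distrib_left[symmetric] sum.distrib[symmetric] by (simp only: add.assoc)
  also have "\<dots> \<le> 2 * real n * (\<Sum>x\<in>\<Omega>. \<Sum>y\<in>\<Omega>. (a x - a y)\<^sup>2 * (T x y * K (n - 1) x y))
     + 2 * real n * (\<Sum>x\<in>\<Omega>. \<Sum>y\<in>\<Omega>. (b x - b y)\<^sup>2 * (T x y * K (n - 1) x y))"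
    by (intro add_mono one)
  also have "\<dots> = 2 * real n * (\<Sum>x\<in>\<Omega>. \<Sum>y\<in>\<Omega>. B x y * (T x y * K (n - 1) x y))"
    unfolding distrib_left[symmetric] sum.distrib[symmetric] by (simp only: B_def distrib_right)
  also have "\<dots> \<le> 2 * real n * (M * R)" by (intro mult_left_mono incr) simp
  finally have "p0 * ?L \<le> p0 * (2 * real n * (M * R))" using p0(2) by (intro mult_left_mono) auto
  also have "\<dots> = 2 * real n * M * (p0 * R)" by simp
  also have "\<dots> \<le> 2 * real n * M * Z" using pR M(2) by (intro mult_left_mono) auto
  finally show ?thesis unfolding Z_def loops_def loop_weight_def by (simp only: mult.assoc)
qed

section \<open>The torus\<close>

definition step :: "nat \<Rightarrow> nat \<Rightarrow> vertex \<Rightarrow> vertex" where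
  "step N i x = x(i := Suc (x i) mod (2 * N))"

text \<open>For \<open>N = 1\<close> the two steps along an axis coincide and both indicators are 1, which doubles the edge.\<close>

definition bond :: "nat \<Rightarrow> nat \<Rightarrow> vertex \<Rightarrow> vertex \<Rightarrow> nat" where
  "bond d N x y = (\<Sum>i=1..d. of_bool (y = step N i x) + of_bool (x = step N i y))"

lemma finite_torus: "finite (torus d N)"
  by (simp add: torus_def finite_PiE)

lemma torus_less: "x \<in> torus d N \<Longrightarrow> i \<in> {1..d} \<Longrightarrow> x i < 2 * N"
  unfolding torus_def using PiE_mem[of x "{1..d}" "\<lambda>_. {0..<2 * N}" i] by simp

lemma torus_update: "x \<in> torus d N \<Longrightarrow> i \<in> {1..d} \<Longrightarrow> c < 2 * N \<Longrightarrow> x(i := c) \<in> torus d N"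
  unfolding torus_def by (auto simp: PiE_def Pi_def extensional_def)

lemma step_torus: "N \<ge> 1 \<Longrightarrow> x \<in> torus d N \<Longrightarrow> i \<in> {1..d} \<Longrightarrow> step N i x \<in> torus d N"
  unfolding step_def by (rule torus_update) auto

lemma torus_eqI:
  "x \<in> torus d N \<Longrightarrow> y \<in> torus d N \<Longrightarrow> (\<And>i. i \<in> {1..d} \<Longrightarrow> x i = y i) \<Longrightarrow> x = y"
  unfolding torus_def by (rule PiE_ext)

lemma bond_sym: "bond d N x y = bond d N y x"
  by (simp add: bond_def add.commute)

lemma bond_pos_step:
  assumes "0 < bond d N x y"
  shows "\<exists>j\<in>{1..d}. y = step N j x \<or> x = step N j y"
proof (rule ccontr)
  assume "\<not> ?thesis"
  then have "bond d N x y = 0" by (simp add: bond_def)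
  then show False using assms by simp
qed

lemma eq_step_iff:
  assumes "x \<in> torus d N" "y \<in> torus d N" "i \<in> {1..d}"
  shows "y = step N i x \<longleftrightarrow> y i = Suc (x i) mod (2 * N) \<and> (\<forall>j\<in>{1..d}. j \<noteq> i \<longrightarrow> y j = x j)"
proof
  assume R: "y i = Suc (x i) mod (2 * N) \<and> (\<forall>j\<in>{1..d}. j \<noteq> i \<longrightarrow> y j = x j)"
  have "N \<ge> 1" using torus_less[OF assms(1,3)] by simp
  show "y = step N i x"
    by (rule torus_eqI[OF assms(2) step_torus[OF \<open>N \<ge> 1\<close> assms(1,3)]]) (use R in \<open>auto simp: step_def\<close>)
qed (auto simp: step_def)

lemma Suc_mod_neq: "a < 2 * N \<Longrightarrow> Suc a mod (2 * N) \<noteq> a"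
  by (auto simp: mod_Suc) presburger

lemma step_dir:
  assumes x: "x \<in> torus d N" "y \<in> torus d N" and i: "i \<in> {1..d}" "j \<in> {1..d}"
    and "y = step N i x \<or> x = step N i y" "y = step N j x \<or> x = step N j y"
  shows "i = j"
proof (rule ccontr)
  assume "i \<noteq> j"
  have "y i \<noteq> x i"
    using assms(5) Suc_mod_neq[OF torus_less[OF x(1) i(1)]] Suc_mod_neq[OF torus_less[OF x(2) i(1)]]
    unfolding eq_step_iff[OF x i(1)] eq_step_iff[OF x(2,1) i(1)] by metis
  moreover have "y i = x i"
    using assms(6) \<open>i \<noteq> j\<close> i unfolding eq_step_iff[OF x i(2)] eq_step_iff[OF x(2,1) i(2)] by metis
  ultimately show False by simp
qed

lemma adjacent_iff:
  assumes x: "x \<in> torus d N" "y \<in> torus d N"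
  shows "adjacent d N x y \<longleftrightarrow> (\<exists>i\<in>{1..d}. y = step N i x \<or> x = step N i y)"
proof -
  have *: "[b = a + 1] (mod 2 * N) \<longleftrightarrow> b = Suc a mod (2 * N)" if "a < 2 * N" "b < 2 * N" for a b
    using that by (simp add: cong_def)
  show ?thesis
    unfolding adjacent_def
  proof (rule bex_cong[OF refl])
    fix i assume i: "i \<in> {1..d}"
    show "(([y i = x i + 1] (mod 2 * N) \<or> [x i = y i + 1] (mod 2 * N)) \<and>
                 (\<forall>j\<in>{1..d}. j \<noteq> i \<longrightarrow> x j = y j)) \<longleftrightarrow> (y = step N i x \<or> x = step N i y)"
      unfolding eq_step_iff[OF x i] eq_step_iff[OF x(2,1) i]
        *[OF torus_less[OF x(1) i] torus_less[OF x(2) i]] *[OF torus_less[OF x(2) i] torus_less[OF x(1) i]]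
      by metis
  qed
qed

lemma bond_eq:
  assumes x: "x \<in> torus d N" "y \<in> torus d N" and N: "N \<ge> 1"
  shows "bond d N x y = (if adjacent d N x y then edge_mult N else 0)"
proof (cases "adjacent d N x y")
  case True
  then obtain i where i: "i \<in> {1..d}" and st: "y = step N i x \<or> x = step N i y"
    using adjacent_iff[OF x] by blast
  have "bond d N x y = (\<Sum>j=1..d. if j = i then of_bool (y = step N i x) + of_bool (x = step N i y) else 0)"
    unfolding bond_def
  proof (rule sum.cong[OF refl])
    fix j assume j: "j \<in> {1..d}"
    show "(of_bool (y = step N j x) + of_bool (x = step N j y) :: nat)
      = (if j = i then of_bool (y = step N i x) + of_bool (x = step N i y) else 0)"
    proof (cases "j = i")
      case False
      then have "\<not> (y = step N j x \<or> x = step N j y)" using step_dir[OF x i j st] by metis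
      then show ?thesis using False by simp
    qed simp
  qed
  also have "\<dots> = of_bool (y = step N i x) + of_bool (x = step N i y)" using i by simp
  also have "\<dots> = edge_mult N"
  proof -
    have e: "y = step N i x \<and> x = step N i y \<longleftrightarrow> N = 1"
    proof
      assume "y = step N i x \<and> x = step N i y"
      then have "x i = Suc (Suc (x i) mod (2 * N)) mod (2 * N)" by (metis fun_upd_same step_def)
      then show "N = 1" using torus_less[OF x(1) i] N by (auto simp: mod_Suc split: if_splits)
    next
      assume N1: "N = 1"
      have "x i < 2" "y i < 2" using torus_less[OF x(1) i] torus_less[OF x(2) i] N1 by simp_all
      then have "y i = Suc (x i) mod 2 \<longleftrightarrow> x i = Suc (y i) mod 2"
        by (auto simp: mod_Suc less_2_cases_iff)
      then have "y i = Suc (x i) mod (2 * N) \<longleftrightarrow> x i = Suc (y i) mod (2 * N)" using N1 by simp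
      then show "y = step N i x \<and> x = step N i y"
        using st unfolding eq_step_iff[OF x i] eq_step_iff[OF x(2,1) i] by metis
    qed
    have "(of_bool p + of_bool q :: nat) = edge_mult N" if "p \<and> q \<longleftrightarrow> N = 1" "p \<or> q" for p q
      using that by (cases p; cases q) (simp_all add: edge_mult_def)
    from this[OF e st] show ?thesis .
  qed
  finally show ?thesis using True by simp
next
  case False
  then have "\<forall>i\<in>{1..d}. y \<noteq> step N i x \<and> x \<noteq> step N i y" using adjacent_iff[OF x] by blast
  then show ?thesis using False by (simp add: bond_def)
qed

lemma adjacent_neq: "x \<in> torus d N \<Longrightarrow> y \<in> torus d N \<Longrightarrow> adjacent d N x y \<Longrightarrow> x \<noteq> y"
  using adjacent_iff[of x d N y] Suc_mod_neq torus_less eq_step_iff by metis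

lemma adjacent_sym: "adjacent d N x y \<longleftrightarrow> adjacent d N y x"
  unfolding adjacent_def by (metis)

lemma sum_edges:
  fixes g :: "vertex set \<Rightarrow> real"
  assumes N: "N \<ge> 1"
  shows "(\<Sum>x\<in>torus d N. \<Sum>y\<in>torus d N. real (bond d N x y) * g {x, y})
    = 2 * (\<Sum>e\<in>edges d N. real (edge_mult N) * g e)"
proof -
  let ?V = "torus d N"
  define A where "A = {(x, y). x \<in> ?V \<and> y \<in> ?V \<and> adjacent d N x y}"
  have AV: "A \<subseteq> ?V \<times> ?V" by (auto simp: A_def)
  have finA: "finite A" by (rule finite_subset[OF AV]) (simp add: finite_torus)
  have img: "(\<lambda>(x, y). {x, y}) ` A = edges d N" by (auto simp: A_def edges_def image_iff)
  have fib: "card {p \<in> A. (\<lambda>(x, y). {x, y}) p = e} = 2" if e: "e \<in> edges d N" for e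
  proof -
    obtain x y where xy: "e = {x, y}" "(x, y) \<in> A"
      using e unfolding edges_def A_def by blast
    have ne: "x \<noteq> y" and yx: "(y, x) \<in> A" using xy(2) adjacent_neq adjacent_sym by (auto simp: A_def)
    have "{p \<in> A. (\<lambda>(x, y). {x, y}) p = e} = {(x, y), (y, x)}"
      using xy yx by (auto simp: doubleton_eq_iff)
    then show ?thesis using ne by simp
  qed
  have "(\<Sum>x\<in>?V. \<Sum>y\<in>?V. real (bond d N x y) * g {x, y})
     = (\<Sum>p\<in>?V \<times> ?V. real (bond d N (fst p) (snd p)) * g {fst p, snd p})"
    by (simp add: sum.cartesian_product split_beta)
  also have "\<dots> = (\<Sum>p\<in>A. real (edge_mult N) * g {fst p, snd p})"
    by (rule sum.mono_neutral_cong_right) (use AV in \<open>auto simp: finite_torus A_def bond_eq[OF _ _ N] split: if_splits\<close>)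
  also have "\<dots> = (\<Sum>e\<in>edges d N. \<Sum>p\<in>{p \<in> A. (\<lambda>(x, y). {x, y}) p = e}. real (edge_mult N) * g {fst p, snd p})"
    unfolding img[symmetric] by (rule sum.image_gen[OF finA])
  also have "\<dots> = (\<Sum>e\<in>edges d N. \<Sum>p\<in>{p \<in> A. (\<lambda>(x, y). {x, y}) p = e}. real (edge_mult N) * g e)"
    by (intro sum.cong refl) (auto simp: split_beta)
  also have "\<dots> = (\<Sum>e\<in>edges d N. 2 * (real (edge_mult N) * g e))"
    by (intro sum.cong refl) (simp add: fib)
  finally show ?thesis by (simp add: sum_distrib_left)
qed

text \<open>Adding \<open>2 * N - 1\<close> is subtracting 1 modulo \<open>2 * N\<close>.\<close>

definition step_back :: "nat \<Rightarrow> nat \<Rightarrow> vertex \<Rightarrow> vertex" where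
  "step_back N i x = x(i := (x i + (2 * N - 1)) mod (2 * N))"

lemma sum_bond:
  fixes \<psi> :: "vertex \<Rightarrow> real"
  assumes N: "N \<ge> 1" and x: "x \<in> torus d N"
  shows "(\<Sum>y\<in>torus d N. real (bond d N x y) * \<psi> y) = (\<Sum>i=1..d. \<psi> (step N i x) + \<psi> (step_back N i x))"
proof -
  have eq_back: "x = step N i y \<longleftrightarrow> y = step_back N i x" if "i \<in> {1..d}" "y \<in> torus d N" for i y
  proof -
    have lt: "x i < 2 * N" "y i < 2 * N" using torus_less that x by blast+
    have *: "a = Suc b mod (2 * N) \<longleftrightarrow> b = (a + (2 * N - 1)) mod (2 * N)" if "a < 2 * N" "b < 2 * N" for a b
      using that N by (cases "a = 0") (auto simp: mod_Suc mod_if)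
    have "y = step_back N i x \<longleftrightarrow> y i = (x i + (2 * N - 1)) mod (2 * N) \<and> (\<forall>j\<in>{1..d}. j \<noteq> i \<longrightarrow> y j = x j)"
    proof
      assume R: "y i = (x i + (2 * N - 1)) mod (2 * N) \<and> (\<forall>j\<in>{1..d}. j \<noteq> i \<longrightarrow> y j = x j)"
      have "step_back N i x \<in> torus d N" unfolding step_back_def by (rule torus_update[OF x that(1)]) (use N in auto)
      from torus_eqI[OF that(2) this] show "y = step_back N i x" using R by (auto simp: step_back_def)
    qed (auto simp: step_back_def)
    then show ?thesis unfolding eq_step_iff[OF that(2) x that(1)] *[OF lt] by metis
  qed
  have bt: "step_back N i x \<in> torus d N" if "i \<in> {1..d}" for i
    unfolding step_back_def by (rule torus_update[OF x that]) (use N in auto)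
  have "(\<Sum>y\<in>torus d N. real (bond d N x y) * \<psi> y)
      = (\<Sum>y\<in>torus d N. \<Sum>i=1..d. (if y = step N i x then \<psi> y else 0) + (if y = step_back N i x then \<psi> y else 0))"
    unfolding bond_def of_nat_sum sum_distrib_right
    by (intro sum.cong refl) (auto simp: eq_back)
  also have "\<dots> = (\<Sum>i=1..d. \<Sum>y\<in>torus d N. (if y = step N i x then \<psi> y else 0) + (if y = step_back N i x then \<psi> y else 0))"
    by (rule sum.swap)
  also have "\<dots> = (\<Sum>i=1..d. \<psi> (step N i x) + \<psi> (step_back N i x))"
    by (intro sum.cong refl) (simp add: sum.distrib finite_torus step_torus[OF N x] bt)
  finally show ?thesis .
qed

definition phase :: "nat \<Rightarrow> (nat \<Rightarrow> real) \<Rightarrow> vertex \<Rightarrow> real" where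
  "phase d k x = (\<Sum>j=1..d. k j * real (x j))"

lemma phase_update:
  assumes i: "i \<in> {1..d}"
  shows "phase d k (x(i := c)) = phase d k x + k i * (real c - real (x i))"
proof -
  have "phase d k y = k i * real (y i) + (\<Sum>j\<in>{1..d} - {i}. k j * real (y j))" for y
    unfolding phase_def using i by (simp add: sum.remove)
  then show ?thesis by (simp add: algebra_simps)
qed

lemma wave_number_mod:
  assumes "k i = 2 * pi / (2 * real N) * of_int m" "N \<ge> 1"
  shows "\<exists>q::int. k i * real (a mod (2 * N)) = k i * real a + 2 * pi * of_int q"
proof -
  have "real a = real (a mod (2 * N)) + 2 * real N * real (a div (2 * N))"
    by (metis (no_types, opaque_lifting) mod_mult_div_eq mult.commute of_nat_add of_nat_mult of_nat_numeral)
  then have "k i * real (a mod (2 * N)) = k i * real a + 2 * pi * of_int (- m * int (a div (2 * N)))"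
    using assms by (simp add: field_simps)
  then show ?thesis by blast
qed

lemma cos_add_2pi_int: "cos (x + 2 * pi * of_int q) = cos x" for q :: int
  by (simp only: cos_add cos_int_2pin sin_int_2pin mult_1_right mult_zero_right diff_0_right)

text \<open>Plane waves are eigenvectors, since \<open>cos (a + b) + cos (a - b) = 2 * cos a * cos b\<close>; the wave numbers
are those for which they are well defined on the torus.\<close>

lemma discrete_Laplacian_wave:
  assumes N: "N \<ge> 1" and x: "x \<in> torus d N"
    and k: "\<forall>j\<in>{1..d}. \<exists>m::int. k j = 2 * pi / (2 * real N) * of_int m"
  shows "(\<Sum>y\<in>torus d N. real (bond d N x y) * (cos (phase d k x + c) - cos (phase d k y + c)))
    = 2 * L_hat d k * cos (phase d k x + c)"
proof -
  have *: "cos (phase d k (step N i x) + c) = cos (phase d k x + c + k i)"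
      "cos (phase d k (step_back N i x) + c) = cos (phase d k x + c - k i)" if i: "i \<in> {1..d}" for i
  proof -
    obtain m :: int where m: "k i = 2 * pi / (2 * real N) * of_int m" using k i by blast
    obtain q :: int where q: "k i * real (Suc (x i) mod (2 * N)) = k i * real (Suc (x i)) + 2 * pi * of_int q"
      using wave_number_mod[of k i N m, OF m N] by blast
    have "phase d k (step N i x) + c = (phase d k x + c + k i) + 2 * pi * of_int q"
      unfolding step_def phase_update[OF i] right_diff_distrib q by (simp add: algebra_simps)
    then show "cos (phase d k (step N i x) + c) = cos (phase d k x + c + k i)"
      by (simp only: cos_add_2pi_int)
    obtain q :: int where q: "k i * real ((x i + (2 * N - 1)) mod (2 * N)) = k i * real (x i + (2 * N - 1)) + 2 * pi * of_int q"
      using wave_number_mod[of k i N m, OF m N] by blast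
    have "k i * (2 * real N) = 2 * pi * of_int m" using m N by simp
    then have "phase d k (step_back N i x) + c = (phase d k x + c - k i) + 2 * pi * of_int (q + m)"
      unfolding step_back_def phase_update[OF i] right_diff_distrib q using N by (simp add: algebra_simps of_nat_diff)
    then show "cos (phase d k (step_back N i x) + c) = cos (phase d k x + c - k i)"
      by (simp only: cos_add_2pi_int)
  qed
  have "(\<Sum>y\<in>torus d N. real (bond d N x y) * (cos (phase d k x + c) - cos (phase d k y + c)))
    = (\<Sum>i=1..d. 2 * cos (phase d k x + c) - (cos (phase d k x + c + k i) + cos (phase d k x + c - k i)))"
    unfolding sum_bond[OF N x, of "\<lambda>y. cos (phase d k x + c) - cos (phase d k y + c)"]
    by (intro sum.cong refl) (simp add: *)
  also have "\<dots> = (\<Sum>i=1..d. 2 * cos (phase d k x + c) * (1 - cos (k i)))"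
  proof (intro sum.cong refl)
    have "cos (a + b) + cos (a - b) = 2 * cos a * cos b" for a b :: real by (simp add: cos_add cos_diff)
    then show "2 * cos (phase d k x + c) - (cos (phase d k x + c + k i) + cos (phase d k x + c - k i))
      = 2 * cos (phase d k x + c) * (1 - cos (k i))" for i by (simp only:) (simp add: algebra_simps)
  qed
  finally show ?thesis by (simp only: L_hat_def sum_distrib_left sum_distrib_right mult_ac)
qed

subsection \<open>Translations\<close>

definition translate :: "nat \<Rightarrow> nat \<Rightarrow> vertex \<Rightarrow> vertex \<Rightarrow> vertex" where
  "translate d N a x = (\<lambda>i\<in>{1..d}. (x i + a i) mod (2 * N))"

lemma translate_torus: "N \<ge> 1 \<Longrightarrow> translate d N a x \<in> torus d N"
  by (auto simp: translate_def torus_def)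

lemma translate_inj:
  assumes a: "x \<in> torus d N" "y \<in> torus d N" and e: "translate d N a x = translate d N a y"
  shows "x = y"
proof (rule torus_eqI[OF a])
  fix i assume i: "i \<in> {1..d}"
  have "translate d N a x i = translate d N a y i" using e by simp
  then have "[x i + a i = y i + a i] (mod 2 * N)" using i by (simp add: translate_def cong_def)
  then have "[x i = y i] (mod 2 * N)" by (simp add: cong_add_rcancel_nat)
  then show "x i = y i" using torus_less[OF a(1) i] torus_less[OF a(2) i] by (simp add: cong_def)
qed

lemma translate_bij: assumes "N \<ge> 1" shows "bij_betw (translate d N a) (torus d N) (torus d N)"
proof -
  have "inj_on (translate d N a) (torus d N)" using translate_inj by (intro inj_onI)
  moreover have "translate d N a ` torus d N \<subseteq> torus d N" using translate_torus[OF assms] by blast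
  ultimately show ?thesis by (simp add: bij_betw_def endo_inj_surj finite_torus)
qed

lemma translate_step: 
  assumes "x \<in> torus d N" "i \<in> {1..d}"
  shows "translate d N a (step N i x) = step N i (translate d N a x)"
  using assms by (auto simp: translate_def step_def fun_eq_iff mod_simps)

lemma bond_translate:
  assumes N: "N \<ge> 1" and x: "x \<in> torus d N" "y \<in> torus d N"
  shows "bond d N (translate d N a x) (translate d N a y) = bond d N x y"
proof -
  have *: "translate d N a v = step N i (translate d N a u) \<longleftrightarrow> v = step N i u"
    if "u \<in> torus d N" "v \<in> torus d N" "i \<in> {1..d}" for i u v
    unfolding translate_step[OF that(1,3), symmetric]
    using translate_inj[OF that(2) step_torus[OF N that(1,3)]] by blast
  show ?thesis unfolding bond_def by (intro sum.cong refl) (simp add: * x)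
qed

lemma translate_origin: "a \<in> torus d N \<Longrightarrow> translate d N a (origin d) = a"
  by (rule torus_eqI[of _ d N]) (auto simp: translate_def origin_def torus_def PiE_def Pi_def)

lemma phase_translate:
  assumes N: "N \<ge> 1" and k: "\<forall>j\<in>{1..d}. \<exists>m::int. k j = 2 * pi / (2 * real N) * of_int m"
  shows "\<exists>q::int. phase d k (translate d N a x) = phase d k x + phase d k a + 2 * pi * of_int q"
proof -
  have "\<forall>j\<in>{1..d}. \<exists>q::int. k j * real ((x j + a j) mod (2 * N)) = k j * real (x j + a j) + 2 * pi * of_int q"
  proof
    fix j assume "j \<in> {1..d}"
    then obtain m :: int where m: "k j = 2 * pi / (2 * real N) * of_int m" using k by blast
    show "\<exists>q::int. k j * real ((x j + a j) mod (2 * N)) = k j * real (x j + a j) + 2 * pi * of_int q"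
      by (rule wave_number_mod[of k j N m, OF m N])
  qed
  then obtain q :: "nat \<Rightarrow> int" where
    q: "\<forall>j\<in>{1..d}. k j * real ((x j + a j) mod (2 * N)) = k j * real (x j + a j) + 2 * pi * of_int (q j)"
    by metis
  have "phase d k (translate d N a x) = (\<Sum>j=1..d. k j * real ((x j + a j) mod (2 * N)))"
    by (simp add: phase_def translate_def)
  also have "\<dots> = (\<Sum>j=1..d. k j * real (x j) + k j * real (a j) + 2 * pi * of_int (q j))"
    by (intro sum.cong refl) (use q in \<open>simp add: algebra_simps\<close>)
  also have "\<dots> = phase d k x + phase d k a + 2 * pi * of_int (\<Sum>j=1..d. q j)"
    by (simp add: phase_def sum.distrib sum_distrib_left)
  finally show ?thesis by blast
qed

subsection \<open>Reflections\<close>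

text \<open>The position of \<open>a\<close> on the cycle of length \<open>n\<close>, counted from \<open>c\<close>.\<close>

definition rel_coord :: "nat \<Rightarrow> nat \<Rightarrow> nat \<Rightarrow> nat" where
  "rel_coord n c a = (a + (n - c)) mod n"

lemma rel_less: "c < n \<Longrightarrow> rel_coord n c a < n" by (simp add: rel_coord_def)

lemma rel_inv: "c < n \<Longrightarrow> u < n \<Longrightarrow> rel_coord n c ((u + c) mod n) = u"
  unfolding rel_coord_def mod_add_left_eq by simp

lemma rel_inv': "c < n \<Longrightarrow> a < n \<Longrightarrow> (rel_coord n c a + c) mod n = a"
  unfolding rel_coord_def mod_add_left_eq by simp

lemma rel_inj: "c < n \<Longrightarrow> a < n \<Longrightarrow> b < n \<Longrightarrow> rel_coord n c a = rel_coord n c b \<Longrightarrow> a = b"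
  by (metis rel_inv')

lemma rel_Suc: "c < n \<Longrightarrow> rel_coord n c (Suc a mod n) = Suc (rel_coord n c a) mod n"
  unfolding rel_coord_def mod_add_left_eq mod_Suc_eq by simp

text \<open>In the coordinate \<open>u\<close> counted from \<open>c\<close> this is \<open>u \<mapsto> 2 * N - 1 - u\<close>. It exchanges the half
\<open>u < N\<close> with its complement, and the bonds between the two halves are those between \<open>u = N - 1\<close> and
\<open>u = N\<close> and those between \<open>u = 2 * N - 1\<close> and \<open>u = 0\<close>.\<close>

definition reflect_vertex :: "nat \<Rightarrow> nat \<Rightarrow> nat \<Rightarrow> vertex \<Rightarrow> vertex" where
  "reflect_vertex N i c z = z(i := ((2 * N - 1 - rel_coord (2 * N) c (z i)) + c) mod (2 * N))"

lemma reflect_vertex_facts: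
  assumes N: "N \<ge> 1" and i: "i \<in> {1..d}" and c: "c < 2 * N" and z: "z \<in> torus d N"
  shows "reflect_vertex N i c z \<in> torus d N"
    "rel_coord (2 * N) c (reflect_vertex N i c z i) = 2 * N - 1 - rel_coord (2 * N) c (z i)"
    "j \<noteq> i \<Longrightarrow> reflect_vertex N i c z j = z j"
    "reflect_vertex N i c (reflect_vertex N i c z) = z"
proof -
  have r: "rel_coord (2 * N) c (z i) < 2 * N" by (rule rel_less[OF c])
  show 1: "reflect_vertex N i c z \<in> torus d N"
    unfolding reflect_vertex_def by (rule torus_update[OF z i]) (use N in auto)
  show 2: "rel_coord (2 * N) c (reflect_vertex N i c z i) = 2 * N - 1 - rel_coord (2 * N) c (z i)"
    unfolding reflect_vertex_def fun_upd_same by (rule rel_inv[OF c]) (use r in simp)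
  show "j \<noteq> i \<Longrightarrow> reflect_vertex N i c z j = z j" by (simp add: reflect_vertex_def)
  have "2 * N - 1 - (2 * N - 1 - rel_coord (2 * N) c (z i)) = rel_coord (2 * N) c (z i)" using r by simp
  then show "reflect_vertex N i c (reflect_vertex N i c z) = z"
    unfolding reflect_vertex_def[of N i c "reflect_vertex N i c z"] 2
    using rel_inv'[OF c torus_less[OF z i]] by (simp add: reflect_vertex_def)
qed

lemma eq_step_rel_iff:
  assumes x: "x \<in> torus d N" "y \<in> torus d N" and i: "i \<in> {1..d}" and c: "c < 2 * N"
  shows "y = step N i x \<longleftrightarrow> rel_coord (2 * N) c (y i) = Suc (rel_coord (2 * N) c (x i)) mod (2 * N)
     \<and> (\<forall>j\<in>{1..d}. j \<noteq> i \<longrightarrow> y j = x j)"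
proof -
  have "y i = Suc (x i) mod (2 * N) \<longleftrightarrow> rel_coord (2 * N) c (y i) = Suc (rel_coord (2 * N) c (x i)) mod (2 * N)"
    unfolding rel_Suc[OF c, symmetric]
    using rel_inj[OF c torus_less[OF x(2) i], of "Suc (x i) mod (2 * N)"] c by auto
  then show ?thesis unfolding eq_step_iff[OF x i] by simp
qed

lemma reflect_vertex_bond:
  assumes N: "N \<ge> 1" and i: "i \<in> {1..d}" and c: "c < 2 * N" and x: "x \<in> torus d N" "y \<in> torus d N"
  shows "bond d N (reflect_vertex N i c x) (reflect_vertex N i c y) = bond d N x y"
proof -
  note mt = reflect_vertex_facts(1)[OF N i c] and mr = reflect_vertex_facts(2)[OF N i c] and mo = reflect_vertex_facts(3)[OF N i c]
  have same: "reflect_vertex N i c v = step N j (reflect_vertex N i c u) \<longleftrightarrow> v = step N j u"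
    if u: "u \<in> torus d N" and v: "v \<in> torus d N" and j: "j \<in> {1..d}" "j \<noteq> i" for u v j
  proof -
    have iff: "reflect_vertex N i c v i = reflect_vertex N i c u i \<longleftrightarrow> v i = u i"
    proof
      assume "reflect_vertex N i c v i = reflect_vertex N i c u i"
      then have "2 * N - 1 - rel_coord (2 * N) c (v i) = 2 * N - 1 - rel_coord (2 * N) c (u i)"
        using mr[OF u] mr[OF v] by simp
      then have "rel_coord (2 * N) c (v i) = rel_coord (2 * N) c (u i)"
        using rel_less[OF c, of "v i"] rel_less[OF c, of "u i"] by linarith
      then show "v i = u i" by (rule rel_inj[OF c torus_less[OF v i] torus_less[OF u i]])
    qed (simp add: reflect_vertex_def)
    show ?thesis
      unfolding eq_step_iff[OF u v j(1)] eq_step_iff[OF mt[OF u] mt[OF v] j(1)]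
      using iff j(2) i mo[OF u] mo[OF v] by metis
  qed
  have swap: "reflect_vertex N i c v = step N i (reflect_vertex N i c u) \<longleftrightarrow> u = step N i v"
    if u: "u \<in> torus d N" and v: "v \<in> torus d N" for u v
  proof -
    have ar: "2 * N - 1 - b = Suc (2 * N - 1 - a) mod (2 * N) \<longleftrightarrow> a = Suc b mod (2 * N)"
      if "a < 2 * N" "b < 2 * N" for a b using that by (auto simp: mod_Suc)
    show ?thesis
      unfolding eq_step_rel_iff[OF mt[OF u] mt[OF v] i c] eq_step_rel_iff[OF v u i c]
        mr[OF u] mr[OF v] ar[OF rel_less[OF c] rel_less[OF c]]
      using mo[OF u] mo[OF v] by metis
  qed
  show ?thesis unfolding bond_def
  proof (rule sum.cong[OF refl])
    fix j assume j: "j \<in> {1..d}"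
    show "(of_bool (reflect_vertex N i c y = step N j (reflect_vertex N i c x)) + of_bool (reflect_vertex N i c x = step N j (reflect_vertex N i c y)) :: nat)
       = of_bool (y = step N j x) + of_bool (x = step N j y)"
    proof (cases "j = i")
      case True
      then show ?thesis by (simp only: swap[OF x] swap[OF x(2,1)] add.commute)
    next
      case False
      then show ?thesis by (simp only: same[OF x j] same[OF x(2,1) j] simp_thms)
    qed
  qed
qed

lemma reflect_vertex_crossing:
  assumes N: "N \<ge> 1" and i: "i \<in> {1..d}" and c: "c < 2 * N" and x: "x \<in> torus d N" "y \<in> torus d N"
    and side: "rel_coord (2 * N) c (x i) < N" "\<not> rel_coord (2 * N) c (y i) < N" and b: "0 < bond d N x y"
  shows "y = reflect_vertex N i c x"
proof -
  note mt = reflect_vertex_facts(1)[OF N i c x(1)] and mr = reflect_vertex_facts(2)[OF N i c x(1)] and mo = reflect_vertex_facts(3)[OF N i c x(1)]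
  obtain j where j: "j \<in> {1..d}" "y = step N j x \<or> x = step N j y"
    using bond_pos_step[OF b] by blast
  have "j = i"
  proof (rule ccontr)
    assume "j \<noteq> i"
    then have "y i = x i" using j(2) by (auto simp: step_def)
    then show False using side by simp
  qed
  then have st: "y = step N i x \<or> x = step N i y" using j by simp
  have "rel_coord (2 * N) c (y i) = 2 * N - 1 - rel_coord (2 * N) c (x i)"
    using st side rel_less[OF c, of "y i"] unfolding eq_step_rel_iff[OF x i c] eq_step_rel_iff[OF x(2,1) i c]
    by (auto simp: mod_Suc split: if_splits)
  then have "rel_coord (2 * N) c (y i) = rel_coord (2 * N) c (reflect_vertex N i c x i)" unfolding mr .
  then have "y i = reflect_vertex N i c x i"
    by (rule rel_inj[OF c torus_less[OF x(2) i] torus_less[OF mt i]])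
  moreover have "y l = x l" if "l \<noteq> i" for l using st that by (auto simp: step_def)
  ultimately show ?thesis using mo by (intro torus_eqI[OF x(2) mt]) metis
qed

section \<open>The model in discrete time\<close>

text \<open>For signs \<open>a\<close> and \<open>b\<close> and \<open>q = exp (- 2 * m)\<close>, the probability that a Poisson variable with mean
\<open>m\<close> is even (if \<open>a = b\<close>) or odd (if \<open>a \<noteq> b\<close>).\<close>

definition flip_kernel :: "real \<Rightarrow> real \<Rightarrow> real \<Rightarrow> real" where
  "flip_kernel q a b = (1 + a * b * q) / 2"

definition ring_weight :: "nat \<Rightarrow> real \<Rightarrow> (nat \<Rightarrow> real) \<Rightarrow> real" where
  "ring_weight n q u = (\<Prod>j<n. flip_kernel q (u j) (u (Suc j mod n)))"

definition rings :: "nat \<Rightarrow> (nat \<Rightarrow> real) set" where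
  "rings n = {..<n} \<rightarrow>\<^sub>E {-1, 1}"

definition conf :: "nat \<Rightarrow> nat \<Rightarrow> nat \<Rightarrow> (vertex \<Rightarrow> nat \<Rightarrow> real) set" where
  "conf d N n = torus d N \<rightarrow>\<^sub>E rings n"

definition coupling :: "nat \<Rightarrow> nat \<Rightarrow> nat \<Rightarrow> (vertex \<Rightarrow> nat \<Rightarrow> real) \<Rightarrow> real" where
  "coupling d N n s = (\<Sum>x\<in>torus d N. \<Sum>y\<in>torus d N. real (bond d N x y) * (\<Sum>j<n. s x j * s y j)) / 2"

definition gibbs :: "nat \<Rightarrow> nat \<Rightarrow> nat \<Rightarrow> real \<Rightarrow> real \<Rightarrow> (vertex \<Rightarrow> nat \<Rightarrow> real) \<Rightarrow> real" where
  "gibbs d N n q \<kappa> s = (\<Prod>x\<in>torus d N. ring_weight n q (s x)) * exp (\<kappa> * coupling d N n s)"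

definition re_amp :: "nat \<Rightarrow> nat \<Rightarrow> nat \<Rightarrow> (nat \<Rightarrow> real) \<Rightarrow> real \<Rightarrow> (vertex \<Rightarrow> nat \<Rightarrow> real) \<Rightarrow> real" where
  "re_amp d N n k \<theta> s = (\<Sum>x\<in>torus d N. \<Sum>j<n. s x j * cos (phase d k x + \<theta> * real j))"

definition im_amp :: "nat \<Rightarrow> nat \<Rightarrow> nat \<Rightarrow> (nat \<Rightarrow> real) \<Rightarrow> real \<Rightarrow> (vertex \<Rightarrow> nat \<Rightarrow> real) \<Rightarrow> real" where
  "im_amp d N n k \<theta> s = (\<Sum>x\<in>torus d N. \<Sum>j<n. s x j * sin (phase d k x + \<theta> * real j))"

lemma finite_rings: "finite (rings n)" by (simp add: rings_def finite_PiE)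

lemma finite_conf: "finite (conf d N n)" by (simp add: conf_def finite_PiE finite_rings finite_torus)

lemma rings_spin: "u \<in> rings n \<Longrightarrow> j < n \<Longrightarrow> u j = -1 \<or> u j = 1"
  unfolding rings_def using PiE_mem[of u "{..<n}" "\<lambda>_. {-1, 1}" j] by simp

lemma conf_ring: "s \<in> conf d N n \<Longrightarrow> x \<in> torus d N \<Longrightarrow> s x \<in> rings n"
  unfolding conf_def using PiE_mem[of s "torus d N" "\<lambda>_. rings n" x] by simp

lemma conf_sq: "s \<in> conf d N n \<Longrightarrow> x \<in> torus d N \<Longrightarrow> j < n \<Longrightarrow> s x j * s x j = 1"
  using rings_spin[OF conf_ring, of s d N n x j] by auto

lemma flip_kernel_pos: "0 < q \<Longrightarrow> q < 1 \<Longrightarrow> a = -1 \<or> a = 1 \<Longrightarrow> b = -1 \<or> b = 1 \<Longrightarrow> 0 < flip_kernel q a b"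
  by (auto simp: flip_kernel_def)

lemma flip_kernel_sym: "flip_kernel q a b = flip_kernel q b a"
  by (simp add: flip_kernel_def mult.commute)

lemma ring_weight_pos:
  assumes "0 < q" "q < 1" "u \<in> rings n"
  shows "0 < ring_weight n q u"
  unfolding ring_weight_def
proof (rule prod_pos)
  fix j assume "j \<in> {..<n}"
  then have "j < n" "Suc j mod n < n" by auto
  then show "0 < flip_kernel q (u j) (u (Suc j mod n))"
    using flip_kernel_pos[OF assms(1,2)] rings_spin[OF assms(3)] by blast
qed

lemma gibbs_pos:
  assumes "0 < q" "q < 1" "s \<in> conf d N n"
  shows "0 < gibbs d N n q \<kappa> s"
proof -
  have "0 < (\<Prod>x\<in>torus d N. ring_weight n q (s x))"
    by (rule prod_pos) (rule ring_weight_pos[OF assms(1,2) conf_ring[OF assms(3)]])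
  then show ?thesis by (simp add: gibbs_def)
qed

subsection \<open>The spatial bound\<close>

text \<open>Rings of spins are the vectors of \<open>spin_graph\<close>. All of them have the same length, so that the quadratic
energy differs from the coupling by a constant only. The real and the imaginary part of a plane wave are
two eigenvectors, whose squared norms add up to the number of space-time points.\<close>

lemma spatial_bound:
  assumes N: "N \<ge> 1" and q: "0 < q" "q < 1" and \<kappa>: "0 < \<kappa>"
    and k: "\<forall>j\<in>{1..d}. \<exists>m::int. k j = 2 * pi / (2 * real N) * of_int m"
  shows "\<kappa> * (2 * L_hat d k) * (\<Sum>s\<in>conf d N n. gibbs d N n q \<kappa> s * ((re_amp d N n k \<theta> s)\<^sup>2 + (im_amp d N n k \<theta> s)\<^sup>2))
    \<le> real (card (torus d N)) * real n * (\<Sum>s\<in>conf d N n. gibbs d N n q \<kappa> s)"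
proof -
  interpret spin_graph "torus d N" "bond d N" "{..<n}" "rings n" "ring_weight n q" \<kappa>
    by unfold_locales (use finite_torus finite_rings ring_weight_pos q \<kappa> bond_sym in \<open>auto intro: less_imp_le\<close>)
  let ?V = "torus d N"
  have reflectable: "\<exists>\<theta> H. reflection \<theta> H \<and> (x \<in> H \<longleftrightarrow> y \<notin> H)"
    if xy: "x \<in> ?V" "y \<in> ?V" "0 < bond d N x y" for x y
  proof -
    obtain i where i: "i \<in> {1..d}" and st: "y = step N i x \<or> x = step N i y"
      using bond_pos_step[OF xy(3)] by blast
    have "\<exists>c<2 * N. (rel_coord (2 * N) c (x i) < N) \<noteq> (rel_coord (2 * N) c (y i) < N)"
    proof -
      have *: "rel_coord (2 * N) c c = 0" if "c < 2 * N" for c using that by (simp add: rel_coord_def)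
      have **: "rel_coord (2 * N) (Suc a mod (2 * N)) a = 2 * N - 1" if "a < 2 * N" for a
        using that N by (cases "Suc a = 2 * N") (auto simp: rel_coord_def)
      have lt: "x i < 2 * N" "y i < 2 * N" using torus_less xy i by blast+
      from st show ?thesis
      proof
        assume "y = step N i x"
        then have "y i = Suc (x i) mod (2 * N)" by (simp add: step_def)
        then have "rel_coord (2 * N) (y i) (x i) = 2 * N - 1" using **[OF lt(1)] by simp
        then show ?thesis using *[OF lt(2)] lt(2) N by (intro exI[of _ "y i"]) auto
      next
        assume "x = step N i y"
        then have "x i = Suc (y i) mod (2 * N)" by (simp add: step_def)
        then have "rel_coord (2 * N) (x i) (y i) = 2 * N - 1" using **[OF lt(2)] by simp
        then show ?thesis using *[OF lt(1)] lt(1) N by (intro exI[of _ "x i"]) auto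
      qed
    qed
    then obtain c where c: "c < 2 * N" and side: "(rel_coord (2 * N) c (x i) < N) \<noteq> (rel_coord (2 * N) c (y i) < N)"
      by blast
    \<comment> \<open>cut the torus between \<open>x\<close> and \<open>y\<close>, and on the opposite side\<close>
    define H where "H = {z \<in> ?V. rel_coord (2 * N) c (z i) < N}"
    note mf = reflect_vertex_facts[OF N i c]
    have half: "rel_coord (2 * N) c (reflect_vertex N i c z i) < N \<longleftrightarrow> \<not> rel_coord (2 * N) c (z i) < N" if "z \<in> ?V" for z
      unfolding mf(2)[OF that] using rel_less[OF c, of "z i"] by linarith
    have img: "reflect_vertex N i c ` H = ?V - H"
    proof (intro equalityI subsetI)
      fix z assume "z \<in> reflect_vertex N i c ` H"
      then obtain w where w: "w \<in> ?V" "rel_coord (2 * N) c (w i) < N" "z = reflect_vertex N i c w" by (auto simp: H_def)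
      then show "z \<in> ?V - H" using mf(1)[OF w(1)] half[OF w(1)] by (simp add: H_def)
    next
      fix z assume z: "z \<in> ?V - H"
      then have zV: "z \<in> ?V" and zr: "\<not> rel_coord (2 * N) c (z i) < N" by (auto simp: H_def)
      have "reflect_vertex N i c z \<in> H" using mf(1)[OF zV] half[OF zV] zr by (simp add: H_def)
      then show "z \<in> reflect_vertex N i c ` H" using mf(4)[OF zV] by (metis imageI)
    qed
    have "reflection (reflect_vertex N i c) H" unfolding reflection_def
    proof (intro conjI ballI impI)
      fix z w assume zw: "z \<in> H" "w \<in> ?V - H" "0 < bond d N z w"
      show "w = reflect_vertex N i c z"
        by (rule reflect_vertex_crossing[OF N i c]) (use zw in \<open>auto simp: H_def\<close>)
    qed (use img mf(4) reflect_vertex_bond[OF N i c] in \<open>auto simp: H_def\<close>)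
    moreover have "x \<in> H \<longleftrightarrow> y \<notin> H" using side xy by (auto simp: H_def)
    ultimately show ?thesis by blast
  qed
  have L0: "0 \<le> 2 * L_hat d k" by (simp add: L_hat_def sum_nonneg)
  define wc where "wc x j = cos (phase d k x + \<theta> * real j)" for x j
  \<comment> \<open>the sine wave is the cosine wave shifted by \<open>pi / 2\<close>\<close>
  define ws where "ws x j = cos (phase d k x + (\<theta> * real j - pi / 2))" for x j
  have ws: "ws x j = sin (phase d k x + \<theta> * real j)" for x j
    by (simp only: ws_def add_diff_eq cos_diff cos_pi_half sin_pi_half mult_zero_right mult_1_right add_0)
  have eigc: "(\<Sum>y\<in>?V. real (bond d N x y) * (wc x j - wc y j)) = 2 * L_hat d k * wc x j"
    if "x \<in> ?V" for x j unfolding wc_def by (rule discrete_Laplacian_wave[OF N that k])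
  have eigs: "(\<Sum>y\<in>?V. real (bond d N x y) * (ws x j - ws y j)) = 2 * L_hat d k * ws x j"
    if "x \<in> ?V" for x j unfolding ws_def by (rule discrete_Laplacian_wave[OF N that k])
  define E where "E = \<kappa> / 4 * (\<Sum>x\<in>?V. \<Sum>y\<in>?V. real (bond d N x y) * (2 * real n))"
  have wt: "weight s = exp (- E) * gibbs d N n q \<kappa> s" if s: "s \<in> conf d N n" for s
  proof -
    have "(\<Sum>j<n. (s x j - s y j)\<^sup>2) = 2 * real n - 2 * (\<Sum>j<n. s x j * s y j)" if "x \<in> ?V" "y \<in> ?V" for x y
    proof -
      have "(\<Sum>j<n. (s x j - s y j)\<^sup>2) = (\<Sum>j<n. 2 - 2 * (s x j * s y j))"
        using conf_sq[OF s that(1)] conf_sq[OF s that(2)]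
        by (intro sum.cong refl) (simp add: power2_eq_square algebra_simps)
      then show ?thesis by (simp add: sum_subtractf sum_distrib_left)
    qed
    then have "energy s = \<kappa> / 4 * (\<Sum>x\<in>?V. \<Sum>y\<in>?V. real (bond d N x y) * (2 * real n - 2 * (\<Sum>j<n. s x j * s y j)))"
      by (simp add: energy_def)
    also have "\<dots> = E - \<kappa> * coupling d N n s"
      unfolding E_def coupling_def
      by (simp add: right_diff_distrib sum_subtractf sum_distrib_left mult_ac)
    finally have "exp (- energy s) = exp (- E) * exp (\<kappa> * coupling d N n s)" by (simp add: exp_add[symmetric])
    then show ?thesis by (simp add: weight_def gibbs_def)
  qed
  have bound: "\<kappa> * (2 * L_hat d k) * (\<Sum>s\<in>conf d N n. gibbs d N n q \<kappa> s * (pairing s h)\<^sup>2)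
     \<le> pairing h h * (\<Sum>s\<in>conf d N n. gibbs d N n q \<kappa> s)"
    if eig: "\<And>x j. x \<in> ?V \<Longrightarrow> (\<Sum>y\<in>?V. real (bond d N x y) * (h x j - h y j)) = 2 * L_hat d k * h x j" for h
  proof -
    have "\<kappa> * (2 * L_hat d k) * (\<Sum>s\<in>conf d N n. weight s * (pairing s h)\<^sup>2) \<le> pairing h h * (\<Sum>s\<in>conf d N n. weight s)"
      unfolding conf_def
    proof (rule infrared_bound[where h = h and l = "2 * L_hat d k"])
      show "\<exists>\<theta> H. reflection \<theta> H \<and> (x \<in> H \<longleftrightarrow> y \<notin> H)"
        if "x \<in> ?V" "y \<in> ?V" "0 < bond d N x y" for x y by (rule reflectable[OF that])
      show "(\<Sum>y\<in>?V. real (bond d N x y) * (h x j - h y j)) = 2 * L_hat d k * h x j"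
        if "x \<in> ?V" for x j by (rule eig[OF that])
    qed (rule L0)
    then have "exp (- E) * (\<kappa> * (2 * L_hat d k) * (\<Sum>s\<in>conf d N n. gibbs d N n q \<kappa> s * (pairing s h)\<^sup>2))
       \<le> exp (- E) * (pairing h h * (\<Sum>s\<in>conf d N n. gibbs d N n q \<kappa> s))"
      by (simp add: wt sum_distrib_left mult_ac)
    then show ?thesis by simp
  qed
  have "pairing wc wc + pairing ws ws = (\<Sum>x\<in>?V. \<Sum>j<n. 1)"
    unfolding pairing_def sum.distrib[symmetric] ws wc_def
    by (intro sum.cong refl) (simp add: power2_eq_square[symmetric])
  then have norm: "pairing wc wc + pairing ws ws = real (card ?V) * real n" by simp
  have pr: "pairing s wc = re_amp d N n k \<theta> s" "pairing s ws = im_amp d N n k \<theta> s" for s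
    unfolding pairing_def ws wc_def re_amp_def im_amp_def by simp_all
  have "\<kappa> * (2 * L_hat d k) * (\<Sum>s\<in>conf d N n. gibbs d N n q \<kappa> s * ((re_amp d N n k \<theta> s)\<^sup>2 + (im_amp d N n k \<theta> s)\<^sup>2))
    = \<kappa> * (2 * L_hat d k) * (\<Sum>s\<in>conf d N n. gibbs d N n q \<kappa> s * (pairing s wc)\<^sup>2)
     + \<kappa> * (2 * L_hat d k) * (\<Sum>s\<in>conf d N n. gibbs d N n q \<kappa> s * (pairing s ws)\<^sup>2)"
    unfolding pr by (simp add: distrib_left sum.distrib)
  also have "\<dots> \<le> pairing wc wc * (\<Sum>s\<in>conf d N n. gibbs d N n q \<kappa> s) + pairing ws ws * (\<Sum>s\<in>conf d N n. gibbs d N n q \<kappa> s)"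
  proof (rule add_mono)
    show "\<kappa> * (2 * L_hat d k) * (\<Sum>s\<in>conf d N n. gibbs d N n q \<kappa> s * (pairing s wc)\<^sup>2)
       \<le> pairing wc wc * (\<Sum>s\<in>conf d N n. gibbs d N n q \<kappa> s)"
      by (rule bound) (rule eigc)
    show "\<kappa> * (2 * L_hat d k) * (\<Sum>s\<in>conf d N n. gibbs d N n q \<kappa> s * (pairing s ws)\<^sup>2)
       \<le> pairing ws ws * (\<Sum>s\<in>conf d N n. gibbs d N n q \<kappa> s)"
      by (rule bound) (rule eigs)
  qed
  finally show ?thesis unfolding distrib_right[symmetric] norm .
qed

subsection \<open>The temporal bound\<close>

definition slices :: "nat \<Rightarrow> nat \<Rightarrow> (vertex \<Rightarrow> real) set" where
  "slices d N = torus d N \<rightarrow>\<^sub>E {-1, 1}"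

definition slice_kernel :: "nat \<Rightarrow> nat \<Rightarrow> real \<Rightarrow> (vertex \<Rightarrow> real) \<Rightarrow> (vertex \<Rightarrow> real) \<Rightarrow> real" where
  "slice_kernel d N q \<eta> \<zeta> = (\<Prod>x\<in>torus d N. flip_kernel q (\<eta> x) (\<zeta> x))"

lemma finite_slices: "finite (slices d N)" by (simp add: slices_def finite_PiE finite_torus)

lemma slices_spin: "\<eta> \<in> slices d N \<Longrightarrow> x \<in> torus d N \<Longrightarrow> \<eta> x = -1 \<or> \<eta> x = 1"
  unfolding slices_def using PiE_mem[of \<eta> "torus d N" "\<lambda>_. {-1, 1}" x] by simp

lemma sum_slices_prod:
  fixes f :: "vertex \<Rightarrow> real \<Rightarrow> real"
  shows "(\<Sum>\<eta>\<in>slices d N. \<Prod>x\<in>torus d N. f x (\<eta> x)) = (\<Prod>x\<in>torus d N. f x (-1) + f x 1)"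
proof -
  have "(\<Prod>x\<in>torus d N. \<Sum>c\<in>{-1, 1}. f x c) = (\<Sum>\<eta>\<in>slices d N. \<Prod>x\<in>torus d N. f x (\<eta> x))"
    unfolding slices_def by (rule prod_sum_PiE) (simp_all add: finite_torus)
  then show ?thesis by simp
qed

lemma slice_kernel_sym: "slice_kernel d N q \<eta> \<zeta> = slice_kernel d N q \<zeta> \<eta>"
  unfolding slice_kernel_def by (simp add: flip_kernel_sym)

text \<open>Two half steps make a full step: the kernel with parameter \<open>q\<^sup>2\<close> is the square of the symmetric kernel
with parameter \<open>q\<close>.\<close>

lemma slice_kernel_gram: "gram (slices d N) (slice_kernel d N (q\<^sup>2))"
  unfolding gram_def
proof (intro exI ballI)
  fix \<eta> \<zeta> assume e: "\<eta> \<in> slices d N" and z: "\<zeta> \<in> slices d N"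
  have "(\<Sum>v\<in>slices d N. slice_kernel d N q v \<eta> * slice_kernel d N q v \<zeta>)
    = (\<Sum>v\<in>slices d N. \<Prod>x\<in>torus d N. flip_kernel q (v x) (\<eta> x) * flip_kernel q (v x) (\<zeta> x))"
    by (simp add: slice_kernel_def prod.distrib)
  also have "\<dots> = (\<Prod>x\<in>torus d N. flip_kernel q (-1) (\<eta> x) * flip_kernel q (-1) (\<zeta> x)
       + flip_kernel q 1 (\<eta> x) * flip_kernel q 1 (\<zeta> x))"
    by (rule sum_slices_prod)
  also have "\<dots> = slice_kernel d N (q\<^sup>2) \<eta> \<zeta>"
    unfolding slice_kernel_def
    by (intro prod.cong refl) (simp add: flip_kernel_def power2_eq_square field_simps)
  finally show "slice_kernel d N (q\<^sup>2) \<eta> \<zeta> = (\<Sum>v\<in>slices d N. slice_kernel d N q v \<eta> * slice_kernel d N q v \<zeta>)" ..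
qed

lemma slice_kernel_nonneg:
  assumes "0 < q" "q < 1" "\<eta> \<in> slices d N" "\<zeta> \<in> slices d N"
  shows "0 \<le> slice_kernel d N q \<eta> \<zeta>"
  unfolding slice_kernel_def
proof (rule prod_nonneg)
  fix x assume "x \<in> torus d N"
  then show "0 \<le> flip_kernel q (\<eta> x) (\<zeta> x)"
    using flip_kernel_pos[OF assms(1,2)] slices_spin[OF assms(3)] slices_spin[OF assms(4)]
    by (simp add: less_imp_le)
qed

lemma slice_kernel_diag:
  assumes "\<eta> \<in> slices d N"
  shows "slice_kernel d N q \<eta> \<eta> = ((1 + q) / 2) ^ card (torus d N)"
proof -
  have "flip_kernel q (\<eta> x) (\<eta> x) = (1 + q) / 2" if "x \<in> torus d N" for x
    using slices_spin[OF assms that] by (auto simp: flip_kernel_def)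
  then have "slice_kernel d N q \<eta> \<eta> = (\<Prod>x\<in>torus d N. (1 + q) / 2)"
    unfolding slice_kernel_def by (rule prod.cong[OF refl])
  then show ?thesis by simp
qed

text \<open>The sites flip independently under the free kernel, each with probability \<open>(1 - q) / 2\<close>, and a flip
changes the spin by 2.\<close>

lemma sum_jump_pair:
  assumes e: "\<eta> \<in> slices d N" and v: "v \<in> torus d N" and w: "w \<in> torus d N" 
  shows "(\<Sum>\<zeta>\<in>slices d N. \<bar>\<eta> v - \<zeta> v\<bar> * \<bar>\<eta> w - \<zeta> w\<bar> * slice_kernel d N q \<eta> \<zeta>)
    \<le> (if v = w then 2 * (1 - q) else 0) + (1 - q)\<^sup>2"
proof -
  let ?V = "torus d N"
  define f where "f x c = (if x = v then \<bar>\<eta> v - c\<bar> else 1) * (if x = w then \<bar>\<eta> w - c\<bar> else 1)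
     * flip_kernel q (\<eta> x) c" for x c
  have "(\<Sum>\<zeta>\<in>slices d N. \<bar>\<eta> v - \<zeta> v\<bar> * \<bar>\<eta> w - \<zeta> w\<bar> * slice_kernel d N q \<eta> \<zeta>)
    = (\<Sum>\<zeta>\<in>slices d N. \<Prod>x\<in>?V. f x (\<zeta> x))"
  proof (rule sum.cong[OF refl])
    fix \<zeta>
    have pd: "(\<Prod>x\<in>?V. if x = u then \<bar>\<eta> u - \<zeta> x\<bar> else 1) = \<bar>\<eta> u - \<zeta> u\<bar>" if "u \<in> ?V" for u
      using that by (simp add: prod.delta finite_torus)
    show "\<bar>\<eta> v - \<zeta> v\<bar> * \<bar>\<eta> w - \<zeta> w\<bar> * slice_kernel d N q \<eta> \<zeta> = (\<Prod>x\<in>?V. f x (\<zeta> x))"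
      by (simp only: f_def prod.distrib pd[OF v] pd[OF w] slice_kernel_def)
  qed
  also have "\<dots> = (\<Prod>x\<in>?V. f x (-1) + f x 1)" by (rule sum_slices_prod)
  also have "\<dots> = (if v = w then 2 * (1 - q) else (1 - q)\<^sup>2)"
  proof (cases "v = w")
    case True
    have "f x (-1) + f x 1 = (if x = v then 2 * (1 - q) else 1)" if "x \<in> ?V" for x
      using slices_spin[OF e that] True by (auto simp: f_def flip_kernel_def field_simps)
    then have "(\<Prod>x\<in>?V. f x (-1) + f x 1) = (\<Prod>x\<in>?V. if x = v then 2 * (1 - q) else 1)"
      by (rule prod.cong[OF refl])
    then show ?thesis using True v by (simp add: prod.delta finite_torus)
  next
    case False
    have "f x (-1) + f x 1 = (if x = v then 1 - q else 1) * (if x = w then 1 - q else 1)" if "x \<in> ?V" for x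
      using slices_spin[OF e that] False by (auto simp: f_def flip_kernel_def field_simps)
    then have "(\<Prod>x\<in>?V. f x (-1) + f x 1) = (\<Prod>x\<in>?V. (if x = v then 1 - q else 1) * (if x = w then 1 - q else 1))"
      by (rule prod.cong[OF refl])
    then show ?thesis using False v w by (simp add: prod.distrib prod.delta finite_torus power2_eq_square)
  qed
  finally show ?thesis by simp
qed

text \<open>The square of the number of sites appears only together with \<open>(1 - q)\<^sup>2\<close>, from pairs of distinct sites
that flip at once; it disappears in the limit, which makes the final bound uniform in the torus.\<close>

lemma sum_jump_square:
  assumes q: "q \<le> 1" and e: "\<eta> \<in> slices d N"
  shows "(\<Sum>\<zeta>\<in>slices d N. (\<Sum>x\<in>torus d N. \<bar>\<eta> x - \<zeta> x\<bar>)\<^sup>2 * slice_kernel d N q \<eta> \<zeta>)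
    \<le> 2 * real (card (torus d N)) * (1 - q) + (real (card (torus d N)))\<^sup>2 * (1 - q)\<^sup>2"
proof -
  let ?V = "torus d N"
  have "(\<Sum>\<zeta>\<in>slices d N. (\<Sum>x\<in>?V. \<bar>\<eta> x - \<zeta> x\<bar>)\<^sup>2 * slice_kernel d N q \<eta> \<zeta>)
    = (\<Sum>\<zeta>\<in>slices d N. \<Sum>v\<in>?V. \<Sum>w\<in>?V. \<bar>\<eta> v - \<zeta> v\<bar> * \<bar>\<eta> w - \<zeta> w\<bar> * slice_kernel d N q \<eta> \<zeta>)"
    by (simp only: power2_eq_square sum_product) (simp only: sum_distrib_right)
  also have "\<dots> = (\<Sum>v\<in>?V. \<Sum>\<zeta>\<in>slices d N. \<Sum>w\<in>?V. \<bar>\<eta> v - \<zeta> v\<bar> * \<bar>\<eta> w - \<zeta> w\<bar> * slice_kernel d N q \<eta> \<zeta>)"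
    by (rule sum.swap)
  also have "\<dots> = (\<Sum>v\<in>?V. \<Sum>w\<in>?V. \<Sum>\<zeta>\<in>slices d N. \<bar>\<eta> v - \<zeta> v\<bar> * \<bar>\<eta> w - \<zeta> w\<bar> * slice_kernel d N q \<eta> \<zeta>)"
    by (intro sum.cong refl sum.swap)
  also have "\<dots> \<le> (\<Sum>v\<in>?V. \<Sum>w\<in>?V. (if v = w then 2 * (1 - q) else 0) + (1 - q)\<^sup>2)"
    by (intro sum_mono sum_jump_pair e)
  also have "\<dots> = 2 * real (card ?V) * (1 - q) + (real (card ?V))\<^sup>2 * (1 - q)\<^sup>2"
    unfolding sum.distrib by (simp add: finite_torus power2_eq_square[of "real _"])
  finally show ?thesis .
qed

definition transpose_conf :: "nat \<Rightarrow> nat \<Rightarrow> nat \<Rightarrow> (nat \<Rightarrow> vertex \<Rightarrow> real) \<Rightarrow> vertex \<Rightarrow> nat \<Rightarrow> real" where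
  "transpose_conf d N n \<eta> = (\<lambda>x\<in>torus d N. \<lambda>j\<in>{..<n}. \<eta> j x)"

lemma sum_conf_transpose:
  fixes F :: "(vertex \<Rightarrow> nat \<Rightarrow> real) \<Rightarrow> real"
  shows "(\<Sum>s\<in>conf d N n. F s) = (\<Sum>\<eta>\<in>{..<n} \<rightarrow>\<^sub>E slices d N. F (transpose_conf d N n \<eta>))"
proof (rule sum.reindex_bij_witness[where i = "transpose_conf d N n" and j = "\<lambda>s. \<lambda>j\<in>{..<n}. \<lambda>x\<in>torus d N. s x j"])
  fix s assume s: "s \<in> conf d N n"
  have sx: "s x = (\<lambda>j\<in>{..<n}. s x j)" if "x \<in> torus d N" for x
    using conf_ring[OF s that] unfolding rings_def by (rule PiE_restrict[symmetric])
  show eq: "transpose_conf d N n (\<lambda>j\<in>{..<n}. \<lambda>x\<in>torus d N. s x j) = s"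
  proof -
    have "transpose_conf d N n (\<lambda>j\<in>{..<n}. \<lambda>x\<in>torus d N. s x j) = (\<lambda>x\<in>torus d N. \<lambda>j\<in>{..<n}. s x j)"
      unfolding transpose_conf_def by (intro restrict_ext) simp
    also have "\<dots> = restrict s (torus d N)" by (intro restrict_ext) (simp add: sx[symmetric])
    also have "\<dots> = s" using s unfolding conf_def by (rule PiE_restrict)
    finally show ?thesis .
  qed
  show "(\<lambda>j\<in>{..<n}. \<lambda>x\<in>torus d N. s x j) \<in> {..<n} \<rightarrow>\<^sub>E slices d N"
    unfolding slices_def restrict_PiE_iff using rings_spin[OF conf_ring[OF s]] by auto
  show "F (transpose_conf d N n (\<lambda>j\<in>{..<n}. \<lambda>x\<in>torus d N. s x j)) = F s" by (simp only: eq)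
next
  fix \<eta> assume e: "\<eta> \<in> {..<n} \<rightarrow>\<^sub>E slices d N"
  have em: "\<eta> j \<in> slices d N" if "j < n" for j using PiE_mem[OF e] that by simp
  have "(\<lambda>j\<in>{..<n}. \<lambda>x\<in>torus d N. transpose_conf d N n \<eta> x j) = (\<lambda>j\<in>{..<n}. restrict (\<eta> j) (torus d N))"
    unfolding transpose_conf_def by (intro restrict_ext) simp
  also have "\<dots> = restrict \<eta> {..<n}"
    by (intro restrict_ext, rule PiE_restrict) (use em in \<open>simp add: slices_def\<close>)
  also have "\<dots> = \<eta>" using e by (rule PiE_restrict)
  finally show "(\<lambda>j\<in>{..<n}. \<lambda>x\<in>torus d N. transpose_conf d N n \<eta> x j) = \<eta>" .
  show "transpose_conf d N n \<eta> \<in> conf d N n"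
    unfolding conf_def rings_def transpose_conf_def restrict_PiE_iff using slices_spin[OF em] by auto
qed

text \<open>The square root of the Gibbs factor of a time slice. Putting one such factor on either side of the free
kernel makes the transfer matrix symmetric.\<close>

definition half_boltzmann :: "nat \<Rightarrow> nat \<Rightarrow> real \<Rightarrow> (vertex \<Rightarrow> real) \<Rightarrow> real" where
  "half_boltzmann d N \<kappa> \<eta> = exp (\<kappa> / 4 * (\<Sum>x\<in>torus d N. \<Sum>y\<in>torus d N. real (bond d N x y) * (\<eta> x * \<eta> y)))"

lemma prod_cyclic_Suc:
  fixes f :: "nat \<Rightarrow> real"
  shows "(\<Prod>j<n. f (Suc j mod n)) = (\<Prod>j<n. f j)"
proof (cases n)
  case (Suc m)
  have "(\<Prod>j<Suc m. f (Suc j mod Suc m)) = (\<Prod>j<m. f (Suc j)) * f 0" by simp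
  also have "\<dots> = (\<Prod>j<Suc m. f j)" by (simp only: prod.lessThan_Suc_shift mult.commute)
  finally show ?thesis using Suc by simp
qed simp

lemma gibbs_transpose:
  "gibbs d N n q \<kappa> (transpose_conf d N n \<eta>) = (\<Prod>j<n. half_boltzmann d N \<kappa> (\<eta> j) *
     slice_kernel d N q (\<eta> j) (\<eta> (Suc j mod n)) * half_boltzmann d N \<kappa> (\<eta> (Suc j mod n)))"
proof -
  let ?V = "torus d N"
  have "ring_weight n q (transpose_conf d N n \<eta> x) = (\<Prod>j<n. flip_kernel q (\<eta> j x) (\<eta> (Suc j mod n) x))" if "x \<in> ?V" for x
    unfolding ring_weight_def
  proof (rule prod.cong[OF refl])
    fix j assume "j \<in> {..<n}"
    then have "j < n" "Suc j mod n < n" by auto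
    then show "flip_kernel q (transpose_conf d N n \<eta> x j) (transpose_conf d N n \<eta> x (Suc j mod n)) = flip_kernel q (\<eta> j x) (\<eta> (Suc j mod n) x)"
      using that by (simp add: transpose_conf_def)
  qed
  then have "(\<Prod>x\<in>?V. ring_weight n q (transpose_conf d N n \<eta> x)) = (\<Prod>x\<in>?V. \<Prod>j<n. flip_kernel q (\<eta> j x) (\<eta> (Suc j mod n) x))"
    by (rule prod.cong[OF refl])
  also have "\<dots> = (\<Prod>j<n. slice_kernel d N q (\<eta> j) (\<eta> (Suc j mod n)))"
    unfolding slice_kernel_def by (rule prod.swap)
  finally have 1: "(\<Prod>x\<in>?V. ring_weight n q (transpose_conf d N n \<eta> x)) = \<dots>" .
  define B where "B j = (\<Sum>x\<in>?V. \<Sum>y\<in>?V. real (bond d N x y) * (\<eta> j x * \<eta> j y))" for j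
  have "(\<Sum>x\<in>?V. \<Sum>y\<in>?V. real (bond d N x y) * (\<Sum>j<n. transpose_conf d N n \<eta> x j * transpose_conf d N n \<eta> y j))
     = (\<Sum>x\<in>?V. \<Sum>y\<in>?V. \<Sum>j<n. real (bond d N x y) * (\<eta> j x * \<eta> j y))"
    by (simp add: transpose_conf_def sum_distrib_left)
  also have "\<dots> = (\<Sum>x\<in>?V. \<Sum>j<n. \<Sum>y\<in>?V. real (bond d N x y) * (\<eta> j x * \<eta> j y))"
    by (intro sum.cong refl sum.swap)
  also have "\<dots> = (\<Sum>j<n. B j)" unfolding B_def by (rule sum.swap)
  finally have "\<kappa> * coupling d N n (transpose_conf d N n \<eta>) = (\<Sum>j<n. \<kappa> / 4 * B j + \<kappa> / 4 * B j)"
    by (simp add: coupling_def sum_distrib_left sum_divide_distrib)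
  then have "exp (\<kappa> * coupling d N n (transpose_conf d N n \<eta>)) = (\<Prod>j<n. exp (\<kappa> / 4 * B j + \<kappa> / 4 * B j))"
    by (simp only: exp_sum finite_lessThan)
  then have "exp (\<kappa> * coupling d N n (transpose_conf d N n \<eta>)) = (\<Prod>j<n. half_boltzmann d N \<kappa> (\<eta> j)) * (\<Prod>j<n. half_boltzmann d N \<kappa> (\<eta> j))"
    by (simp only: exp_add prod.distrib half_boltzmann_def B_def)
  also have "\<dots> = (\<Prod>j<n. half_boltzmann d N \<kappa> (\<eta> j)) * (\<Prod>j<n. half_boltzmann d N \<kappa> (\<eta> (Suc j mod n)))"
    by (simp only: prod_cyclic_Suc[of "\<lambda>j. half_boltzmann d N \<kappa> (\<eta> j)"])
  finally show ?thesis unfolding gibbs_def 1 by (simp only: prod.distrib mult_ac)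
qed

text \<open>Read slice by slice, a configuration is a closed path in the space of slices, and \<open>temporal_bound\<close> applies
to the real and the imaginary part \<open>a\<close> and \<open>b\<close> of the spatial plane wave. Recombining them with the
wave in time costs a factor 2.\<close>

lemma temporal_gibbs_bound:
  fixes m :: int
  assumes q: "0 < q" "q < 1" and n: "2 \<le> n" and \<theta>: "\<theta> * real n = 2 * pi * of_int m"
  shows "((1 + q\<^sup>2) / 2) ^ card (torus d N) * (2 - 2 * cos \<theta>) *
     (\<Sum>s\<in>conf d N n. gibbs d N n (q\<^sup>2) \<kappa> s * ((re_amp d N n k \<theta> s)\<^sup>2 + (im_amp d N n k \<theta> s)\<^sup>2))
    \<le> 8 * real n * (2 * real (card (torus d N)) * (1 - q\<^sup>2) + (real (card (torus d N)))\<^sup>2 * (1 - q\<^sup>2)\<^sup>2)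
      * (\<Sum>s\<in>conf d N n. gibbs d N n (q\<^sup>2) \<kappa> s)"
proof -
  let ?V = "torus d N" and ?\<Omega> = "slices d N"
  define Q where "Q = q\<^sup>2"
  have Q: "0 < Q" "Q < 1" using q by (simp_all add: Q_def power_less_one_iff)
  define M where "M = 2 * (2 * real (card ?V) * (1 - Q) + (real (card ?V))\<^sup>2 * (1 - Q)\<^sup>2)"
  define a where "a \<eta> = (\<Sum>x\<in>?V. cos (phase d k x) * \<eta> x)" for \<eta> :: "vertex \<Rightarrow> real"
  define b where "b \<eta> = (\<Sum>x\<in>?V. sin (phase d k x) * \<eta> x)" for \<eta> :: "vertex \<Rightarrow> real"
  define w where "w \<eta> = (\<Prod>j<n. half_boltzmann d N \<kappa> (\<eta> j) *
     slice_kernel d N Q (\<eta> j) (\<eta> (Suc j mod n)) * half_boltzmann d N \<kappa> (\<eta> (Suc j mod n)))" for \<eta>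
  define A where "A \<eta> = (\<Sum>j<n. cos (\<theta> * real j) * a (\<eta> j))\<^sup>2 + (\<Sum>j<n. sin (\<theta> * real j) * a (\<eta> j))\<^sup>2
        + (\<Sum>j<n. cos (\<theta> * real j) * b (\<eta> j))\<^sup>2 + (\<Sum>j<n. sin (\<theta> * real j) * b (\<eta> j))\<^sup>2" for \<eta>
  have lip: "(\<Sum>x\<in>?V. g x * (\<eta> x - \<zeta> x))\<^sup>2 \<le> (\<Sum>x\<in>?V. \<bar>\<eta> x - \<zeta> x\<bar>)\<^sup>2"
    if "\<And>x. \<bar>g x\<bar> \<le> 1" for g \<eta> \<zeta> :: "vertex \<Rightarrow> real"
  proof -
    have "\<bar>\<Sum>x\<in>?V. g x * (\<eta> x - \<zeta> x)\<bar> \<le> (\<Sum>x\<in>?V. \<bar>g x * (\<eta> x - \<zeta> x)\<bar>)" by (rule sum_abs)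
    also have "\<dots> \<le> (\<Sum>x\<in>?V. \<bar>\<eta> x - \<zeta> x\<bar>)"
      using mult_right_mono[OF that abs_ge_zero] by (intro sum_mono) (simp add: abs_mult)
    finally show ?thesis by (rule abs_le_square_iff[THEN iffD1, OF order_trans]) simp
  qed
  have M: "(\<Sum>\<zeta>\<in>?\<Omega>. ((a \<eta> - a \<zeta>)\<^sup>2 + (b \<eta> - b \<zeta>)\<^sup>2) * slice_kernel d N Q \<eta> \<zeta>) \<le> M"
    if e: "\<eta> \<in> ?\<Omega>" for \<eta>
  proof -
    have "(a \<eta> - a \<zeta>)\<^sup>2 + (b \<eta> - b \<zeta>)\<^sup>2 \<le> 2 * (\<Sum>x\<in>?V. \<bar>\<eta> x - \<zeta> x\<bar>)\<^sup>2" for \<zeta>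
      using lip[of "\<lambda>x. cos (phase d k x)" \<eta> \<zeta>] lip[of "\<lambda>x. sin (phase d k x)" \<eta> \<zeta>]
      unfolding a_def b_def by (simp add: sum_subtractf right_diff_distrib)
    then have "(\<Sum>\<zeta>\<in>?\<Omega>. ((a \<eta> - a \<zeta>)\<^sup>2 + (b \<eta> - b \<zeta>)\<^sup>2) * slice_kernel d N Q \<eta> \<zeta>)
       \<le> (\<Sum>\<zeta>\<in>?\<Omega>. (2 * (\<Sum>x\<in>?V. \<bar>\<eta> x - \<zeta> x\<bar>)\<^sup>2) * slice_kernel d N Q \<eta> \<zeta>)"
      by (intro sum_mono mult_right_mono slice_kernel_nonneg[OF Q e])
    also have "\<dots> = 2 * (\<Sum>\<zeta>\<in>?\<Omega>. (\<Sum>x\<in>?V. \<bar>\<eta> x - \<zeta> x\<bar>)\<^sup>2 * slice_kernel d N Q \<eta> \<zeta>)"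
      by (simp add: sum_distrib_left mult.assoc)
    also have "\<dots> \<le> M" using sum_jump_square[of Q, OF _ e] Q by (simp add: M_def)
    finally show ?thesis .
  qed
  have T: "((1 + Q) / 2) ^ card ?V * (2 - 2 * cos \<theta>) * (\<Sum>\<eta>\<in>{..<n} \<rightarrow>\<^sub>E ?\<Omega>. w \<eta> * A \<eta>)
    \<le> 2 * real n * M * (\<Sum>\<eta>\<in>{..<n} \<rightarrow>\<^sub>E ?\<Omega>. w \<eta>)"
    unfolding w_def A_def
  proof (rule temporal_bound[OF finite_slices slice_kernel_sym _ _ _ n \<theta>])
    show "gram ?\<Omega> (slice_kernel d N Q)" unfolding Q_def by (rule slice_kernel_gram)
    show "0 \<le> M" using Q by (simp add: M_def)
    show "0 \<le> half_boltzmann d N \<kappa> x" for x by (simp add: half_boltzmann_def)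
  qed (use Q slice_kernel_diag slice_kernel_nonneg M in auto)
  have amp: "(re_amp d N n k \<theta> (transpose_conf d N n \<eta>))\<^sup>2 + (im_amp d N n k \<theta> (transpose_conf d N n \<eta>))\<^sup>2 \<le> 2 * A \<eta>" for \<eta>
  proof -
    have "re_amp d N n k \<theta> (transpose_conf d N n \<eta>) = (\<Sum>x\<in>?V. \<Sum>j<n. \<eta> j x * cos (phase d k x + \<theta> * real j))"
      by (simp add: re_amp_def transpose_conf_def)
    also have "\<dots> = (\<Sum>j<n. \<Sum>x\<in>?V. \<eta> j x * cos (phase d k x + \<theta> * real j))" by (rule sum.swap)
    also have "\<dots> = (\<Sum>j<n. cos (\<theta> * real j) * a (\<eta> j)) - (\<Sum>j<n. sin (\<theta> * real j) * b (\<eta> j))"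
      unfolding a_def b_def sum_distrib_left sum_subtractf[symmetric]
      by (intro sum.cong refl) (simp add: cos_add algebra_simps)
    finally have re: "re_amp d N n k \<theta> (transpose_conf d N n \<eta>) = \<dots>" .
    have "im_amp d N n k \<theta> (transpose_conf d N n \<eta>) = (\<Sum>x\<in>?V. \<Sum>j<n. \<eta> j x * sin (phase d k x + \<theta> * real j))"
      by (simp add: im_amp_def transpose_conf_def)
    also have "\<dots> = (\<Sum>j<n. \<Sum>x\<in>?V. \<eta> j x * sin (phase d k x + \<theta> * real j))" by (rule sum.swap)
    also have "\<dots> = (\<Sum>j<n. sin (\<theta> * real j) * a (\<eta> j)) + (\<Sum>j<n. cos (\<theta> * real j) * b (\<eta> j))"
      unfolding a_def b_def sum_distrib_left sum.distrib[symmetric]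
      by (intro sum.cong refl) (simp add: sin_add algebra_simps)
    finally have im: "im_amp d N n k \<theta> (transpose_conf d N n \<eta>) = \<dots>" .
    have "(u - v)\<^sup>2 + (s + t)\<^sup>2 \<le> 2 * (u\<^sup>2 + s\<^sup>2 + t\<^sup>2 + v\<^sup>2)" for u v s t :: real
      using sum_squares_ge_zero[of "u + v" "s - t"] by (simp add: power2_eq_square algebra_simps)
    then show ?thesis unfolding re im A_def .
  qed
  have w: "gibbs d N n Q \<kappa> (transpose_conf d N n \<eta>) = w \<eta>" for \<eta> unfolding w_def by (rule gibbs_transpose)
  have w0: "0 \<le> w \<eta>" if "\<eta> \<in> {..<n} \<rightarrow>\<^sub>E ?\<Omega>" for \<eta>
    unfolding w_def
  proof (rule prod_nonneg)
    fix j assume "j \<in> {..<n}"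
    then have "\<eta> j \<in> ?\<Omega>" "\<eta> (Suc j mod n) \<in> ?\<Omega>" using PiE_mem[OF that] by auto
    then show "0 \<le> half_boltzmann d N \<kappa> (\<eta> j) * slice_kernel d N Q (\<eta> j) (\<eta> (Suc j mod n)) * half_boltzmann d N \<kappa> (\<eta> (Suc j mod n))"
      using slice_kernel_nonneg[OF Q] by (simp add: half_boltzmann_def)
  qed
  have "(\<Sum>s\<in>conf d N n. gibbs d N n Q \<kappa> s * ((re_amp d N n k \<theta> s)\<^sup>2 + (im_amp d N n k \<theta> s)\<^sup>2))
     \<le> (\<Sum>\<eta>\<in>{..<n} \<rightarrow>\<^sub>E ?\<Omega>. w \<eta> * (2 * A \<eta>))"
    unfolding sum_conf_transpose w by (intro sum_mono mult_left_mono amp w0)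
  also have "\<dots> = 2 * (\<Sum>\<eta>\<in>{..<n} \<rightarrow>\<^sub>E ?\<Omega>. w \<eta> * A \<eta>)"
    by (simp add: sum_distrib_left mult_ac)
  finally have "((1 + Q) / 2) ^ card ?V * (2 - 2 * cos \<theta>) * (\<Sum>s\<in>conf d N n. gibbs d N n Q \<kappa> s * ((re_amp d N n k \<theta> s)\<^sup>2 + (im_amp d N n k \<theta> s)\<^sup>2))
     \<le> ((1 + Q) / 2) ^ card ?V * (2 - 2 * cos \<theta>) * (2 * (\<Sum>\<eta>\<in>{..<n} \<rightarrow>\<^sub>E ?\<Omega>. w \<eta> * A \<eta>))"
    using Q by (intro mult_left_mono) auto
  also have "\<dots> = 2 * (((1 + Q) / 2) ^ card ?V * (2 - 2 * cos \<theta>) * (\<Sum>\<eta>\<in>{..<n} \<rightarrow>\<^sub>E ?\<Omega>. w \<eta> * A \<eta>))"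
    by (simp only: mult_ac)
  also have "\<dots> \<le> 2 * (2 * real n * M * (\<Sum>\<eta>\<in>{..<n} \<rightarrow>\<^sub>E ?\<Omega>. w \<eta>))"
    by (rule mult_left_mono[OF T]) simp
  also have "(\<Sum>\<eta>\<in>{..<n} \<rightarrow>\<^sub>E ?\<Omega>. w \<eta>) = (\<Sum>s\<in>conf d N n. gibbs d N n Q \<kappa> s)"
    unfolding sum_conf_transpose w ..
  also have "2 * (2 * real n * M * (\<Sum>s\<in>conf d N n. gibbs d N n Q \<kappa> s))
    = 8 * real n * (2 * real (card ?V) * (1 - Q) + (real (card ?V))\<^sup>2 * (1 - Q)\<^sup>2) * (\<Sum>s\<in>conf d N n. gibbs d N n Q \<kappa> s)"
    by (simp only: M_def)
  finally show ?thesis unfolding Q_def .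
qed

subsection \<open>Translation invariance\<close>

definition shift_conf :: "nat \<Rightarrow> nat \<Rightarrow> nat \<Rightarrow> vertex \<Rightarrow> nat \<Rightarrow> (vertex \<Rightarrow> nat \<Rightarrow> real) \<Rightarrow> vertex \<Rightarrow> nat \<Rightarrow> real" where
  "shift_conf d N n a i s = (\<lambda>x\<in>torus d N. \<lambda>j\<in>{..<n}. s (translate d N a x) ((i + j) mod n))"

lemma shift_conf_apply:
  "x \<in> torus d N \<Longrightarrow> j < n \<Longrightarrow> shift_conf d N n a i s x j = s (translate d N a x) ((i + j) mod n)"
  by (simp add: shift_conf_def)

lemma shift_conf_mem:
  assumes N: "N \<ge> 1" and s: "s \<in> conf d N n"
  shows "shift_conf d N n a i s \<in> conf d N n"
proof -
  have "s (translate d N a x) ((i + j) mod n) \<in> {-1, 1}" if "j < n" for x j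
  proof -
    have "(i + j) mod n < n" using that by simp
    from rings_spin[OF conf_ring[OF s translate_torus[OF N]] this] show ?thesis by blast
  qed
  then show ?thesis unfolding conf_def rings_def shift_conf_def restrict_PiE_iff by blast
qed

lemma shift_conf_bij:
  assumes N: "N \<ge> 1" and i: "i \<le> n"
  shows "bij_betw (shift_conf d N n a i) (conf d N n) (conf d N n)"
proof -
  have "inj_on (shift_conf d N n a i) (conf d N n)"
  proof (rule inj_onI)
    fix s s' assume s: "s \<in> conf d N n" "s' \<in> conf d N n" and e: "shift_conf d N n a i s = shift_conf d N n a i s'"
    have pt: "s y j = s' y j" if y: "y \<in> torus d N" and j: "j < n" for y j
    proof -
      obtain x where x: "x \<in> torus d N" "y = translate d N a x"
        using translate_bij[OF N, of d a] y unfolding bij_betw_def by blast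
      define l where "l = (j + (n - i)) mod n"
      have l: "l < n" "(i + l) mod n = j" using j mod_rotate(2)[OF i j] by (auto simp: l_def)
      have "shift_conf d N n a i s x l = shift_conf d N n a i s' x l" using e by simp
      then show ?thesis unfolding shift_conf_apply[OF x(1) l(1)] l(2) x(2) .
    qed
    show "s = s'"
    proof (rule PiE_ext[OF s[unfolded conf_def]])
      fix y assume y: "y \<in> torus d N"
      show "s y = s' y"
        by (rule PiE_ext[OF conf_ring[OF s(1) y, unfolded rings_def] conf_ring[OF s(2) y, unfolded rings_def]])
          (use pt[OF y] in simp)
    qed
  qed
  moreover have "shift_conf d N n a i ` conf d N n \<subseteq> conf d N n" using shift_conf_mem[OF N] by blast
  ultimately show ?thesis by (simp add: bij_betw_def endo_inj_surj finite_conf)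
qed

lemma gibbs_shift:
  assumes N: "N \<ge> 1" and i: "i \<le> n"
  shows "gibbs d N n q \<kappa> (shift_conf d N n a i s) = gibbs d N n q \<kappa> s"
proof -
  let ?V = "torus d N" and ?s = "shift_conf d N n a i s" and ?t = "translate d N a"
  have "ring_weight n q (?s x) = ring_weight n q (s (?t x))" if x: "x \<in> ?V" for x
  proof -
    have "ring_weight n q (?s x) = (\<Prod>j<n. flip_kernel q (s (?t x) ((i + j) mod n)) (s (?t x) (Suc ((i + j) mod n) mod n)))"
      unfolding ring_weight_def
    proof (rule prod.cong[OF refl])
      fix j assume "j \<in> {..<n}"
      then have j: "j < n" "Suc j mod n < n" by auto
      have "(i + Suc j mod n) mod n = Suc ((i + j) mod n) mod n" by (simp add: mod_simps)
      then show "flip_kernel q (?s x j) (?s x (Suc j mod n)) = flip_kernel q (s (?t x) ((i + j) mod n)) (s (?t x) (Suc ((i + j) mod n) mod n))"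
        by (simp add: shift_conf_apply x j)
    qed
    then show ?thesis unfolding ring_weight_def
      using prod_rotate_index[OF i, of "\<lambda>j. flip_kernel q (s (?t x) j) (s (?t x) (Suc j mod n))"] by simp
  qed
  then have "(\<Prod>x\<in>?V. ring_weight n q (?s x)) = (\<Prod>x\<in>?V. ring_weight n q (s (?t x)))"
    by (rule prod.cong[OF refl])
  also have "\<dots> = (\<Prod>x\<in>?V. ring_weight n q (s x))" by (rule prod.reindex_bij_betw[OF translate_bij[OF N]])
  finally have 1: "(\<Prod>x\<in>?V. ring_weight n q (?s x)) = \<dots>" .
  define G where "G x y = real (bond d N x y) * (\<Sum>j<n. s x j * s y j)" for x y
  have re: "(\<Sum>x\<in>?V. f (?t x)) = (\<Sum>x\<in>?V. f x)" for f :: "vertex \<Rightarrow> real"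
    by (rule sum.reindex_bij_betw[OF translate_bij[OF N]])
  have "real (bond d N x y) * (\<Sum>j<n. ?s x j * ?s y j) = G (?t x) (?t y)" if "x \<in> ?V" "y \<in> ?V" for x y
  proof -
    have "(\<Sum>j<n. ?s x j * ?s y j) = (\<Sum>j<n. s (?t x) ((i + j) mod n) * s (?t y) ((i + j) mod n))"
      using that by (intro sum.cong refl) (simp add: shift_conf_apply)
    also have "\<dots> = (\<Sum>j<n. s (?t x) j * s (?t y) j)"
      by (rule sum_rotate_index[OF i])
    finally show ?thesis by (simp add: G_def bond_translate[OF N that])
  qed
  then have "coupling d N n ?s = (\<Sum>x\<in>?V. \<Sum>y\<in>?V. G (?t x) (?t y)) / 2"
    unfolding coupling_def by (intro arg_cong[where f = "\<lambda>r. r / 2"] sum.cong refl) simp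
  also have "\<dots> = coupling d N n s"
  proof -
    have "(\<Sum>x\<in>?V. \<Sum>y\<in>?V. G (?t x) (?t y)) = (\<Sum>x\<in>?V. \<Sum>y\<in>?V. G (?t x) y)"
      by (rule sum.cong[OF refl]) (rule re)
    also have "\<dots> = (\<Sum>x\<in>?V. \<Sum>y\<in>?V. G x y)" by (rule re)
    finally show ?thesis by (simp add: coupling_def G_def)
  qed
  finally show ?thesis unfolding gibbs_def 1 by simp
qed

definition two_point :: "nat \<Rightarrow> nat \<Rightarrow> nat \<Rightarrow> real \<Rightarrow> real \<Rightarrow> vertex \<Rightarrow> nat \<Rightarrow> real" where
  "two_point d N n q \<kappa> x j = (\<Sum>s\<in>conf d N n. s (origin d) 0 * s x j * gibbs d N n q \<kappa> s)
     / (\<Sum>s\<in>conf d N n. gibbs d N n q \<kappa> s)"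

lemma origin_torus: "N \<ge> 1 \<Longrightarrow> origin d \<in> torus d N"
  by (auto simp: origin_def torus_def)

lemma partition_pos:
  assumes "N \<ge> 1" "0 < q" "q < 1"
  shows "0 < (\<Sum>s\<in>conf d N n. gibbs d N n q \<kappa> s)"
proof (rule sum_pos)
  show "conf d N n \<noteq> {}" by (auto simp: conf_def rings_def PiE_eq_empty_iff)
qed (use finite_conf gibbs_pos[OF assms(2,3)] in auto)

lemma two_point_translate:
  assumes N: "N \<ge> 1" and q: "0 < q" "q < 1" and x: "x \<in> torus d N" "z \<in> torus d N" and ij: "i < n" "t < n"
  shows "(\<Sum>s\<in>conf d N n. gibbs d N n q \<kappa> s * (s x i * s (translate d N x z) ((i + t) mod n)))
    = two_point d N n q \<kappa> z t * (\<Sum>s\<in>conf d N n. gibbs d N n q \<kappa> s)"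
proof -
  let ?C = "conf d N n" and ?g = "gibbs d N n q \<kappa>"
  have "(\<Sum>s\<in>?C. ?g s * (s x i * s (translate d N x z) ((i + t) mod n)))
    = (\<Sum>s\<in>?C. ?g (shift_conf d N n x i s) * (shift_conf d N n x i s (origin d) 0 * shift_conf d N n x i s z t))"
    using ij x by (simp add: gibbs_shift[OF N] shift_conf_apply origin_torus[OF N] translate_origin)
  also have "\<dots> = (\<Sum>s\<in>?C. ?g s * (s (origin d) 0 * s z t))"
    using ij by (intro sum.reindex_bij_betw[OF shift_conf_bij[OF N]]) simp
  also have "\<dots> = two_point d N n q \<kappa> z t * (\<Sum>s\<in>?C. ?g s)"
    using partition_pos[OF N q, of d n \<kappa>] by (simp add: two_point_def mult_ac)
  finally show ?thesis .
qed

text \<open>By translation invariance the correlation depends on the difference of the two space-time points only, and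
the phases are additive up to multiples of \<open>2 * pi\<close>. The function \<open>f\<close> will be the sine and the cosine.\<close>

lemma two_point_Fourier:
  fixes m :: int and f :: "real \<Rightarrow> real"
  assumes N: "N \<ge> 1" and q: "0 < q" "q < 1"
    and k: "\<forall>j\<in>{1..d}. \<exists>m::int. k j = 2 * pi / (2 * real N) * of_int m"
    and \<theta>: "\<theta> * real n = 2 * pi * of_int m"
    and per: "\<And>y q. f (y + 2 * pi * of_int q) = f y"
  shows "(\<Sum>x\<in>torus d N. \<Sum>i<n. \<Sum>y\<in>torus d N. \<Sum>j<n. (\<Sum>s\<in>conf d N n. gibbs d N n q \<kappa> s * (s x i * s y j)) *
       f ((phase d k y + \<theta> * real j) - (phase d k x + \<theta> * real i)))
    = real (card (torus d N)) * real n * (\<Sum>z\<in>torus d N. \<Sum>t<n. two_point d N n q \<kappa> z t * f (phase d k z + \<theta> * real t))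
      * (\<Sum>s\<in>conf d N n. gibbs d N n q \<kappa> s)"
    (is "?L = _ * _ * ?R * ?Z")
proof -
  let ?V = "torus d N"
  have "(\<Sum>y\<in>?V. \<Sum>j<n. (\<Sum>s\<in>conf d N n. gibbs d N n q \<kappa> s * (s x i * s y j)) *
       f ((phase d k y + \<theta> * real j) - (phase d k x + \<theta> * real i))) = ?R * ?Z"
    if x: "x \<in> ?V" and i: "i \<in> {..<n}" for x i
  proof -
    define H where "H y j = (\<Sum>s\<in>conf d N n. gibbs d N n q \<kappa> s * (s x i * s y j)) *
       f ((phase d k y + \<theta> * real j) - (phase d k x + \<theta> * real i))" for y j
    have i': "i < n" "i \<le> n" using i by auto
    have "H (translate d N x z) ((i + t) mod n) = two_point d N n q \<kappa> z t * f (phase d k z + \<theta> * real t) * ?Z"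
      if z: "z \<in> ?V" and t: "t < n" for z t
    proof -
      obtain r :: int where r: "phase d k (translate d N x z) = phase d k z + phase d k x + 2 * pi * of_int r"
        using phase_translate[OF N k] by blast
      define p where "p = (i + t) div n"
      have "real (i + t) = real ((i + t) mod n) + real n * real p"
        unfolding p_def of_nat_mult[symmetric] of_nat_add[symmetric] by simp
      then have "\<theta> * real ((i + t) mod n) = \<theta> * (real i + real t) - \<theta> * real n * real p"
        by (simp add: algebra_simps)
      then have "(phase d k (translate d N x z) + \<theta> * real ((i + t) mod n)) - (phase d k x + \<theta> * real i)
        = (phase d k z + \<theta> * real t) + 2 * pi * of_int (r - m * int p)"
        unfolding r \<theta> by (simp add: algebra_simps)
      then show ?thesis
        unfolding H_def two_point_translate[OF N q x z i'(1) t] by (simp only: per) (simp only: mult_ac)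
    qed
    then have "?R * ?Z = (\<Sum>z\<in>?V. \<Sum>t<n. H (translate d N x z) ((i + t) mod n))"
      by (simp add: sum_distrib_right)
    also have "\<dots> = (\<Sum>z\<in>?V. \<Sum>t<n. H (translate d N x z) t)"
      by (rule sum.cong[OF refl]) (rule sum_rotate_index[OF i'(2)])
    also have "\<dots> = (\<Sum>y\<in>?V. \<Sum>t<n. H y t)" by (rule sum.reindex_bij_betw[OF translate_bij[OF N]])
    finally show ?thesis by (simp add: H_def)
  qed
  then have "?L = (\<Sum>x\<in>?V. \<Sum>i<n. ?R * ?Z)" by (intro sum.cong refl)
  then show ?thesis by simp
qed

lemma sum_swap_pairs:
  fixes F :: "'a \<Rightarrow> 'b \<Rightarrow> 'a \<Rightarrow> 'b \<Rightarrow> real"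
  shows "(\<Sum>x\<in>A. \<Sum>i\<in>B. \<Sum>y\<in>A. \<Sum>j\<in>B. F x i y j) = (\<Sum>x\<in>A. \<Sum>i\<in>B. \<Sum>y\<in>A. \<Sum>j\<in>B. F y j x i)"
proof -
  have "(\<Sum>p\<in>A \<times> B. \<Sum>r\<in>A \<times> B. F (fst p) (snd p) (fst r) (snd r)) = (\<Sum>p\<in>A \<times> B. \<Sum>r\<in>A \<times> B. F (fst r) (snd r) (fst p) (snd p))"
    by (rule sum.swap)
  then show ?thesis by (simp add: sum.cartesian_product')
qed

text \<open>The double sum of \<open>two_point_Fourier\<close> is antisymmetric under the exchange of the two points.\<close>

lemma two_point_Fourier_sin:
  fixes m :: int
  assumes N: "N \<ge> 1" and n: "1 \<le> n" and q: "0 < q" "q < 1"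
    and k: "\<forall>j\<in>{1..d}. \<exists>m::int. k j = 2 * pi / (2 * real N) * of_int m"
    and \<theta>: "\<theta> * real n = 2 * pi * of_int m"
  shows "(\<Sum>z\<in>torus d N. \<Sum>t<n. two_point d N n q \<kappa> z t * sin (phase d k z + \<theta> * real t)) = 0"
    (is "?R = 0")
proof -
  let ?V = "torus d N"
  let ?\<phi> = "\<lambda>x i. phase d k x + \<theta> * real i"
  let ?F = "\<lambda>x i y j. (\<Sum>s\<in>conf d N n. gibbs d N n q \<kappa> s * (s x i * s y j)) *
       sin ((phase d k y + \<theta> * real j) - (phase d k x + \<theta> * real i))"
  have per: "sin (y + 2 * pi * of_int p) = sin y" for y and p :: int
    by (simp only: sin_add cos_int_2pin sin_int_2pin mult_1_right mult_zero_right add_0_right)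
  have anti: "?F y j x i = - ?F x i y j" for x i y j
  proof -
    have sin_flip: "sin (b - a) = - sin (a - b)" for a b :: real using sin_minus[of "a - b"] by simp
    have prod_flip: "(\<Sum>s\<in>conf d N n. gibbs d N n q \<kappa> s * (s y j * s x i)) = (\<Sum>s\<in>conf d N n. gibbs d N n q \<kappa> s * (s x i * s y j))"
      by (intro sum.cong refl) (simp only: mult_ac)
    show ?thesis
      unfolding prod_flip sin_flip[of "?\<phi> x i" "?\<phi> y j"] by (rule mult_minus_right)
  qed
  have "(\<Sum>x\<in>?V. \<Sum>i<n. \<Sum>y\<in>?V. \<Sum>j<n. ?F x i y j) = (\<Sum>x\<in>?V. \<Sum>i<n. \<Sum>y\<in>?V. \<Sum>j<n. ?F y j x i)"
    by (rule sum_swap_pairs)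
  also have "\<dots> = (\<Sum>x\<in>?V. \<Sum>i<n. \<Sum>y\<in>?V. \<Sum>j<n. - ?F x i y j)"
    by (intro sum.cong refl) (rule anti)
  also have "\<dots> = - (\<Sum>x\<in>?V. \<Sum>i<n. \<Sum>y\<in>?V. \<Sum>j<n. ?F x i y j)"
    by (simp only: sum_negf)
  finally have "(\<Sum>x\<in>?V. \<Sum>i<n. \<Sum>y\<in>?V. \<Sum>j<n. ?F x i y j) = 0" by simp
  then have "real (card ?V) * real n * ?R * (\<Sum>s\<in>conf d N n. gibbs d N n q \<kappa> s) = 0"
    using two_point_Fourier[OF N q k \<theta> per, of \<kappa>] by simp
  moreover have "card ?V \<noteq> 0" using origin_torus[OF N] finite_torus by auto
  ultimately show ?thesis using n partition_pos[OF N q, of d n \<kappa>] by simp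
qed

text \<open>The double sum of \<open>two_point_Fourier\<close> is the mean of the squared modulus of the wave amplitude.\<close>

lemma two_point_Fourier_cos:
  fixes m :: int
  assumes N: "N \<ge> 1" and q: "0 < q" "q < 1"
    and k: "\<forall>j\<in>{1..d}. \<exists>m::int. k j = 2 * pi / (2 * real N) * of_int m"
    and \<theta>: "\<theta> * real n = 2 * pi * of_int m"
  shows "(\<Sum>s\<in>conf d N n. gibbs d N n q \<kappa> s * ((re_amp d N n k \<theta> s)\<^sup>2 + (im_amp d N n k \<theta> s)\<^sup>2))
    = real (card (torus d N)) * real n * (\<Sum>z\<in>torus d N. \<Sum>t<n. two_point d N n q \<kappa> z t * cos (phase d k z + \<theta> * real t))
      * (\<Sum>s\<in>conf d N n. gibbs d N n q \<kappa> s)"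
proof -
  let ?V = "torus d N" and ?C = "conf d N n"
  let ?\<phi> = "\<lambda>x i. phase d k x + \<theta> * real i"
  define c where "c p r = cos (?\<phi> (fst r) (snd r) - ?\<phi> (fst p) (snd p))" for p r
  let ?P = "?V \<times> {..<n}"
  have amp: "(re_amp d N n k \<theta> s)\<^sup>2 + (im_amp d N n k \<theta> s)\<^sup>2
     = (\<Sum>p\<in>?P. \<Sum>r\<in>?P. s (fst p) (snd p) * s (fst r) (snd r) * c p r)" for s
  proof -
    have re: "re_amp d N n k \<theta> s = (\<Sum>p\<in>?P. s (fst p) (snd p) * cos (?\<phi> (fst p) (snd p)))"
      by (simp add: re_amp_def sum.cartesian_product')
    have im: "im_amp d N n k \<theta> s = (\<Sum>p\<in>?P. s (fst p) (snd p) * sin (?\<phi> (fst p) (snd p)))"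
      by (simp add: im_amp_def sum.cartesian_product')
    show ?thesis unfolding re im power2_eq_square sum_product sum.distrib[symmetric] c_def cos_diff
      by (intro sum.cong refl) (simp add: algebra_simps)
  qed
  have "(\<Sum>s\<in>?C. gibbs d N n q \<kappa> s * ((re_amp d N n k \<theta> s)\<^sup>2 + (im_amp d N n k \<theta> s)\<^sup>2))
    = (\<Sum>s\<in>?C. \<Sum>p\<in>?P. \<Sum>r\<in>?P. gibbs d N n q \<kappa> s * (s (fst p) (snd p) * s (fst r) (snd r)) * c p r)"
    unfolding amp by (simp add: sum_distrib_left mult_ac)
  also have "\<dots> = (\<Sum>p\<in>?P. \<Sum>s\<in>?C. \<Sum>r\<in>?P. gibbs d N n q \<kappa> s * (s (fst p) (snd p) * s (fst r) (snd r)) * c p r)"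
    by (rule sum.swap)
  also have "\<dots> = (\<Sum>p\<in>?P. \<Sum>r\<in>?P. \<Sum>s\<in>?C. gibbs d N n q \<kappa> s * (s (fst p) (snd p) * s (fst r) (snd r)) * c p r)"
    by (intro sum.cong refl sum.swap)
  also have "\<dots> = (\<Sum>x\<in>?V. \<Sum>i<n. \<Sum>y\<in>?V. \<Sum>j<n. (\<Sum>s\<in>?C. gibbs d N n q \<kappa> s * (s x i * s y j)) * cos (?\<phi> y j - ?\<phi> x i))"
    by (simp add: sum.cartesian_product' c_def sum_distrib_right)
  also have "\<dots> = real (card ?V) * real n * (\<Sum>z\<in>?V. \<Sum>t<n. two_point d N n q \<kappa> z t * cos (phase d k z + \<theta> * real t))
      * (\<Sum>s\<in>?C. gibbs d N n q \<kappa> s)"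
    by (rule two_point_Fourier[OF N q k \<theta> cos_add_2pi_int])
  finally show ?thesis .
qed

definition disc_Fourier :: "nat \<Rightarrow> nat \<Rightarrow> nat \<Rightarrow> real \<Rightarrow> real \<Rightarrow> (nat \<Rightarrow> real) \<Rightarrow> real \<Rightarrow> real" where
  "disc_Fourier d N n q \<kappa> k \<theta> = (\<Sum>z\<in>torus d N. \<Sum>t<n. two_point d N n q \<kappa> z t * cos (phase d k z + \<theta> * real t))"

theorem disc_spatial_bound:
  fixes m :: int
  assumes N: "N \<ge> 1" and n: "1 \<le> n" and q: "0 < q" "q < 1" and \<kappa>: "0 < \<kappa>"
    and k: "\<forall>j\<in>{1..d}. \<exists>m::int. k j = 2 * pi / (2 * real N) * of_int m"
    and \<theta>: "\<theta> * real n = 2 * pi * of_int m"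
  shows "\<kappa> * (2 * L_hat d k) * disc_Fourier d N n q \<kappa> k \<theta> \<le> 1"
proof -
  define Z where "Z = (\<Sum>s\<in>conf d N n. gibbs d N n q \<kappa> s)"
  define B where "B = real (card (torus d N)) * real n * Z"
  have "0 < card (torus d N)" using origin_torus[OF N] finite_torus by (auto simp: card_gt_0_iff)
  then have B: "0 < B" using n partition_pos[OF N q, of d n \<kappa>] by (simp add: B_def Z_def)
  have "\<kappa> * (2 * L_hat d k) * (real (card (torus d N)) * real n * disc_Fourier d N n q \<kappa> k \<theta> * Z)
    \<le> real (card (torus d N)) * real n * Z"
    using spatial_bound[OF N q \<kappa> k, of n \<theta>] unfolding two_point_Fourier_cos[OF N q k \<theta>] Z_def disc_Fourier_def .
  then have "B * (\<kappa> * (2 * L_hat d k) * disc_Fourier d N n q \<kappa> k \<theta>) \<le> B * 1"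
    by (simp add: B_def mult_ac)
  then show ?thesis using B by (rule mult_left_le_imp_le)
qed

theorem disc_temporal_bound:
  fixes m :: int
  assumes N: "N \<ge> 1" and n: "2 \<le> n" and q: "0 < q" "q < 1"
    and k: "\<forall>j\<in>{1..d}. \<exists>m::int. k j = 2 * pi / (2 * real N) * of_int m"
    and \<theta>: "\<theta> * real n = 2 * pi * of_int m"
  shows "((1 + q\<^sup>2) / 2) ^ card (torus d N) * (2 - 2 * cos \<theta>) * disc_Fourier d N n (q\<^sup>2) \<kappa> k \<theta>
     \<le> 8 * (2 * (1 - q\<^sup>2) + real (card (torus d N)) * (1 - q\<^sup>2)\<^sup>2)"
proof -
  have Q: "0 < q\<^sup>2" "q\<^sup>2 < 1" using q by (simp_all add: power_less_one_iff)
  define v where "v = real (card (torus d N))"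
  define Z where "Z = (\<Sum>s\<in>conf d N n. gibbs d N n (q\<^sup>2) \<kappa> s)"
  define B where "B = v * real n * Z"
  have "0 < card (torus d N)" using origin_torus[OF N] finite_torus by (auto simp: card_gt_0_iff)
  then have B: "0 < B" using n partition_pos[OF N Q, of d n \<kappa>] by (simp add: B_def Z_def v_def)
  have "((1 + q\<^sup>2) / 2) ^ card (torus d N) * (2 - 2 * cos \<theta>) * (v * real n * disc_Fourier d N n (q\<^sup>2) \<kappa> k \<theta> * Z)
    \<le> 8 * real n * (2 * v * (1 - q\<^sup>2) + v\<^sup>2 * (1 - q\<^sup>2)\<^sup>2) * Z"
    using temporal_gibbs_bound[OF q n \<theta>, of d N \<kappa> k]
    unfolding two_point_Fourier_cos[OF N Q k \<theta>] Z_def disc_Fourier_def v_def .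
  moreover have "8 * real n * (2 * v * (1 - q\<^sup>2) + v\<^sup>2 * (1 - q\<^sup>2)\<^sup>2) * Z
     = B * (8 * (2 * (1 - q\<^sup>2) + v * (1 - q\<^sup>2)\<^sup>2))"
    unfolding B_def power2_eq_square[of v] by (simp only: distrib_left distrib_right mult_ac)
  ultimately have "B * (((1 + q\<^sup>2) / 2) ^ card (torus d N) * (2 - 2 * cos \<theta>) * disc_Fourier d N n (q\<^sup>2) \<kappa> k \<theta>)
    \<le> B * (8 * (2 * (1 - q\<^sup>2) + v * (1 - q\<^sup>2)\<^sup>2))"
    by (simp only: B_def mult_ac)
  then show ?thesis using B unfolding v_def by (rule mult_left_le_imp_le)
qed

section \<open>The law of the sampled configuration\<close>

subsection \<open>Counting points in blocks\<close>

definition grid :: "real \<Rightarrow> nat \<Rightarrow> nat \<Rightarrow> real" where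
  "grid \<beta> n j = \<beta> * real j / real n"

text \<open>The intervals between successive sampling times on the circle. The last one contains the point 0, because
the spin at time 0 already counts a point there.\<close>

definition block :: "real \<Rightarrow> nat \<Rightarrow> nat \<Rightarrow> real set" where
  "block \<beta> n j = (if Suc j < n then {grid \<beta> n j<..grid \<beta> n (Suc j)} else {0} \<union> {grid \<beta> n j<..<\<beta>})"

definition sgn_card :: "real set \<Rightarrow> real" where
  "sgn_card S = (-1) ^ card S"

lemma sgn_card_cases: "sgn_card S = 1 \<or> sgn_card S = -1"
  by (simp add: sgn_card_def) (cases "even (card S)"; simp)

lemma sgn_card_even: "sgn_card S = 1 \<longleftrightarrow> even (card S)"
  unfolding sgn_card_def by (cases "even (card S)") auto

lemma sgn_card_Un:
  assumes "finite S" "A \<inter> B = {}"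
  shows "sgn_card (S \<inter> (A \<union> B)) = sgn_card (S \<inter> A) * sgn_card (S \<inter> B)"
proof -
  have "card (S \<inter> (A \<union> B)) = card (S \<inter> A) + card (S \<inter> B)"
    unfolding Int_Un_distrib by (rule card_Un_disjoint) (use assms in auto)
  then show ?thesis by (simp add: sgn_card_def power_add)
qed

context
  fixes \<beta> :: real and n :: nat
  assumes \<beta>: "0 < \<beta>" and n: "1 \<le> n"
begin

lemma grid_0: "grid \<beta> n 0 = 0" by (simp add: grid_def)

lemma grid_n: "grid \<beta> n n = \<beta>" using n by (simp add: grid_def)

lemma grid_mono: "i \<le> j \<Longrightarrow> grid \<beta> n i \<le> grid \<beta> n j"
  using \<beta> by (simp add: grid_def divide_right_mono)

lemma grid_strict_mono: "i < j \<Longrightarrow> grid \<beta> n i < grid \<beta> n j"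
  using \<beta> n by (simp add: grid_def divide_strict_right_mono)

lemma grid_nonneg: "0 \<le> grid \<beta> n j" using \<beta> by (simp add: grid_def)

lemma grid_less: "j < n \<Longrightarrow> grid \<beta> n j < \<beta>" using grid_strict_mono[of j n] grid_n by simp

lemma block_subset: "j < n \<Longrightarrow> block \<beta> n j \<subseteq> {0..<\<beta>}"
  using grid_nonneg[of j] grid_less[of "Suc j"] \<beta> by (auto simp: block_def)

lemma block_borel: "block \<beta> n j \<in> sets borel" by (simp add: block_def)

lemma block_measure:
  assumes "j < n" shows "measure lborel (block \<beta> n j) = \<beta> / real n"
proof (cases "Suc j < n")
  case True
  have "measure lborel {grid \<beta> n j<..grid \<beta> n (Suc j)} = grid \<beta> n (Suc j) - grid \<beta> n j"
    using grid_mono[of j "Suc j"] by simp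
  then show ?thesis using True by (simp add: block_def) (simp add: grid_def diff_divide_distrib[symmetric] algebra_simps)
next
  case False
  then have n': "n = Suc j" using assms by simp
  have "measure lborel ({0} \<union> {grid \<beta> n j<..<\<beta>}) = measure lborel {0::real} + measure lborel {grid \<beta> n j<..<\<beta>}"
    by (rule measure_Un3[THEN trans]) (use grid_nonneg[of j] grid_less[OF assms] in \<open>auto simp: fmeasurable_def\<close>)
  also have "\<dots> = \<beta> - grid \<beta> n j" using grid_less[OF assms] by simp
  also have "\<dots> = \<beta> / real n" using n' by (simp add: grid_def field_simps)
  finally show ?thesis using False by (simp add: block_def)
qed

lemma block_disjoint: "disjoint_family_on (block \<beta> n) {..<n}"
proof -
  have *: "block \<beta> n i \<inter> block \<beta> n j = {}" if ij: "i < j" "j < n" for i j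
  proof -
    have i: "block \<beta> n i = {grid \<beta> n i<..grid \<beta> n (Suc i)}" using ij by (simp add: block_def)
    have "grid \<beta> n (Suc i) \<le> grid \<beta> n j" using ij by (intro grid_mono) simp
    then show ?thesis unfolding i using grid_nonneg[of i] by (auto simp: block_def)
  qed
  show ?thesis unfolding disjoint_family_on_def
  proof (intro ballI impI)
    fix i j assume "i \<in> {..<n}" "j \<in> {..<n}" "i \<noteq> j"
    then show "block \<beta> n i \<inter> block \<beta> n j = {}" using *[of i j] *[of j i] by (cases "i < j") auto
  qed
qed

lemma sgn_card_step:
  assumes S: "finite S" and j: "Suc j < n"
  shows "sgn_card (S \<inter> {0..grid \<beta> n (Suc j)}) = sgn_card (S \<inter> {0..grid \<beta> n j}) * sgn_card (S \<inter> block \<beta> n j)"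
proof -
  have "{0..grid \<beta> n (Suc j)} = {0..grid \<beta> n j} \<union> block \<beta> n j"
    using j grid_nonneg[of j] grid_mono[of j "Suc j"] by (auto simp: block_def)
  moreover have "{0..grid \<beta> n j} \<inter> block \<beta> n j = {}" using j by (auto simp: block_def)
  ultimately show ?thesis using sgn_card_Un[OF S] by simp
qed

lemma sgn_card_last:
  assumes S: "finite S" "S \<subseteq> {0..<\<beta>}"
  shows "sgn_card (S \<inter> {0..grid \<beta> n (n - 1)}) * sgn_card (S \<inter> block \<beta> n (n - 1))
    = sgn_card S * sgn_card (S \<inter> {0..grid \<beta> n 0})"
proof -
  let ?g = "grid \<beta> n (n - 1)"
  have g: "0 \<le> ?g" "?g < \<beta>" using grid_nonneg grid_less[of "n - 1"] n by auto
  have b: "block \<beta> n (n - 1) = {0} \<union> {?g<..<\<beta>}" using n by (simp add: block_def)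
  have 1: "sgn_card (S \<inter> block \<beta> n (n - 1)) = sgn_card (S \<inter> {0}) * sgn_card (S \<inter> {?g<..<\<beta>})"
    unfolding b by (rule sgn_card_Un[OF S(1)]) (use g in auto)
  have "S = S \<inter> ({0..?g} \<union> {?g<..<\<beta>})" using S(2) g by auto
  then have "sgn_card S = sgn_card (S \<inter> ({0..?g} \<union> {?g<..<\<beta>}))" by simp
  also have "\<dots> = sgn_card (S \<inter> {0..?g}) * sgn_card (S \<inter> {?g<..<\<beta>})"
    by (rule sgn_card_Un[OF S(1)]) auto
  finally show ?thesis unfolding 1 grid_0 by simp
qed

text \<open>The sign changes from one sampling time to the next exactly if the block in between contains an odd number
of points. The blocks exhaust the circle, so going around once multiplies the sign by the parity of the
whole set: the sequence closes up if and only if that is even.\<close>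

lemma ring_iff_blocks:
  assumes S: "finite S" "S \<subseteq> {0..<\<beta>}" and u: "u \<in> rings n"
  shows "(even (card S) \<and> (\<exists>z\<in>{0, 1::nat}. \<forall>j<n. (-1) ^ (z + card (S \<inter> {0..grid \<beta> n j})) = u j))
    \<longleftrightarrow> (\<forall>j<n. sgn_card (S \<inter> block \<beta> n j) = u j * u (Suc j mod n))"
proof -
  define v where "v z j = (-1) ^ z * sgn_card (S \<inter> {0..grid \<beta> n j})" for z j :: nat
  have v: "(-1) ^ (z + card (S \<inter> {0..grid \<beta> n j})) = v z j" for z j
    by (simp add: v_def sgn_card_def power_add)
  have vs: "v z (Suc j) = v z j * sgn_card (S \<inter> block \<beta> n j)" if "Suc j < n" for z j
    using sgn_card_step[OF S(1) that] by (simp add: v_def)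
  have vl: "v z (n - 1) * sgn_card (S \<inter> block \<beta> n (n - 1)) = sgn_card S * v z 0" for z
    using sgn_card_last[OF S] by (simp add: v_def mult_ac)
  have usq: "u j * u j = 1" if "j < n" for j using rings_spin[OF u that] by auto
  show ?thesis unfolding v
  proof
    assume L: "even (card S) \<and> (\<exists>z\<in>{0, 1::nat}. \<forall>j<n. v z j = u j)"
    then obtain z where z: "\<And>j. j < n \<Longrightarrow> v z j = u j" by blast
    show "\<forall>j<n. sgn_card (S \<inter> block \<beta> n j) = u j * u (Suc j mod n)"
    proof (intro allI impI)
      fix j assume j: "j < n"
      have "u j * sgn_card (S \<inter> block \<beta> n j) = u (Suc j mod n)"
      proof (cases "Suc j < n")
        case True
        then show ?thesis using vs[OF True, of z] z[OF j] z[OF True] by simp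
      next
        case False
        then have "n = Suc j" using j by simp
        then have "n - 1 = j" "Suc j mod n = 0" by simp_all
        then show ?thesis using vl[of z] z[OF j] z[of 0] n L sgn_card_even[of S] by simp
      qed
      then have "u j * (u j * sgn_card (S \<inter> block \<beta> n j)) = u j * u (Suc j mod n)" by simp
      then show "sgn_card (S \<inter> block \<beta> n j) = u j * u (Suc j mod n)"
        by (simp only: mult.assoc[symmetric] usq[OF j] mult_1_left)
    qed
  next
    assume R: "\<forall>j<n. sgn_card (S \<inter> block \<beta> n j) = u j * u (Suc j mod n)"
    have "v 1 0 = - v 0 0" "v 0 0 = 1 \<or> v 0 0 = -1" using sgn_card_cases by (auto simp: v_def)
    moreover have "u 0 = -1 \<or> u 0 = 1" using rings_spin[OF u, of 0] n by simp
    ultimately obtain z :: nat where z: "z \<in> {0, 1}" "v z 0 = u 0" by (metis insertI1 insertI2 minus_minus)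
    have vu: "j < n \<Longrightarrow> v z j = u j" for j
    proof (induction j)
      case (Suc j)
      then have "v z (Suc j) = u j * (u j * u (Suc j))" using vs[of j z] R by simp
      then show ?case using usq[of j] Suc.prems by (simp only: mult.assoc[symmetric])
    qed (use z in simp)
    have "sgn_card S * u 0 = v z (n - 1) * sgn_card (S \<inter> block \<beta> n (n - 1))"
      using vl[of z] z(2) by simp
    also have "\<dots> = u (n - 1) * (u (n - 1) * u 0)" using vu[of "n - 1"] R n by simp
    also have "\<dots> = u 0" using usq[of "n - 1"] n by (simp only: mult.assoc[symmetric])
    finally have "sgn_card S * (u 0 * u 0) = u 0 * u 0" by simp
    then have "sgn_card S = 1" using usq[of 0] n by simp
    then show "even (card S) \<and> (\<exists>z\<in>{0, 1::nat}. \<forall>j<n. v z j = u j)"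
      using vu z(1) sgn_card_even by blast
  qed
qed

end

subsection \<open>Parities of Poisson counts\<close>

lemma space_configs: "space (configs \<beta>) = {S. finite S \<and> S \<subseteq> {0..<\<beta>}}"
  unfolding configs_def by (rule space_measure_of) auto

lemma card_measurable:
  assumes "B \<in> sets borel" "B \<subseteq> {0..<\<beta>}"
  shows "(\<lambda>S. card (S \<inter> B)) \<in> measurable (configs \<beta>) (count_space UNIV)"
proof -
  have "(\<lambda>S. card (S \<inter> B)) -` {m} \<inter> space (configs \<beta>) \<in> sets (configs \<beta>)" for m
  proof -
    have "(\<lambda>S. card (S \<inter> B)) -` {m} \<inter> space (configs \<beta>) = {S. finite S \<and> S \<subseteq> {0..<\<beta>} \<and> card (S \<inter> B) = m}"
      by (auto simp: space_configs)
    also have "\<dots> \<in> sets (configs \<beta>)"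
      unfolding configs_def by (subst sets_measure_of) (use assms in \<open>auto intro!: sigma_sets.Basic\<close>)
    finally show ?thesis .
  qed
  then show ?thesis by (simp add: measurable_count_space_eq_countable)
qed

text \<open>The even terms of the exponential series of \<open>a\<close> add up to \<open>cosh a\<close>, and
\<open>cosh a * exp (- a) = (1 + exp (- 2 * a)) / 2\<close>.\<close>

lemma poisson_parity:
  assumes P: "poisson_law \<delta> \<beta> P" and B: "B \<in> sets borel" "B \<subseteq> {0..<\<beta>}" and c: "c = -1 \<or> c = 1"
  shows "measure P {S \<in> space P. sgn_card (S \<inter> B) = c} = flip_kernel (exp (- 2 * (\<delta> * measure lborel B))) c 1"
proof -
  interpret prob_space P using P by (simp add: poisson_law_def)
  have sP: "sets P = sets (configs \<beta>)" using P by (simp add: poisson_law_def)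
  have [measurable]: "(\<lambda>S. card (S \<inter> B)) \<in> measurable P (count_space UNIV)"
    unfolding measurable_cong_sets[OF sP refl] by (rule card_measurable[OF B])
  define a where "a = \<delta> * measure lborel B"
  define A where "A i = {S \<in> space P. card (S \<inter> B) = i \<and> even i}" for i
  have "(\<lambda>i. measure P (A i)) sums measure P (\<Union>i. A i)"
    by (rule finite_measure_UNION) (auto simp: A_def disjoint_family_on_def)
  moreover have "measure P (A i) = (if even i then a ^ i / fact i * exp (- a) else 0)" for i
    using P B by (simp add: A_def poisson_law_def a_def)
  moreover have "(\<lambda>i. (if even i then a ^ i / fact i else 0) * exp (- a)) sums (cosh a * exp (- a))"
    using cosh_converges[of a] by (intro sums_mult2) (simp add: scaleR_conv_of_real divide_inverse mult.commute if_distrib cong: if_cong)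
  ultimately have "measure P (\<Union>i. A i) = cosh a * exp (- a)"
    by (auto intro: sums_unique2 simp: if_distrib[of "\<lambda>x. x * _"] cong: if_cong)
  moreover have "(\<Union>i. A i) = {S \<in> space P. sgn_card (S \<inter> B) = 1}"
    by (auto simp: A_def sgn_card_even)
  moreover have "cosh a * exp (- a) = flip_kernel (exp (- 2 * a)) 1 1"
    by (simp add: cosh_def flip_kernel_def field_simps exp_add[symmetric] mult_exp_exp)
  ultimately have 1: "measure P {S \<in> space P. sgn_card (S \<inter> B) = 1} = flip_kernel (exp (- 2 * a)) 1 1"
    by simp
  have m: "{S \<in> space P. sgn_card (S \<inter> B) = 1} \<in> sets P" unfolding sgn_card_even by measurable
  show ?thesis
  proof (cases "c = 1")
    case True
    then show ?thesis using 1 by (simp add: a_def)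
  next
    case False
    then have "{S \<in> space P. sgn_card (S \<inter> B) = c} = space P - {S \<in> space P. sgn_card (S \<inter> B) = 1}"
      using c sgn_card_cases by fastforce
    then have "measure P {S \<in> space P. sgn_card (S \<inter> B) = c} = 1 - flip_kernel (exp (- 2 * a)) 1 1"
      using prob_compl[OF m] 1 by simp
    then show ?thesis using False c by (auto simp: flip_kernel_def a_def field_simps)
  qed
qed

subsection \<open>One site\<close>

definition sample_event :: "real \<Rightarrow> nat \<Rightarrow> (nat \<Rightarrow> real) \<Rightarrow> nat \<Rightarrow> real set set" where
  "sample_event \<beta> n u z = {S \<in> space (configs \<beta>). \<forall>j<n. (-1) ^ (z + card (S \<inter> {0..grid \<beta> n j})) = u j}"

lemma sample_event_sets:
  assumes "0 < \<beta>" "1 \<le> n"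
  shows "sample_event \<beta> n u z \<in> sets (configs \<beta>)"
proof -
  have m: "(\<lambda>S. card (S \<inter> {0..grid \<beta> n j})) \<in> measurable (configs \<beta>) (count_space UNIV)" if "j \<in> {..<n}" for j
    by (rule card_measurable) (use that grid_less[OF assms, of j] in auto)
  have "sample_event \<beta> n u z = {S \<in> space (configs \<beta>). \<forall>j\<in>{..<n}. (-1) ^ (z + card (S \<inter> {0..grid \<beta> n j})) = u j}"
    by (auto simp: sample_event_def)
  also have "\<dots> \<in> sets (configs \<beta>)"
  proof (rule sets.sets_Collect_finite_All)
    fix j assume "j \<in> {..<n}"
    note m[OF this, measurable]
    show "{S \<in> space (configs \<beta>). (-1) ^ (z + card (S \<inter> {0..grid \<beta> n j})) = u j} \<in> sets (configs \<beta>)"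
      by measurable
  qed simp
  finally show ?thesis .
qed

text \<open>The two initial signs \<open>z = 0, 1\<close> together leave only a condition on the parities in the blocks, which are
independent under the Poisson law. That condition already forces an even total, so conditioning on it
merely divides by its probability.\<close>

lemma even_poisson_sample:
  assumes \<nu>: "even_poisson_law \<delta> \<beta> \<nu>" and \<beta>: "0 < \<beta>" and n: "1 \<le> n" and u: "u \<in> rings n"
  shows "measure \<nu> (sample_event \<beta> n u 0) + measure \<nu> (sample_event \<beta> n u 1)
    = ring_weight n (exp (- 2 * (\<delta> * (\<beta> / real n)))) u / flip_kernel (exp (- 2 * (\<delta> * \<beta>))) 1 1"
proof -
  obtain P where P: "poisson_law \<delta> \<beta> P" and \<nu>: "\<nu> = uniform_measure P {S \<in> space P. even (card S)}"
    using \<nu> unfolding even_poisson_law_def by blast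
  interpret prob_space P using P by (simp add: poisson_law_def)
  have sP: "sets P = sets (configs \<beta>)" using P by (simp add: poisson_law_def)
  have spP: "space P = space (configs \<beta>)" by (rule sets_eq_imp_space_eq[OF sP])
  define E where "E = {S \<in> space P. even (card S)}"
  have "S \<inter> {0..<\<beta>} = S" if "S \<in> space P" for S using that by (auto simp: spP space_configs)
  then have E: "E = {S \<in> space P. sgn_card (S \<inter> {0..<\<beta>}) = 1}"
    unfolding E_def sgn_card_even by auto
  have "(\<lambda>S. card (S \<inter> {0..<\<beta>})) \<in> measurable P (count_space UNIV)"
    unfolding measurable_cong_sets[OF sP refl] by (rule card_measurable) auto
  then have Es: "E \<in> sets P" unfolding E sgn_card_even by measurable
  have PE: "prob E = flip_kernel (exp (- 2 * (\<delta> * \<beta>))) 1 1"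
    unfolding E using poisson_parity[OF P, of "{0..<\<beta>}" 1] \<beta> by simp
  have E0: "0 < prob E" unfolding PE by (simp add: flip_kernel_def add_pos_pos)
  have SE: "sample_event \<beta> n u z \<in> sets P" for z unfolding sP by (rule sample_event_sets[OF \<beta> n])
  have me: "measure \<nu> (sample_event \<beta> n u z) = prob (E \<inter> sample_event \<beta> n u z) / prob E" for z
    unfolding \<nu> E_def[symmetric]
    by (rule measure_uniform_measure) (use E0 SE in \<open>auto simp: emeasure_eq_measure\<close>)
  have disj: "sample_event \<beta> n u 0 \<inter> sample_event \<beta> n u 1 = {}"
  proof -
    have "False" if "S \<in> sample_event \<beta> n u 0" "S \<in> sample_event \<beta> n u 1" for S
    proof -
      have "(-1) ^ card (S \<inter> {0..grid \<beta> n 0}) = u 0" "(-1) ^ Suc (card (S \<inter> {0..grid \<beta> n 0})) = u 0"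
        using that n by (auto simp: sample_event_def)
      moreover have "u 0 = -1 \<or> u 0 = 1" using rings_spin[OF u] n by simp
      ultimately show False by auto
    qed
    then show ?thesis by blast
  qed
  have cup: "(E \<inter> sample_event \<beta> n u 0) \<union> (E \<inter> sample_event \<beta> n u 1)
    = {S \<in> space P. \<forall>j<n. sgn_card (S \<inter> block \<beta> n j) = u j * u (Suc j mod n)}"
  proof -
    have "S \<in> (E \<inter> sample_event \<beta> n u 0) \<union> (E \<inter> sample_event \<beta> n u 1)
      \<longleftrightarrow> (\<forall>j<n. sgn_card (S \<inter> block \<beta> n j) = u j * u (Suc j mod n))" if S: "S \<in> space P" for S
    proof -
      have S': "finite S" "S \<subseteq> {0..<\<beta>}" using S by (auto simp: spP space_configs)
      show ?thesis unfolding ring_iff_blocks[OF \<beta> n S' u, symmetric]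
        using S by (auto simp: E_def sample_event_def spP)
    qed
    then show ?thesis by (auto simp: E_def)
  qed
  have bl: "block \<beta> n j \<in> sets borel" "block \<beta> n j \<subseteq> {0..<\<beta>}" if "j < n" for j
    using block_borel[OF \<beta> n] block_subset[OF \<beta> n that] by auto
  have indep: "\<forall>(B :: nat \<Rightarrow> real set) m. (\<forall>i<m. B i \<in> sets borel \<and> B i \<subseteq> {0..<\<beta>}) \<and> disjoint_family_on B {..<m}
    \<longrightarrow> indep_vars (\<lambda>_. count_space UNIV) (\<lambda>i S. card (S \<inter> B i)) {..<m}"
    using P unfolding poisson_law_def by (elim conjE)
  have "indep_vars (\<lambda>_. count_space UNIV) (\<lambda>i S. card (S \<inter> block \<beta> n i)) {..<n}"
    by (rule indep[rule_format]) (use bl block_disjoint[OF \<beta> n] in simp)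
  then have "prob (\<Inter>i\<in>{..<n}. (\<lambda>S. card (S \<inter> block \<beta> n i)) -` {c. (-1) ^ c = u i * u (Suc i mod n)} \<inter> space P)
      = (\<Prod>i<n. prob ((\<lambda>S. card (S \<inter> block \<beta> n i)) -` {c. (-1) ^ c = u i * u (Suc i mod n)} \<inter> space P))"
    by (rule indep_varsD_finite) (use n in \<open>auto simp: lessThan_empty_iff\<close>)
  also have "(\<Inter>i\<in>{..<n}. (\<lambda>S. card (S \<inter> block \<beta> n i)) -` {c. (-1) ^ c = u i * u (Suc i mod n)} \<inter> space P)
      = {S \<in> space P. \<forall>j<n. sgn_card (S \<inter> block \<beta> n j) = u j * u (Suc j mod n)}"
    using n by (auto simp: sgn_card_def lessThan_empty_iff)
  also have "(\<Prod>i<n. prob ((\<lambda>S. card (S \<inter> block \<beta> n i)) -` {c. (-1) ^ c = u i * u (Suc i mod n)} \<inter> space P))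
      = ring_weight n (exp (- 2 * (\<delta> * (\<beta> / real n)))) u"
    unfolding ring_weight_def
  proof (rule prod.cong[OF refl])
    fix i assume "i \<in> {..<n}"
    then have i: "i < n" "Suc i mod n < n" by auto
    have c: "u i * u (Suc i mod n) = -1 \<or> u i * u (Suc i mod n) = 1"
      using rings_spin[OF u i(1)] rings_spin[OF u i(2)] by auto
    have "(\<lambda>S. card (S \<inter> block \<beta> n i)) -` {c. (-1) ^ c = u i * u (Suc i mod n)} \<inter> space P
      = {S \<in> space P. sgn_card (S \<inter> block \<beta> n i) = u i * u (Suc i mod n)}"
      by (auto simp: sgn_card_def)
    then show "prob ((\<lambda>S. card (S \<inter> block \<beta> n i)) -` {c. (-1) ^ c = u i * u (Suc i mod n)} \<inter> space P)
      = flip_kernel (exp (- 2 * (\<delta> * (\<beta> / real n)))) (u i) (u (Suc i mod n))"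
      using poisson_parity[OF P bl[OF i(1)] c] block_measure[OF \<beta> n i(1)] by (simp add: flip_kernel_def)
  qed
  finally have prod: "prob {S \<in> space P. \<forall>j<n. sgn_card (S \<inter> block \<beta> n j) = u j * u (Suc j mod n)}
    = ring_weight n (exp (- 2 * (\<delta> * (\<beta> / real n)))) u" .
  have "prob (E \<inter> sample_event \<beta> n u 0) + prob (E \<inter> sample_event \<beta> n u 1)
    = prob ((E \<inter> sample_event \<beta> n u 0) \<union> (E \<inter> sample_event \<beta> n u 1))"
    by (rule finite_measure_Union[symmetric]) (use Es SE disj in auto)
  then show ?thesis unfolding me add_divide_distrib[symmetric] cup prod PE[symmetric] by simp
qed

subsection \<open>All sites\<close>

locale space_time_spins = prob_space M for M :: "'w measure" +
  fixes d N :: nat and \<delta> \<beta> :: real and D :: "vertex \<Rightarrow> 'w \<Rightarrow> real set" and \<xi> :: "vertex \<Rightarrow> 'w \<Rightarrow> nat"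
  assumes N: "N \<ge> 1" and \<delta>: "\<delta> > 0" and \<beta>: "\<beta> > 0"
    and D_indep: "indep_vars (\<lambda>_. configs \<beta>) D (torus d N)"
    and D_law: "\<forall>x\<in>torus d N. even_poisson_law \<delta> \<beta> (distr M (configs \<beta>) (D x))"
    and \<xi>_indep: "indep_vars (\<lambda>_. count_space UNIV) \<xi> (torus d N)"
    and \<xi>_law: "\<forall>x\<in>torus d N. distr M (count_space UNIV) (\<xi> x) = measure_pmf (pmf_of_set {0, 1})"
    and D_\<xi>_indep: "indep_set
           (sets (vimage_algebra (space M) (\<lambda>\<omega>. \<lambda>x\<in>torus d N. D x \<omega>)
              (\<Pi>\<^sub>M x\<in>torus d N. configs \<beta>)))
           (sets (vimage_algebra (space M) (\<lambda>\<omega>. \<lambda>x\<in>torus d N. \<xi> x \<omega>)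
              (\<Pi>\<^sub>M x\<in>torus d N. count_space UNIV)))"
begin

definition \<sigma> :: "'w \<Rightarrow> spin_config" where
  "\<sigma> \<omega> = spin (\<lambda>x. D x \<omega>) (\<lambda>x. \<xi> x \<omega>)"

definition sample :: "nat \<Rightarrow> 'w \<Rightarrow> vertex \<Rightarrow> nat \<Rightarrow> real" where
  "sample n \<omega> = (\<lambda>x\<in>torus d N. \<lambda>j\<in>{..<n}. \<sigma> \<omega> x (grid \<beta> n j))"

lemma torus_nonempty: "torus d N \<noteq> {}"
  using N by (auto simp: torus_def PiE_eq_empty_iff)

lemma D_measurable: "x \<in> torus d N \<Longrightarrow> D x \<in> measurable M (configs \<beta>)"
  using D_indep by (auto simp: indep_vars_def)

lemma \<xi>_measurable: "x \<in> torus d N \<Longrightarrow> \<xi> x \<in> measurable M (count_space UNIV)"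
  using \<xi>_indep by (auto simp: indep_vars_def)

lemma \<sigma>_cases: "\<sigma> \<omega> x t = -1 \<or> \<sigma> \<omega> x t = 1"
proof -
  have "(-1 :: real) ^ m = -1 \<or> (-1 :: real) ^ m = 1" for m by (cases "even m") auto
  then show ?thesis by (simp add: \<sigma>_def spin_def)
qed

lemma sample_conf: "sample n \<omega> \<in> conf d N n"
  unfolding conf_def rings_def sample_def restrict_PiE_iff using \<sigma>_cases by blast

text \<open>Only the parity of \<open>\<xi>\<close> matters. Using it in place of the value lets these events cover the whole space,
and no null set has to be removed.\<close>

definition pattern_event :: "nat \<Rightarrow> (vertex \<Rightarrow> nat \<Rightarrow> real) \<Rightarrow> (vertex \<Rightarrow> nat) \<Rightarrow> 'w set" where
  "pattern_event n s z = {\<omega> \<in> space M. \<forall>x\<in>torus d N. \<xi> x \<omega> mod 2 = z x \<and> D x \<omega> \<in> sample_event \<beta> n (s x) (z x)}"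

lemma sample_eq_iff:
  assumes s: "s \<in> conf d N n"
  shows "{\<omega> \<in> space M. sample n \<omega> = s} = (\<Union>z\<in>torus d N \<rightarrow>\<^sub>E {0, 1}. pattern_event n s z)"
proof -
  have eq: "sample n \<omega> = s \<longleftrightarrow> (\<forall>x\<in>torus d N. \<forall>j<n. \<sigma> \<omega> x (grid \<beta> n j) = s x j)" for \<omega>
  proof
    assume "sample n \<omega> = s"
    then show "\<forall>x\<in>torus d N. \<forall>j<n. \<sigma> \<omega> x (grid \<beta> n j) = s x j" by (auto simp: sample_def)
  next
    assume R: "\<forall>x\<in>torus d N. \<forall>j<n. \<sigma> \<omega> x (grid \<beta> n j) = s x j"
    show "sample n \<omega> = s"
    proof (rule PiE_ext[OF sample_conf[unfolded conf_def] s[unfolded conf_def]])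
      fix x assume x: "x \<in> torus d N"
      show "sample n \<omega> x = s x"
        by (rule PiE_ext[OF conf_ring[OF sample_conf x, unfolded rings_def] conf_ring[OF s x, unfolded rings_def]])
          (use R x in \<open>simp add: sample_def\<close>)
    qed
  qed
  have par: "(-1 :: real) ^ (a + b) = (-1) ^ (a mod 2 + b)" for a b :: nat
    by (cases "even a") (auto simp: power_add odd_iff_mod_2_eq_one)
  have sp: "\<sigma> \<omega> x t = (-1) ^ (\<xi> x \<omega> mod 2 + card (D x \<omega> \<inter> {0..t}))" for \<omega> x t
    unfolding \<sigma>_def spin_def by (rule par)
  have Dsp: "D x \<omega> \<in> space (configs \<beta>)" if "x \<in> torus d N" "\<omega> \<in> space M" for x \<omega>
    using measurable_space[OF D_measurable] that by blast
  show ?thesis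
  proof (intro equalityI subsetI)
    fix \<omega> assume w: "\<omega> \<in> {\<omega> \<in> space M. sample n \<omega> = s}"
    define z where "z = (\<lambda>x\<in>torus d N. \<xi> x \<omega> mod 2)"
    have "z \<in> torus d N \<rightarrow>\<^sub>E {0, 1}" unfolding z_def restrict_PiE_iff by auto
    moreover have "\<omega> \<in> pattern_event n s z"
      using w Dsp unfolding pattern_event_def z_def sample_event_def eq sp by simp
    ultimately show "\<omega> \<in> (\<Union>z\<in>torus d N \<rightarrow>\<^sub>E {0, 1}. pattern_event n s z)" by blast
  next
    fix \<omega> assume "\<omega> \<in> (\<Union>z\<in>torus d N \<rightarrow>\<^sub>E {0, 1}. pattern_event n s z)"
    then show "\<omega> \<in> {\<omega> \<in> space M. sample n \<omega> = s}"
      unfolding eq sp by (auto simp: pattern_event_def sample_event_def)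
  qed
qed

lemma pattern_event_prob:
  assumes n: "1 \<le> n" and z: "z \<in> torus d N \<rightarrow>\<^sub>E {0, 1}"
  shows "pattern_event n s z \<in> events"
    "prob (pattern_event n s z) = (\<Prod>x\<in>torus d N. 1 / 2 * measure (distr M (configs \<beta>) (D x)) (sample_event \<beta> n (s x) (z x)))"
proof -
  let ?V = "torus d N"
  define A where "A x = sample_event \<beta> n (s x) (z x)" for x
  define B where "B x = {k::nat. k mod 2 = z x}" for x
  have A: "A x \<in> sets (configs \<beta>)" for x unfolding A_def by (rule sample_event_sets[OF \<beta> n])
  define evD where "evD = (\<lambda>\<omega>. \<lambda>x\<in>?V. D x \<omega>) -` (\<Pi>\<^sub>E x\<in>?V. A x) \<inter> space M"
  define evX where "evX = (\<lambda>\<omega>. \<lambda>x\<in>?V. \<xi> x \<omega>) -` (\<Pi>\<^sub>E x\<in>?V. B x) \<inter> space M"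
  have evDs: "evD \<in> sets (vimage_algebra (space M) (\<lambda>\<omega>. \<lambda>x\<in>?V. D x \<omega>) (\<Pi>\<^sub>M x\<in>?V. configs \<beta>))"
    unfolding evD_def by (intro in_vimage_algebra sets_PiM_I_finite finite_torus A)
  have evXs: "evX \<in> sets (vimage_algebra (space M) (\<lambda>\<omega>. \<lambda>x\<in>?V. \<xi> x \<omega>) (\<Pi>\<^sub>M x\<in>?V. count_space UNIV))"
    unfolding evX_def by (intro in_vimage_algebra sets_PiM_I_finite finite_torus) simp
  have evD: "evD = (\<Inter>x\<in>?V. D x -` A x \<inter> space M)"
    using torus_nonempty by (auto simp: evD_def restrict_PiE_iff)
  have evX: "evX = (\<Inter>x\<in>?V. \<xi> x -` B x \<inter> space M)"
    using torus_nonempty by (auto simp: evX_def restrict_PiE_iff)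
  have pe: "pattern_event n s z = evD \<inter> evX"
    using torus_nonempty by (auto simp: evD evX pattern_event_def A_def B_def)
  have ev: "evD \<in> events" "evX \<in> events"
    using indep_setD_ev1[OF D_\<xi>_indep] indep_setD_ev2[OF D_\<xi>_indep] evDs evXs by auto
  then show "pattern_event n s z \<in> events" unfolding pe by blast
  have "prob evD = (\<Prod>x\<in>?V. prob (D x -` A x \<inter> space M))"
    unfolding evD by (rule indep_varsD_finite[OF D_indep torus_nonempty finite_torus A])
  also have "\<dots> = (\<Prod>x\<in>?V. measure (distr M (configs \<beta>) (D x)) (A x))"
    by (intro prod.cong refl measure_distr[symmetric] D_measurable A)
  finally have pD: "prob evD = \<dots>" .
  have "prob evX = (\<Prod>x\<in>?V. prob (\<xi> x -` B x \<inter> space M))"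
    unfolding evX by (rule indep_varsD_finite[OF \<xi>_indep torus_nonempty finite_torus]) simp
  also have "\<dots> = (\<Prod>x\<in>?V. 1 / 2)"
  proof (rule prod.cong[OF refl])
    fix x assume x: "x \<in> ?V"
    have zx: "z x = 0 \<or> z x = 1" using PiE_mem[OF z x] by simp
    have "prob (\<xi> x -` B x \<inter> space M) = measure (distr M (count_space UNIV) (\<xi> x)) (B x)"
      by (rule measure_distr[symmetric, OF \<xi>_measurable[OF x]]) simp
    also have "\<dots> = measure (measure_pmf (pmf_of_set {0, 1})) (B x)" using \<xi>_law x by simp
    also have "\<dots> = real (card ({0, 1} \<inter> B x)) / real (card {0, 1::nat})"
      by (rule measure_pmf_of_set) auto
    also have "{0, 1} \<inter> B x = {z x}" using zx by (auto simp: B_def)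
    finally show "prob (\<xi> x -` B x \<inter> space M) = 1 / 2" by simp
  qed
  finally have pX: "prob evX = (\<Prod>x\<in>?V. 1 / 2)" .
  have "prob (pattern_event n s z) = prob evD * prob evX"
    unfolding pe by (rule indep_setD[OF D_\<xi>_indep evDs evXs])
  then show "prob (pattern_event n s z) = (\<Prod>x\<in>?V. 1 / 2 * measure (distr M (configs \<beta>) (D x)) (sample_event \<beta> n (s x) (z x)))"
    unfolding pD pX prod.distrib A_def by (simp only: mult.commute)
qed

definition flip_rate :: "nat \<Rightarrow> real" where
  "flip_rate n = exp (- 2 * (\<delta> * (\<beta> / real n)))"

definition norm_const :: real where
  "norm_const = (1 / 2 / flip_kernel (exp (- 2 * (\<delta> * \<beta>))) 1 1) ^ card (torus d N)"

text \<open>Sum over the patterns of initial signs. Given the pattern, everything is independent over the sites, so the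
sum of products is a product of sums, to each factor of which \<open>even_poisson_sample\<close> applies.\<close>

lemma sample_law:
  assumes n: "1 \<le> n" and s: "s \<in> conf d N n"
  shows "{\<omega> \<in> space M. sample n \<omega> = s} \<in> events"
    "prob {\<omega> \<in> space M. sample n \<omega> = s} = norm_const * (\<Prod>x\<in>torus d N. ring_weight n (flip_rate n) (s x))"
proof -
  let ?V = "torus d N"
  let ?m = "\<lambda>x z. 1 / 2 * measure (distr M (configs \<beta>) (D x)) (sample_event \<beta> n (s x) z)"
  have fin: "finite (?V \<rightarrow>\<^sub>E {0, 1::nat})" by (simp add: finite_PiE finite_torus)
  note pep = pattern_event_prob[OF n]
  show "{\<omega> \<in> space M. sample n \<omega> = s} \<in> events"
    unfolding sample_eq_iff[OF s] using fin pep(1) by blast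
  have disj: "disjoint_family_on (pattern_event n s) (?V \<rightarrow>\<^sub>E {0, 1})"
    unfolding disjoint_family_on_def
  proof (intro ballI impI)
    fix z z' assume z: "z \<in> ?V \<rightarrow>\<^sub>E {0, 1::nat}" "z' \<in> ?V \<rightarrow>\<^sub>E {0, 1}" "z \<noteq> z'"
    then obtain x where "x \<in> ?V" "z x \<noteq> z' x" using PiE_ext by blast
    then show "pattern_event n s z \<inter> pattern_event n s z' = {}" by (auto simp: pattern_event_def)
  qed
  have "prob {\<omega> \<in> space M. sample n \<omega> = s} = (\<Sum>z\<in>?V \<rightarrow>\<^sub>E {0, 1}. prob (pattern_event n s z))"
    unfolding sample_eq_iff[OF s] by (rule finite_measure_finite_Union) (use fin pep(1) disj in auto)
  also have "\<dots> = (\<Sum>z\<in>?V \<rightarrow>\<^sub>E {0, 1}. \<Prod>x\<in>?V. ?m x (z x))" by (intro sum.cong refl pep(2))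
  also have "\<dots> = (\<Prod>x\<in>?V. \<Sum>z\<in>{0, 1}. ?m x z)" by (rule prod_sum_PiE[symmetric]) (simp_all add: finite_torus)
  also have "\<dots> = (\<Prod>x\<in>?V. 1 / 2 / flip_kernel (exp (- 2 * (\<delta> * \<beta>))) 1 1 * ring_weight n (flip_rate n) (s x))"
  proof (rule prod.cong[OF refl])
    fix x assume x: "x \<in> ?V"
    have "(\<Sum>z\<in>{0, 1}. ?m x z) = 1 / 2 * (measure (distr M (configs \<beta>) (D x)) (sample_event \<beta> n (s x) 0)
        + measure (distr M (configs \<beta>) (D x)) (sample_event \<beta> n (s x) 1))" by simp
    also have "\<dots> = 1 / 2 * (ring_weight n (flip_rate n) (s x) / flip_kernel (exp (- 2 * (\<delta> * \<beta>))) 1 1)"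
      unfolding flip_rate_def using even_poisson_sample[OF _ \<beta> n conf_ring[OF s x]] D_law x by simp
    finally show "(\<Sum>z\<in>{0, 1}. ?m x z) = 1 / 2 / flip_kernel (exp (- 2 * (\<delta> * \<beta>))) 1 1 * ring_weight n (flip_rate n) (s x)"
      by simp
  qed
  also have "\<dots> = norm_const * (\<Prod>x\<in>?V. ring_weight n (flip_rate n) (s x))"
    unfolding prod.distrib norm_const_def by simp
  finally show "prob {\<omega> \<in> space M. sample n \<omega> = s} = norm_const * (\<Prod>x\<in>?V. ring_weight n (flip_rate n) (s x))" .
qed

lemma norm_const_pos: "0 < norm_const"
  by (simp add: norm_const_def flip_kernel_def add_pos_pos)

lemma sample_expectation:
  fixes \<Phi> :: "(vertex \<Rightarrow> nat \<Rightarrow> real) \<Rightarrow> real"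
  assumes n: "1 \<le> n"
  shows "(\<lambda>\<omega>. \<Phi> (sample n \<omega>)) \<in> borel_measurable M"
    "(LINT \<omega>|M. \<Phi> (sample n \<omega>)) = norm_const * (\<Sum>s\<in>conf d N n. \<Phi> s * (\<Prod>x\<in>torus d N. ring_weight n (flip_rate n) (s x)))"
proof -
  define A where "A s = {\<omega> \<in> space M. sample n \<omega> = s}" for s
  have A: "A s \<in> events" if "s \<in> conf d N n" for s unfolding A_def by (rule sample_law(1)[OF n that])
  have eq: "\<Phi> (sample n \<omega>) = (\<Sum>s\<in>conf d N n. \<Phi> s * indicator (A s) \<omega>)" if "\<omega> \<in> space M" for \<omega>
  proof -
    have "(\<Sum>s\<in>conf d N n. \<Phi> s * indicator (A s) \<omega>) = (\<Sum>s\<in>conf d N n. if s = sample n \<omega> then \<Phi> s else 0)"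
      using that by (intro sum.cong refl) (auto simp: A_def)
    then show ?thesis by (simp add: finite_conf sample_conf)
  qed
  have m: "(\<lambda>\<omega>. \<Sum>s\<in>conf d N n. \<Phi> s * indicator (A s) \<omega>) \<in> borel_measurable M"
    using A by (intro borel_measurable_sum borel_measurable_times borel_measurable_indicator) auto
  show "(\<lambda>\<omega>. \<Phi> (sample n \<omega>)) \<in> borel_measurable M"
    using m by (subst measurable_cong[OF eq]) auto
  have "(LINT \<omega>|M. \<Phi> (sample n \<omega>)) = (LINT \<omega>|M. (\<Sum>s\<in>conf d N n. \<Phi> s * indicator (A s) \<omega>))"
    by (rule Bochner_Integration.integral_cong[OF refl eq])
  also have "\<dots> = (\<Sum>s\<in>conf d N n. LINT \<omega>|M. \<Phi> s * indicator (A s) \<omega>)"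
    using A by (intro Bochner_Integration.integral_sum) (auto intro!: integrable_mult_right integrable_real_indicator simp: emeasure_eq_measure)
  also have "\<dots> = (\<Sum>s\<in>conf d N n. \<Phi> s * prob (A s))"
    using A by (intro sum.cong refl) simp
  also have "\<dots> = norm_const * (\<Sum>s\<in>conf d N n. \<Phi> s * (\<Prod>x\<in>torus d N. ring_weight n (flip_rate n) (s x)))"
    unfolding sum_distrib_left A_def by (intro sum.cong refl) (simp add: sample_law(2)[OF n])
  finally show "(LINT \<omega>|M. \<Phi> (sample n \<omega>)) = \<dots>" .
qed

end

section \<open>Sampling from the right\<close>

text \<open>The index of the first sampling time after \<open>t\<close>, counted around the circle.\<close>

definition next_index :: "real \<Rightarrow> nat \<Rightarrow> real \<Rightarrow> nat" where
  "next_index \<beta> n t = Suc (nat \<lfloor>real n * t / \<beta>\<rfloor>) mod n"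

lemma grid_cell:
  assumes \<beta>: "0 < \<beta>" and n: "1 \<le> n" and t: "t \<in> {0..<\<beta>}"
  shows "nat \<lfloor>real n * t / \<beta>\<rfloor> < n" "t \<in> {grid \<beta> n j..<grid \<beta> n (Suc j)} \<longleftrightarrow> j = nat \<lfloor>real n * t / \<beta>\<rfloor>"
proof -
  define r where "r = real n * t / \<beta>"
  have r: "0 \<le> r" "r < real n" using assms by (simp_all add: r_def field_simps)
  then show "nat \<lfloor>real n * t / \<beta>\<rfloor> < n" unfolding r_def[symmetric] by (simp add: nat_less_iff floor_less_iff)
  have "t \<in> {grid \<beta> n j..<grid \<beta> n (Suc j)} \<longleftrightarrow> real j \<le> r \<and> r < real j + 1"
    using \<beta> n by (simp add: grid_def r_def field_simps)
  also have "\<dots> \<longleftrightarrow> \<lfloor>r\<rfloor> = int j" by (simp add: floor_eq_iff)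
  also have "\<dots> \<longleftrightarrow> j = nat \<lfloor>r\<rfloor>" using r by auto
  finally show "t \<in> {grid \<beta> n j..<grid \<beta> n (Suc j)} \<longleftrightarrow> j = nat \<lfloor>real n * t / \<beta>\<rfloor>" unfolding r_def .
qed

lemma next_index_less: "1 \<le> n \<Longrightarrow> next_index \<beta> n t < n"
  by (simp add: next_index_def)

lemma eventually_next_index:
  assumes \<beta>: "0 < \<beta>" and t: "t \<in> {0..<\<beta>}" and u: "t < u"
  shows "\<forall>\<^sub>F n in sequentially. t < grid \<beta> n (next_index \<beta> n t) \<and> grid \<beta> n (next_index \<beta> n t) < u"
proof -
  have "(\<lambda>n. \<beta> / real n) \<longlonglongrightarrow> 0" by real_asymp
  then have "\<forall>\<^sub>F n in sequentially. \<beta> / real n < min (u - t) (\<beta> - t)"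
    by (rule order_tendstoD(2)) (use t u in auto)
  then show ?thesis using eventually_ge_at_top[of 1]
  proof eventually_elim
    case (elim n)
    define j where "j = nat \<lfloor>real n * t / \<beta>\<rfloor>"
    have j: "j < n" "grid \<beta> n j \<le> t" "t < grid \<beta> n (Suc j)"
      using grid_cell(1)[OF \<beta> elim(2) t] grid_cell(2)[OF \<beta> elim(2) t, of j] by (auto simp: j_def)
    have "grid \<beta> n (Suc j) = grid \<beta> n j + \<beta> / real n"
      by (simp add: grid_def add_divide_distrib algebra_simps)
    then have lt: "grid \<beta> n (Suc j) < u" "grid \<beta> n (Suc j) < \<beta>" using j elim(1) by auto
    have "Suc j < n"
    proof (rule ccontr)
      assume "\<not> Suc j < n"
      then have "Suc j = n" using j by simp
      then show False using lt(2) grid_n[OF \<beta> elim(2)] by simp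
    qed
    then have "next_index \<beta> n t = Suc j" by (simp add: next_index_def j_def)
    then show ?case using j lt by simp
  qed
qed

lemma next_index_tendsto:
  assumes \<beta>: "0 < \<beta>" and t: "t \<in> {0..<\<beta>}"
  shows "(\<lambda>n. grid \<beta> n (next_index \<beta> n t)) \<longlonglongrightarrow> t"
proof (rule order_tendstoI)
  fix a assume "a < t"
  have "t < t + 1" by simp
  from eventually_next_index[OF \<beta> t this]
  show "\<forall>\<^sub>F n in sequentially. a < grid \<beta> n (next_index \<beta> n t)"
    by eventually_elim (use \<open>a < t\<close> in auto)
next
  fix a assume "t < a"
  from eventually_next_index[OF \<beta> t this]
  show "\<forall>\<^sub>F n in sequentially. grid \<beta> n (next_index \<beta> n t) < a"
    by eventually_elim auto
qed

text \<open>Dominated convergence for the step functions that take on each cell the value at its right end. The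
function \<open>F\<close> is measurable as a limit of these step functions.\<close>

lemma Riemann_sum_limit:
  fixes f :: "nat \<Rightarrow> nat \<Rightarrow> 'b::{banach, second_countable_topology}"
  assumes \<beta>: "0 < \<beta>" and bound: "\<And>n j. j < n \<Longrightarrow> norm (f n j) \<le> C"
    and lim: "\<And>t. t \<in> {0..<\<beta>} \<Longrightarrow> (\<lambda>n. f n (next_index \<beta> n t)) \<longlonglongrightarrow> F t"
  shows "(\<lambda>n. (\<beta> / real n) *\<^sub>R (\<Sum>j<n. f n j)) \<longlonglongrightarrow> (LINT t:{0..<\<beta>}|lborel. F t)"
proof -
  define g where "g n t = (\<Sum>j<n. indicator {grid \<beta> n j..<grid \<beta> n (Suc j)} t *\<^sub>R f n (Suc j mod n))" for n and t :: real
  have g_eq: "g n t = indicator {0..<\<beta>} t *\<^sub>R f n (next_index \<beta> n t)" if n: "1 \<le> n" for n t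
  proof (cases "t \<in> {0..<\<beta>}")
    case True
    define j0 where "j0 = nat \<lfloor>real n * t / \<beta>\<rfloor>"
    have j0: "j0 < n" using grid_cell(1)[OF \<beta> n True] by (simp add: j0_def)
    have "(indicator {grid \<beta> n j..<grid \<beta> n (Suc j)} t :: real) = of_bool (j = j0)" for j
      unfolding indicator_def grid_cell(2)[OF \<beta> n True] j0_def by simp
    then have "g n t = (\<Sum>j<n. if j = j0 then f n (Suc j mod n) else 0)"
      unfolding g_def by (intro sum.cong refl) simp
    then show ?thesis using True j0 by (simp add: next_index_def j0_def)
  next
    case False
    have "t \<notin> {grid \<beta> n j..<grid \<beta> n (Suc j)}" if "j < n" for j
      using False grid_nonneg[OF \<beta> n, of j] grid_mono[OF \<beta> n, of "Suc j" n] grid_n[OF \<beta> n] that by auto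
    then show ?thesis using False by (simp add: g_def)
  qed
  have g_int: "(LINT t|lborel. g n t) = (\<beta> / real n) *\<^sub>R (\<Sum>j<n. f n j)" if n: "1 \<le> n" for n
  proof -
    have cell: "measure lborel {grid \<beta> n j..<grid \<beta> n (Suc j)} = \<beta> / real n" for j
      using grid_mono[OF \<beta> n, of j "Suc j"] by (simp, simp add: grid_def add_divide_distrib algebra_simps)
    have "(LINT t|lborel. g n t) = (\<Sum>j<n. LINT t|lborel. indicator {grid \<beta> n j..<grid \<beta> n (Suc j)} t *\<^sub>R f n (Suc j mod n))"
      unfolding g_def by (rule Bochner_Integration.integral_sum) (use grid_mono[OF \<beta> n, of _ "Suc _"] in \<open>auto intro!: integrable_scaleR_left integrable_real_indicator\<close>)
    also have "\<dots> = (\<Sum>j<n. (\<beta> / real n) *\<^sub>R f n (Suc j mod n))"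
    proof (intro sum.cong refl)
      fix j
      let ?A = "{grid \<beta> n j..<grid \<beta> n (Suc j)}"
      have "integrable lborel (indicat_real ?A)"
        using grid_mono[OF \<beta> n, of j "Suc j"] by (intro integrable_real_indicator) auto
      then have "(LINT t|lborel. indicat_real ?A t *\<^sub>R f n (Suc j mod n)) = (LINT t|lborel. indicat_real ?A t) *\<^sub>R f n (Suc j mod n)"
        by (rule integral_scaleR_left)
      also have "(LINT t|lborel. indicat_real ?A t) = \<beta> / real n"
        using cell[of j] by simp
      finally show "(LINT t|lborel. indicat_real ?A t *\<^sub>R f n (Suc j mod n)) = (\<beta> / real n) *\<^sub>R f n (Suc j mod n)" .
    qed
    also have "\<dots> = (\<beta> / real n) *\<^sub>R (\<Sum>j<n. f n (Suc j mod n))" by (simp add: scaleR_right.sum)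
    also have "(\<Sum>j<n. f n (Suc j mod n)) = (\<Sum>j<n. f n j)"
    proof (cases n)
      case (Suc m)
      have "(\<Sum>j<Suc m. f n (Suc j mod Suc m)) = (\<Sum>j<m. f n (Suc j)) + f n 0" by simp
      also have "\<dots> = (\<Sum>j<Suc m. f n j)" by (simp only: sum.lessThan_Suc_shift add.commute)
      finally show ?thesis using Suc by simp
    qed simp
    finally show ?thesis .
  qed
  have meas: "g n \<in> borel_measurable lborel" for n unfolding g_def by measurable
  have C: "0 \<le> C" using bound[of 0 1] norm_ge_zero[of "f 1 0"] by linarith
  have glim: "(\<lambda>n. g (Suc n) t) \<longlonglongrightarrow> indicator {0..<\<beta>} t *\<^sub>R F t" for t
  proof -
    have "(\<lambda>n. f (Suc n) (next_index \<beta> (Suc n) t)) \<longlonglongrightarrow> F t" if "t \<in> {0..<\<beta>}"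
      using LIMSEQ_Suc[OF lim[OF that]] .
    then show ?thesis by (cases "t \<in> {0..<\<beta>}") (simp_all add: g_eq)
  qed
  have "(\<lambda>n. LINT t|lborel. g (Suc n) t) \<longlonglongrightarrow> (LINT t|lborel. indicator {0..<\<beta>} t *\<^sub>R F t)"
  proof (rule integral_dominated_convergence[where w = "\<lambda>t. indicator {0..<\<beta>} t * C"])
    show "(\<lambda>t. indicator {0..<\<beta>} t *\<^sub>R F t) \<in> borel_measurable lborel"
      by (rule borel_measurable_LIMSEQ_metric[OF meas glim])
    show "integrable lborel (\<lambda>t. indicator {0..<\<beta>} t * C)" 
      using \<beta> by (intro integrable_mult_left integrable_real_indicator) simp_all
    show "AE t in lborel. norm (g (Suc n) t) \<le> indicator {0..<\<beta>} t * C" for n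
      using bound[OF next_index_less] C by (intro AE_I2) (simp add: g_eq indicator_def)
  qed (use meas glim in auto)
  then have "(\<lambda>n. (\<beta> / real (Suc n)) *\<^sub>R (\<Sum>j<Suc n. f (Suc n) j)) \<longlonglongrightarrow> (LINT t:{0..<\<beta>}|lborel. F t)"
    unfolding set_lebesgue_integral_def by (subst (asm) g_int) simp_all
  then show ?thesis by (rule LIMSEQ_imp_Suc)
qed

section \<open>The continuum limit\<close>

lemma (in prob_space) bounded_convergence:
  fixes X :: "nat \<Rightarrow> 'a \<Rightarrow> real"
  assumes meas: "\<And>m. X m \<in> borel_measurable M"
    and bound: "\<And>m \<omega>. \<omega> \<in> space M \<Longrightarrow> \<bar>X m \<omega>\<bar> \<le> C"
    and lim: "\<And>\<omega>. \<omega> \<in> space M \<Longrightarrow> (\<lambda>m. X m \<omega>) \<longlonglongrightarrow> Y \<omega>"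
  shows "(\<lambda>m. LINT \<omega>|M. X m \<omega>) \<longlonglongrightarrow> (LINT \<omega>|M. Y \<omega>)"
proof (rule integral_dominated_convergence[where w = "\<lambda>_. C"])
  show "Y \<in> borel_measurable M" by (rule borel_measurable_LIMSEQ_metric[OF meas lim])
qed (use meas bound lim in auto)

context space_time_spins
begin

definition mean_coupling :: "nat \<Rightarrow> 'w \<Rightarrow> real" where
  "mean_coupling n \<omega> = \<beta> / real n * coupling d N n (sample n \<omega>)"

definition coupling_bound :: real where
  "coupling_bound = \<beta> * (\<Sum>x\<in>torus d N. \<Sum>y\<in>torus d N. real (bond d N x y)) / 2"

lemma \<sigma>_abs: "\<bar>\<sigma> \<omega> x t\<bar> = 1"
  using \<sigma>_cases[of \<omega> x t] by auto

lemma mean_coupling_eq: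
  "mean_coupling n \<omega> = (\<Sum>e\<in>edges d N. real (edge_mult N) * (\<beta> / real n * (\<Sum>j<n. \<Prod>z\<in>e. \<sigma> \<omega> z (grid \<beta> n j))))"
proof -
  let ?V = "torus d N"
  define g where "g e = (\<Sum>j<n. \<Prod>z\<in>e. \<sigma> \<omega> z (grid \<beta> n j))" for e
  have "real (bond d N x y) * (\<Sum>j<n. sample n \<omega> x j * sample n \<omega> y j) = real (bond d N x y) * g {x, y}"
    if xy: "x \<in> ?V" "y \<in> ?V" for x y
  proof (cases "bond d N x y = 0")
    case False
    then have "x \<noteq> y" using adjacent_neq[OF xy] bond_eq[OF xy N] by (auto split: if_splits)
    then show ?thesis using xy by (simp add: g_def sample_def)
  qed simp
  then have "coupling d N n (sample n \<omega>) = (\<Sum>x\<in>?V. \<Sum>y\<in>?V. real (bond d N x y) * g {x, y}) / 2"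
    unfolding coupling_def by (intro arg_cong[where f = "\<lambda>r. r / 2"] sum.cong refl)
  also have "\<dots> = (\<Sum>e\<in>edges d N. real (edge_mult N) * g e)"
    unfolding sum_edges[OF N] by simp
  finally show ?thesis by (simp add: mean_coupling_def g_def sum_distrib_left mult_ac)
qed

lemma mean_coupling_bound: "\<bar>mean_coupling n \<omega>\<bar> \<le> coupling_bound"
proof (cases "n = 0")
  case True
  then show ?thesis using \<beta> by (simp add: mean_coupling_def coupling_bound_def sum_nonneg)
next
  case False
  let ?V = "torus d N"
  have "\<bar>\<Sum>j<n. sample n \<omega> x j * sample n \<omega> y j\<bar> \<le> real n" if "x \<in> ?V" "y \<in> ?V" for x y
  proof -
    have "\<bar>\<Sum>j<n. sample n \<omega> x j * sample n \<omega> y j\<bar> \<le> (\<Sum>j<n. \<bar>sample n \<omega> x j * sample n \<omega> y j\<bar>)" by (rule sum_abs)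
    also have "\<dots> = real n" using that by (simp add: sample_def abs_mult \<sigma>_abs)
    finally show ?thesis .
  qed
  then have "\<bar>real (bond d N x y) * (\<Sum>j<n. sample n \<omega> x j * sample n \<omega> y j)\<bar> \<le> real (bond d N x y) * real n"
    if "x \<in> ?V" "y \<in> ?V" for x y using that by (simp add: abs_mult mult_left_mono)
  then have "\<bar>\<Sum>x\<in>?V. \<Sum>y\<in>?V. real (bond d N x y) * (\<Sum>j<n. sample n \<omega> x j * sample n \<omega> y j)\<bar>
     \<le> (\<Sum>x\<in>?V. \<Sum>y\<in>?V. real (bond d N x y) * real n)"
    by (intro order_trans[OF sum_abs] sum_mono)
  then have "\<bar>coupling d N n (sample n \<omega>)\<bar> \<le> real n * (\<Sum>x\<in>?V. \<Sum>y\<in>?V. real (bond d N x y)) / 2"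
    unfolding coupling_def by (simp add: sum_distrib_left sum_distrib_right mult_ac)
  then have "\<beta> / real n * \<bar>coupling d N n (sample n \<omega>)\<bar> \<le> \<beta> / real n * (real n * (\<Sum>x\<in>?V. \<Sum>y\<in>?V. real (bond d N x y)) / 2)"
    using \<beta> by (intro mult_left_mono) auto
  then show ?thesis using \<beta> False by (simp add: mean_coupling_def coupling_bound_def abs_mult)
qed

text \<open>There are finitely many points, hence none shortly after \<open>t\<close>.\<close>

lemma \<sigma>_right_limit:
  assumes \<omega>: "\<omega> \<in> space M" and x: "x \<in> torus d N" and t: "t \<in> {0..<\<beta>}"
  shows "\<forall>\<^sub>F n in sequentially. \<sigma> \<omega> x (grid \<beta> n (next_index \<beta> n t)) = \<sigma> \<omega> x t"
proof -
  have "D x \<omega> \<in> space (configs \<beta>)" by (rule measurable_space[OF D_measurable[OF x] \<omega>])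
  then have fin: "finite (D x \<omega> \<inter> {t<..})" by (simp add: space_configs)
  have "\<forall>\<^sub>F n in sequentially. \<forall>u\<in>D x \<omega> \<inter> {t<..}. t < grid \<beta> n (next_index \<beta> n t) \<and> grid \<beta> n (next_index \<beta> n t) < u"
    by (rule eventually_ball_finite[OF fin]) (use eventually_next_index[OF \<beta> t] in auto)
  moreover have "\<forall>\<^sub>F n in sequentially. t < grid \<beta> n (next_index \<beta> n t) \<and> grid \<beta> n (next_index \<beta> n t) < t + 1"
    by (rule eventually_next_index[OF \<beta> t]) simp
  ultimately show ?thesis
  proof eventually_elim
    case (elim n)
    let ?g = "grid \<beta> n (next_index \<beta> n t)"
    have "D x \<omega> \<inter> {0..?g} = D x \<omega> \<inter> {0..t}"
    proof (intro equalityI subsetI)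
      fix u assume u: "u \<in> D x \<omega> \<inter> {0..?g}"
      have "u \<le> t"
      proof (rule ccontr)
        assume "\<not> u \<le> t"
        then have "?g < u" using elim(1) u by auto
        then show False using u by auto
      qed
      then show "u \<in> D x \<omega> \<inter> {0..t}" using u by auto
    qed (use elim(2) in auto)
    then show ?case by (simp add: \<sigma>_def spin_def)
  qed
qed

lemma \<sigma>_right_tendsto:
  assumes "\<omega> \<in> space M" "x \<in> torus d N" "t \<in> {0..<\<beta>}"
  shows "(\<lambda>n. \<sigma> \<omega> x (grid \<beta> n (next_index \<beta> n t))) \<longlonglongrightarrow> \<sigma> \<omega> x t"
  by (rule tendsto_eventually[OF \<sigma>_right_limit[OF assms]])

lemma edges_subset: "e \<in> edges d N \<Longrightarrow> e \<subseteq> torus d N"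
  by (auto simp: edges_def)

lemma mean_coupling_tendsto:
  assumes \<omega>: "\<omega> \<in> space M"
  shows "(\<lambda>n. mean_coupling n \<omega>) \<longlonglongrightarrow> interaction d N \<beta> (\<sigma> \<omega>)"
  unfolding mean_coupling_eq interaction_def
proof (intro tendsto_sum tendsto_mult tendsto_const)
  fix e assume e: "e \<in> edges d N"
  have "(\<lambda>n. (\<beta> / real n) *\<^sub>R (\<Sum>j<n. \<Prod>z\<in>e. \<sigma> \<omega> z (grid \<beta> n j))) \<longlonglongrightarrow> (LINT t:{0..<\<beta>}|lborel. \<Prod>z\<in>e. \<sigma> \<omega> z t)"
  proof (rule Riemann_sum_limit[OF \<beta>, where C = 1])
    fix t assume t: "t \<in> {0..<\<beta>}"
    show "(\<lambda>n. \<Prod>z\<in>e. \<sigma> \<omega> z (grid \<beta> n (next_index \<beta> n t))) \<longlonglongrightarrow> (\<Prod>z\<in>e. \<sigma> \<omega> z t)"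
      by (intro tendsto_prod \<sigma>_right_tendsto[OF \<omega> _ t]) (use edges_subset[OF e] in blast)
  qed (simp add: abs_prod \<sigma>_abs)
  then show "(\<lambda>n. \<beta> / real n * (\<Sum>j<n. \<Prod>z\<in>e. \<sigma> \<omega> z (grid \<beta> n j))) \<longlonglongrightarrow> (LINT t:{0..<\<beta>}|lborel. \<Prod>z\<in>e. \<sigma> \<omega> z t)"
    by simp
qed

lemma sampled_gibbs:
  assumes n: "1 \<le> n"
  shows "(\<lambda>\<omega>. \<Phi> (sample n \<omega>) * exp (lam * mean_coupling n \<omega>)) \<in> borel_measurable M"
    "(LINT \<omega>|M. \<Phi> (sample n \<omega>) * exp (lam * mean_coupling n \<omega>))
      = norm_const * (\<Sum>s\<in>conf d N n. \<Phi> s * gibbs d N n (flip_rate n) (lam * \<beta> / real n) s)"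
proof -
  have e: "\<Phi> (sample n \<omega>) * exp (lam * mean_coupling n \<omega>)
    = (\<lambda>s. \<Phi> s * exp (lam * \<beta> / real n * coupling d N n s)) (sample n \<omega>)" for \<omega>
    by (simp add: mean_coupling_def)
  show "(\<lambda>\<omega>. \<Phi> (sample n \<omega>) * exp (lam * mean_coupling n \<omega>)) \<in> borel_measurable M"
    unfolding e by (rule sample_expectation(1)[OF n])
  show "(LINT \<omega>|M. \<Phi> (sample n \<omega>) * exp (lam * mean_coupling n \<omega>))
      = norm_const * (\<Sum>s\<in>conf d N n. \<Phi> s * gibbs d N n (flip_rate n) (lam * \<beta> / real n) s)"
    using sample_expectation(2)[OF n, of "\<lambda>s. \<Phi> s * exp (lam * \<beta> / real n * coupling d N n s)"]
    unfolding e gibbs_def by (simp only: mult_ac)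
qed

lemma flip_rate_bounds: "1 \<le> n \<Longrightarrow> 0 < flip_rate n \<and> flip_rate n < 1"
  using \<delta> \<beta> by (simp add: flip_rate_def)

lemma partition_limit:
  "(\<lambda>m. LINT \<omega>|M. exp (lam * mean_coupling (Suc m) \<omega>)) \<longlonglongrightarrow> partition_function d N lam \<beta> M \<sigma>"
  unfolding partition_function_def
proof (rule bounded_convergence[where C = "exp (\<bar>lam\<bar> * coupling_bound)"])
  show "(\<lambda>\<omega>. exp (lam * mean_coupling (Suc m) \<omega>)) \<in> borel_measurable M" for m
    using sampled_gibbs(1)[of "Suc m" "\<lambda>_. 1" lam] by simp
  show "\<bar>exp (lam * mean_coupling (Suc m) \<omega>)\<bar> \<le> exp (\<bar>lam\<bar> * coupling_bound)" for m \<omega>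
  proof -
    have "lam * mean_coupling (Suc m) \<omega> \<le> \<bar>lam\<bar> * \<bar>mean_coupling (Suc m) \<omega>\<bar>"
      by (metis abs_ge_self abs_mult)
    also have "\<dots> \<le> \<bar>lam\<bar> * coupling_bound" by (intro mult_left_mono mean_coupling_bound) simp
    finally show ?thesis by simp
  qed
  show "(\<lambda>m. exp (lam * mean_coupling (Suc m) \<omega>)) \<longlonglongrightarrow> exp (lam * interaction d N \<beta> (\<sigma> \<omega>))" if "\<omega> \<in> space M" for \<omega>
    by (intro tendsto_exp tendsto_mult tendsto_const LIMSEQ_Suc[OF mean_coupling_tendsto[OF that]])
qed

lemma partition_positive: "0 < partition_function d N lam \<beta> M \<sigma>"
proof -
  have "exp (- (\<bar>lam\<bar> * coupling_bound)) \<le> (LINT \<omega>|M. exp (lam * mean_coupling (Suc m) \<omega>))" for m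
  proof -
    have ge: "exp (- (\<bar>lam\<bar> * coupling_bound)) \<le> exp (lam * mean_coupling (Suc m) \<omega>)"
      and le: "exp (lam * mean_coupling (Suc m) \<omega>) \<le> exp (\<bar>lam\<bar> * coupling_bound)" for \<omega>
    proof -
      have "\<bar>lam * mean_coupling (Suc m) \<omega>\<bar> \<le> \<bar>lam\<bar> * coupling_bound"
        unfolding abs_mult by (intro mult_left_mono mean_coupling_bound) simp
      then show "exp (- (\<bar>lam\<bar> * coupling_bound)) \<le> exp (lam * mean_coupling (Suc m) \<omega>)"
        "exp (lam * mean_coupling (Suc m) \<omega>) \<le> exp (\<bar>lam\<bar> * coupling_bound)" by auto
    qed
    have "integrable M (\<lambda>\<omega>. exp (lam * mean_coupling (Suc m) \<omega>))"
      by (rule integrable_const_bound[where B = "exp (\<bar>lam\<bar> * coupling_bound)"])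
        (use le sampled_gibbs(1)[of "Suc m" "\<lambda>_. 1" lam] in auto)
    from integral_mono[OF integrable_const this ge] show ?thesis by (simp add: prob_space)
  qed
  then have "exp (- (\<bar>lam\<bar> * coupling_bound)) \<le> partition_function d N lam \<beta> M \<sigma>"
    by (intro LIMSEQ_le_const[OF partition_limit]) auto
  then show ?thesis by (rule less_le_trans[rotated]) simp
qed

text \<open>The sampling times are approached from the right and the Gibbs factors are bounded, so numerator and
denominator converge by bounded convergence.\<close>

lemma schwinger_limit:
  assumes x: "x \<in> torus d N" and t: "t \<in> {0..<\<beta>}"
  shows "(\<lambda>n. two_point d N n (flip_rate n) (lam * \<beta> / real n) x (next_index \<beta> n t))
    \<longlonglongrightarrow> schwinger d N lam \<beta> M \<sigma> (origin d, 0) (x, t)"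
proof -
  let ?o = "origin d"
  have o: "?o \<in> torus d N" by (rule origin_torus[OF N])
  define X where "X n \<omega> = \<sigma> \<omega> ?o 0 * \<sigma> \<omega> x (grid \<beta> n (next_index \<beta> n t)) * exp (lam * mean_coupling n \<omega>)" for n \<omega>
  have X: "X n \<omega> = (\<lambda>s. s ?o 0 * s x (next_index \<beta> n t)) (sample n \<omega>) * exp (lam * mean_coupling n \<omega>)"
    if n: "1 \<le> n" for n \<omega>
    using n o x next_index_less[OF n, of \<beta> t] by (simp add: X_def sample_def grid_0[OF \<beta> n])
  have num: "(\<lambda>m. LINT \<omega>|M. X (Suc m) \<omega>)
     \<longlonglongrightarrow> (LINT \<omega>|M. \<sigma> \<omega> ?o 0 * \<sigma> \<omega> x t * exp (lam * interaction d N \<beta> (\<sigma> \<omega>)))"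
  proof (rule bounded_convergence[where C = "exp (\<bar>lam\<bar> * coupling_bound)"])
    show "X (Suc m) \<in> borel_measurable M" for m
    proof -
      have "(\<lambda>\<omega>. (\<lambda>s. s ?o 0 * s x (next_index \<beta> (Suc m) t)) (sample (Suc m) \<omega>) * exp (lam * mean_coupling (Suc m) \<omega>)) \<in> borel_measurable M"
        by (rule sampled_gibbs(1)) simp
      then show ?thesis using X[of "Suc m"] by (simp add: fun_eq_iff cong: measurable_cong)
    qed
    show "\<bar>X (Suc m) \<omega>\<bar> \<le> exp (\<bar>lam\<bar> * coupling_bound)" for m \<omega>
    proof -
      have "lam * mean_coupling (Suc m) \<omega> \<le> \<bar>lam\<bar> * \<bar>mean_coupling (Suc m) \<omega>\<bar>"
        by (metis abs_ge_self abs_mult)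
      also have "\<dots> \<le> \<bar>lam\<bar> * coupling_bound" by (intro mult_left_mono mean_coupling_bound) simp
      finally show ?thesis by (simp add: X_def abs_mult \<sigma>_abs)
    qed
    show "(\<lambda>m. X (Suc m) \<omega>) \<longlonglongrightarrow> \<sigma> \<omega> ?o 0 * \<sigma> \<omega> x t * exp (lam * interaction d N \<beta> (\<sigma> \<omega>))"
      if w: "\<omega> \<in> space M" for \<omega>
      unfolding X_def
      by (intro tendsto_exp tendsto_mult tendsto_const LIMSEQ_Suc[OF mean_coupling_tendsto[OF w]]
          LIMSEQ_Suc[OF \<sigma>_right_tendsto[OF w x t]])
  qed
  have "two_point d N (Suc m) (flip_rate (Suc m)) (lam * \<beta> / real (Suc m)) x (next_index \<beta> (Suc m) t)
     = (LINT \<omega>|M. X (Suc m) \<omega>) / (LINT \<omega>|M. exp (lam * mean_coupling (Suc m) \<omega>))" for m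
  proof -
    have "(LINT \<omega>|M. X (Suc m) \<omega>) = norm_const * (\<Sum>s\<in>conf d N (Suc m). s ?o 0 * s x (next_index \<beta> (Suc m) t)
        * gibbs d N (Suc m) (flip_rate (Suc m)) (lam * \<beta> / real (Suc m)) s)"
      using sampled_gibbs(2)[of "Suc m" "\<lambda>s. s ?o 0 * s x (next_index \<beta> (Suc m) t)" lam] X[of "Suc m"] by simp
    moreover have "(LINT \<omega>|M. exp (lam * mean_coupling (Suc m) \<omega>))
      = norm_const * (\<Sum>s\<in>conf d N (Suc m). gibbs d N (Suc m) (flip_rate (Suc m)) (lam * \<beta> / real (Suc m)) s)"
      using sampled_gibbs(2)[of "Suc m" "\<lambda>_. 1" lam] by simp
    ultimately show ?thesis using norm_const_pos by (simp add: two_point_def)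
  qed
  moreover have "(\<lambda>m. (LINT \<omega>|M. X (Suc m) \<omega>) / (LINT \<omega>|M. exp (lam * mean_coupling (Suc m) \<omega>)))
     \<longlonglongrightarrow> (LINT \<omega>|M. \<sigma> \<omega> ?o 0 * \<sigma> \<omega> x t * exp (lam * interaction d N \<beta> (\<sigma> \<omega>))) / partition_function d N lam \<beta> M \<sigma>"
    by (intro tendsto_divide num partition_limit) (use partition_positive in \<open>simp add: less_imp_neq[symmetric]\<close>)
  ultimately have "(\<lambda>m. two_point d N (Suc m) (flip_rate (Suc m)) (lam * \<beta> / real (Suc m)) x (next_index \<beta> (Suc m) t))
    \<longlonglongrightarrow> schwinger d N lam \<beta> M \<sigma> (?o, 0) (x, t)"
    by (simp add: schwinger_def ising_mean_def)
  then show ?thesis by (rule LIMSEQ_imp_Suc)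
qed

lemma two_point_bound:
  assumes n: "1 \<le> n" and q: "0 < q" "q < 1" and x: "x \<in> torus d N" and j: "j < n"
  shows "\<bar>two_point d N n q \<kappa> x j\<bar> \<le> 1"
proof -
  let ?C = "conf d N n" and ?g = "gibbs d N n q \<kappa>"
  have Z: "0 < (\<Sum>s\<in>?C. ?g s)" by (rule partition_pos[OF N q])
  have one: "\<bar>s y i\<bar> = 1" if "s \<in> ?C" "y \<in> torus d N" "i < n" for s y i
    using rings_spin[OF conf_ring[OF that(1,2)] that(3)] by auto
  have "\<bar>\<Sum>s\<in>?C. s (origin d) 0 * s x j * ?g s\<bar> \<le> (\<Sum>s\<in>?C. \<bar>s (origin d) 0 * s x j * ?g s\<bar>)" by (rule sum_abs)
  also have "\<dots> = (\<Sum>s\<in>?C. ?g s)"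
    using one origin_torus[OF N] x j n gibbs_pos[OF q] by (intro sum.cong refl) (simp add: abs_mult less_imp_le)
  finally show ?thesis using Z by (simp add: two_point_def abs_divide)
qed

lemma Fourier_limit:
  assumes k: "\<forall>j\<in>{1..d}. \<exists>m::int. k j = 2 * pi / (2 * real N) * of_int m"
    and l: "l = 2 * pi / \<beta> * of_int (m :: int)"
  shows "(\<lambda>n. complex_of_real (\<beta> / real n * disc_Fourier d N n (flip_rate n) (lam * \<beta> / real n) k (l * \<beta> / real n)))
    \<longlonglongrightarrow> schwinger_fourier d N lam \<beta> M \<sigma> k l"
proof -
  let ?V = "torus d N"
  define c where "c n x j = two_point d N n (flip_rate n) (lam * \<beta> / real n) x j" for n x j
  define f where "f x n j = complex_of_real (c n x j) * exp (\<i> * complex_of_real (phase d k x))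
      * exp (\<i> * complex_of_real (l * grid \<beta> n j))" for x n j
  have "(\<lambda>n. \<Sum>x\<in>?V. (\<beta> / real n) *\<^sub>R (\<Sum>j<n. f x n j)) \<longlonglongrightarrow> schwinger_fourier d N lam \<beta> M \<sigma> k l"
    unfolding schwinger_fourier_def phase_def[symmetric]
  proof (rule tendsto_sum)
    fix x assume x: "x \<in> ?V"
    show "(\<lambda>n. (\<beta> / real n) *\<^sub>R (\<Sum>j<n. f x n j)) \<longlonglongrightarrow> (LINT t:{0..<\<beta>}|lborel.
        complex_of_real (schwinger d N lam \<beta> M \<sigma> (origin d, 0) (x, t)) *
        exp (\<i> * complex_of_real (phase d k x)) * exp (\<i> * complex_of_real (l * t)))"
    proof (rule Riemann_sum_limit[OF \<beta>, where C = 1])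
      fix n j :: nat assume j: "j < n"
      then have n: "1 \<le> n" by simp
      have "\<bar>c n x j\<bar> \<le> 1" unfolding c_def using flip_rate_bounds[OF n] by (intro two_point_bound n x j) auto
      then show "norm (f x n j) \<le> 1" by (simp add: f_def norm_mult)
    next
      fix t assume t: "t \<in> {0..<\<beta>}"
      show "(\<lambda>n. f x n (next_index \<beta> n t)) \<longlonglongrightarrow> complex_of_real (schwinger d N lam \<beta> M \<sigma> (origin d, 0) (x, t)) *
        exp (\<i> * complex_of_real (phase d k x)) * exp (\<i> * complex_of_real (l * t))"
        unfolding f_def c_def
        by (intro tendsto_mult tendsto_const tendsto_of_real schwinger_limit[OF x t] tendsto_exp next_index_tendsto[OF \<beta> t])
    qed
  qed
  then have limS: "(\<lambda>n. \<Sum>x\<in>?V. (\<beta> / real (Suc n)) *\<^sub>R (\<Sum>j<Suc n. f x (Suc n) j)) \<longlonglongrightarrow> schwinger_fourier d N lam \<beta> M \<sigma> k l"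
    by (rule LIMSEQ_Suc)
  have eq: "(\<Sum>x\<in>?V. (\<beta> / real n) *\<^sub>R (\<Sum>j<n. f x n j))
     = complex_of_real (\<beta> / real n * disc_Fourier d N n (flip_rate n) (lam * \<beta> / real n) k (l * \<beta> / real n))"
    if n: "1 \<le> n" for n
  proof -
    let ?\<theta> = "l * \<beta> / real n"
    have \<theta>: "?\<theta> * real n = 2 * pi * of_int m" using n \<beta> by (simp add: l)
    have g: "l * grid \<beta> n j = ?\<theta> * real j" for j by (simp add: grid_def)
    have fe: "f x n j = complex_of_real (c n x j * cos (phase d k x + ?\<theta> * real j))
       + \<i> * complex_of_real (c n x j * sin (phase d k x + ?\<theta> * real j))" for x j
    proof -
      have "f x n j = complex_of_real (c n x j) * exp (\<i> * complex_of_real (phase d k x + ?\<theta> * real j))"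
        unfolding f_def g by (simp add: exp_add[symmetric] distrib_left mult.assoc)
      also have "\<dots> = complex_of_real (c n x j) * cis (phase d k x + ?\<theta> * real j)" by (simp only: cis_conv_exp)
      finally show ?thesis by (simp add: complex_eq_iff)
    qed
    have im: "(\<Sum>x\<in>?V. \<Sum>j<n. c n x j * sin (phase d k x + ?\<theta> * real j)) = 0"
      unfolding c_def using flip_rate_bounds[OF n] by (intro two_point_Fourier_sin[OF N n _ _ k \<theta>]) auto
    have "(\<Sum>x\<in>?V. \<Sum>j<n. f x n j) = complex_of_real (\<Sum>x\<in>?V. \<Sum>j<n. c n x j * cos (phase d k x + ?\<theta> * real j))
      + \<i> * complex_of_real (\<Sum>x\<in>?V. \<Sum>j<n. c n x j * sin (phase d k x + ?\<theta> * real j))"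
      unfolding fe of_real_sum sum_distrib_left sum.distrib ..
    then have "(\<Sum>x\<in>?V. \<Sum>j<n. f x n j) = complex_of_real (\<Sum>x\<in>?V. \<Sum>j<n. c n x j * cos (phase d k x + ?\<theta> * real j))"
      unfolding im by simp
    also have "\<dots> = complex_of_real (disc_Fourier d N n (flip_rate n) (lam * \<beta> / real n) k ?\<theta>)"
      by (simp only: disc_Fourier_def c_def)
    finally have "(\<Sum>x\<in>?V. \<Sum>j<n. f x n j) = complex_of_real (disc_Fourier d N n (flip_rate n) (lam * \<beta> / real n) k ?\<theta>)" .
    then show ?thesis unfolding scaleR_right.sum[symmetric] by (simp add: scaleR_conv_of_real)
  qed
  have "1 \<le> Suc n" for n by simp
  note limS[unfolded eq[OF this]]
  then show ?thesis by (rule LIMSEQ_imp_Suc)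
qed

text \<open>The bounds of the discrete model are multiplied by the powers of \<open>n\<close> that give them a limit: with
\<open>q = flip_rate n\<close>, \<open>n * (1 - q)\<close> tends to \<open>2 * \<delta> * \<beta>\<close> and \<open>n\<^sup>2 * (2 - 2 * cos (l * \<beta> / n))\<close>
tends to \<open>(l * \<beta>)\<^sup>2\<close>.\<close>

theorem infrared_bound_Fourier:
  assumes lam: "0 < lam"
    and k: "\<forall>j\<in>{1..d}. \<exists>m::int. k j = 2 * pi / (2 * real N) * of_int m"
    and l: "\<exists>m::int. l = 2 * pi / \<beta> * of_int m"
  shows "schwinger_fourier d N lam \<beta> M \<sigma> k l \<in> \<real>"
    "2 * lam * L_hat d k * Re (schwinger_fourier d N lam \<beta> M \<sigma> k l) \<le> 1"
    "l\<^sup>2 * Re (schwinger_fourier d N lam \<beta> M \<sigma> k l) \<le> 32 * \<delta>"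
proof -
  obtain m :: int where m: "l = 2 * pi / \<beta> * of_int m" using l by blast
  let ?c = "schwinger_fourier d N lam \<beta> M \<sigma> k l"
  define F where "F n = \<beta> / real n * disc_Fourier d N n (flip_rate n) (lam * \<beta> / real n) k (l * \<beta> / real n)" for n
  have lim: "(\<lambda>n. complex_of_real (F n)) \<longlonglongrightarrow> ?c" unfolding F_def by (rule Fourier_limit[OF k m])
  show "?c \<in> \<real>"
    by (rule closed_sequentially[OF closed_complex_Reals _ lim]) simp
  have limF: "F \<longlonglongrightarrow> Re ?c" using tendsto_Re[OF lim] by simp
  have \<theta>: "l * \<beta> / real n * real n = 2 * pi * of_int m" if "1 \<le> n" for n using that \<beta> by (simp add: m)
  have "2 * lam * L_hat d k * F n \<le> 1" if n: "1 \<le> n" for n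
  proof -
    have "lam * \<beta> / real n * (2 * L_hat d k) * disc_Fourier d N n (flip_rate n) (lam * \<beta> / real n) k (l * \<beta> / real n) \<le> 1"
      by (rule disc_spatial_bound[OF N n _ _ _ k \<theta>[OF n]]) (use flip_rate_bounds[OF n] lam \<beta> n in auto)
    then show ?thesis by (simp add: F_def mult_ac)
  qed
  then show "2 * lam * L_hat d k * Re ?c \<le> 1"
    by (intro LIMSEQ_le_const2[OF tendsto_mult[OF tendsto_const limF]]) auto
  define v where "v = card (torus d N)"
  have bound: "((1 + flip_rate n) / 2) ^ v * ((real n)\<^sup>2 * (2 - 2 * cos (l * \<beta> / real n))) * F n
     \<le> \<beta> * (8 * (2 * (real n * (1 - flip_rate n)) + real v * (real n * (1 - flip_rate n)) * (1 - flip_rate n)))"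
    if n: "2 \<le> n" for n
  proof -
    define q where "q = exp (- (\<delta> * (\<beta> / real n)))"
    have q: "0 < q" "q < 1" using n \<delta> \<beta> by (simp_all add: q_def)
    have q2: "q\<^sup>2 = flip_rate n" by (simp add: q_def flip_rate_def power2_eq_square exp_add[symmetric])
    have "1 \<le> n" using n by simp
    have "((1 + flip_rate n) / 2) ^ v * (2 - 2 * cos (l * \<beta> / real n)) * disc_Fourier d N n (flip_rate n) (lam * \<beta> / real n) k (l * \<beta> / real n)
       \<le> 8 * (2 * (1 - flip_rate n) + real v * (1 - flip_rate n)\<^sup>2)"
      using disc_temporal_bound[OF N n q k \<theta>[OF \<open>1 \<le> n\<close>], of "lam * \<beta> / real n"] unfolding q2 v_def .
    then have "\<beta> * real n * (((1 + flip_rate n) / 2) ^ v * (2 - 2 * cos (l * \<beta> / real n)) * disc_Fourier d N n (flip_rate n) (lam * \<beta> / real n) k (l * \<beta> / real n))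
       \<le> \<beta> * real n * (8 * (2 * (1 - flip_rate n) + real v * (1 - flip_rate n)\<^sup>2))"
      using \<beta> by (intro mult_left_mono) auto
    moreover have "(real n)\<^sup>2 * (\<beta> / real n) = \<beta> * real n" using n by (simp add: power2_eq_square)
    ultimately show ?thesis unfolding F_def by (simp add: power2_eq_square algebra_simps)
  qed
  have fr: "flip_rate \<longlonglongrightarrow> 1" unfolding flip_rate_def by real_asymp
  have nfr: "(\<lambda>n. real n * (1 - flip_rate n)) \<longlonglongrightarrow> 2 * (\<delta> * \<beta>)"
    unfolding flip_rate_def using \<delta> \<beta> by real_asymp
  have cosl: "(\<lambda>n. (real n)\<^sup>2 * (2 - 2 * cos (l * \<beta> / real n))) \<longlonglongrightarrow> (l * \<beta>)\<^sup>2"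
  proof -
    have "(\<lambda>n. (real n)\<^sup>2 * (2 - 2 * cos (a / real n))) \<longlonglongrightarrow> a * a" for a :: real
    proof -
      consider "a > 0" | "a = 0" | "a < 0" by linarith
      then show ?thesis by cases (real_asymp, simp, real_asymp)
    qed
    then show ?thesis unfolding power2_eq_square[of "l * \<beta>"] .
  qed
  have "((1 + 1) / 2) ^ v * (l * \<beta>)\<^sup>2 * Re ?c
     \<le> \<beta> * (8 * (2 * (2 * (\<delta> * \<beta>)) + real v * (2 * (\<delta> * \<beta>)) * (1 - 1)))"
  proof (rule LIMSEQ_le)
    show "(\<lambda>n. ((1 + flip_rate n) / 2) ^ v * ((real n)\<^sup>2 * (2 - 2 * cos (l * \<beta> / real n))) * F n)
       \<longlonglongrightarrow> ((1 + 1) / 2) ^ v * (l * \<beta>)\<^sup>2 * Re ?c"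
      by (intro tendsto_intros fr cosl limF) simp
    show "(\<lambda>n. \<beta> * (8 * (2 * (real n * (1 - flip_rate n)) + real v * (real n * (1 - flip_rate n)) * (1 - flip_rate n))))
      \<longlonglongrightarrow> \<beta> * (8 * (2 * (2 * (\<delta> * \<beta>)) + real v * (2 * (\<delta> * \<beta>)) * (1 - 1)))"
      by (intro tendsto_mult tendsto_add tendsto_diff tendsto_const fr nfr)
    show "\<exists>n0. \<forall>n\<ge>n0. ((1 + flip_rate n) / 2) ^ v * ((real n)\<^sup>2 * (2 - 2 * cos (l * \<beta> / real n))) * F n
     \<le> \<beta> * (8 * (2 * (real n * (1 - flip_rate n)) + real v * (real n * (1 - flip_rate n)) * (1 - flip_rate n)))"
      using bound by blast
  qed
  then have "\<beta>\<^sup>2 * (l\<^sup>2 * Re ?c) \<le> \<beta>\<^sup>2 * (32 * \<delta>)"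
    by (simp add: power_mult_distrib power2_eq_square mult_ac)
  then show "l\<^sup>2 * Re ?c \<le> 32 * \<delta>" using \<beta> by (simp add: mult_le_cancel_left_pos)
qed

end

theorem theorem1p2:
  fixes d N :: nat and lam \<delta> \<beta> :: real
    and M :: "'w measure"
    and D :: "vertex \<Rightarrow> 'w \<Rightarrow> real set"
    and \<xi> :: "vertex \<Rightarrow> 'w \<Rightarrow> nat"
    and k :: "nat \<Rightarrow> real" and l :: real
  assumes "d \<ge> 1" and "N \<ge> 1" and "lam > 0" and "\<delta> > 0" and "\<beta> > 0"
    and "prob_space M"
    and "prob_space.indep_vars M (\<lambda>_. configs \<beta>) D (torus d N)"
    and "\<forall>x\<in>torus d N. even_poisson_law \<delta> \<beta> (distr M (configs \<beta>) (D x))"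
    and "prob_space.indep_vars M (\<lambda>_. count_space UNIV) \<xi> (torus d N)"
    and "\<forall>x\<in>torus d N. distr M (count_space UNIV) (\<xi> x) = measure_pmf (pmf_of_set {0, 1})"
    and "prob_space.indep_set M
           (sets (vimage_algebra (space M) (\<lambda>\<omega>. \<lambda>x\<in>torus d N. D x \<omega>)
              (\<Pi>\<^sub>M x\<in>torus d N. configs \<beta>)))
           (sets (vimage_algebra (space M) (\<lambda>\<omega>. \<lambda>x\<in>torus d N. \<xi> x \<omega>)
              (\<Pi>\<^sub>M x\<in>torus d N. count_space UNIV)))"
    and "\<forall>j\<in>{1..d}. \<exists>m::int. k j = 2 * pi / (2 * real N) * of_int m"
    and "\<exists>m::int. l = 2 * pi / \<beta> * of_int m"
  shows "let \<sigma> = (\<lambda>\<omega>. spin (\<lambda>x. D x \<omega>) (\<lambda>x. \<xi> x \<omega>));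
             c_hat = schwinger_fourier d N lam \<beta> M \<sigma> k l
         in c_hat \<in> \<real> \<and>
            ereal (Re c_hat) \<le> ereal 48 / ereal (2 * lam * L_hat d k + l\<^sup>2 / (2 * \<delta>))"
proof -
  interpret prob_space M by fact
  interpret space_time_spins M d N \<delta> \<beta> D \<xi>
    by unfold_locales (use assms in auto)
  define c where "c = schwinger_fourier d N lam \<beta> M \<sigma> k l"
  define E where "E = 2 * lam * L_hat d k + l\<^sup>2 / (2 * \<delta>)"
  note bounds = infrared_bound_Fourier[OF assms(3,12,13), folded c_def]
  have sig: "(\<lambda>\<omega>. spin (\<lambda>x. D x \<omega>) (\<lambda>x. \<xi> x \<omega>)) = \<sigma>" by (simp add: fun_eq_iff \<sigma>_def)
  have L: "0 \<le> 2 * lam * L_hat d k" using assms(3) by (simp add: L_hat_def sum_nonneg)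
  have E0: "0 \<le> E" using L assms(4) by (simp add: E_def)
  have "l\<^sup>2 / (2 * \<delta>) * Re c \<le> 16" using bounds(3) assms(4) by (simp add: field_simps)
  then have Ec: "E * Re c \<le> 48" using bounds(2) by (simp add: E_def distrib_right)
  have "ereal (Re c) \<le> ereal 48 / ereal E"
  proof (cases "E = 0")
    case True
    then show ?thesis by (simp add: divide_ereal_def)
  next
    case False
    then show ?thesis using Ec E0 by (simp add: field_simps)
  qed
  then show ?thesis unfolding Let_def sig c_def[symmetric] E_def[symmetric] using bounds(1) by simp
qed

end
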